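(* Let $\alpha > -1$ and let $r, l$ be integers with $1 \le r \le l$. Then there exists a constant $C = C(\alpha,l,r) > 0$ such that for every integer $N \ge 1$ and every $u \in \mathrm{H}^l_{\rho^\alpha}(B^2)$, $$\| u - \mathrm{Proj}^{(\alpha)}_N(u) \|_{\mathrm{H}^r_{\rho^\alpha}(B^2)} \le C \, N^{-1/2+2r-l} \, \| u \|_{\mathrm{H}^l_{\rho^\alpha}(B^2)}.$$
   Context: $B^2=\{x\in\mathbb{R}^2 : |x|<1\}$ is the open unit disk and $\rho(x) = 1-|x|^2$. For $\alpha>-1$, $\mathrm{L}^2_{\rho^\alpha}(B^2)$ is the space of (classes of) measurable $u\colon B^2\to\mathbb{C}$ with $\|u\|_{\mathrm{L}^2_{\rho^\alpha}(B^2)}^2 = \int_{B^2}|u|^2\rho^\alpha<\infty$, with inner product $\langle u,v\rangle=\int_{B^2} u\,\overline{v}\,\rho^\alpha$. For $m\in\{0,1,2,\dots\}$, $\mathrm{H}^m_{\rho^\alpha}(B^2)$ is the space of $u\in \mathrm{L}^2_{\rho^\alpha}(B^2)$ whose weak derivatives up to order $m$ lie in $\mathrm{L}^2_{\rho^\alpha}(B^2)$, with norm $\|u\|_{\mathrm{H}^m_{\rho^\alpha}(B^2)}^2=\sum_{k=0}^m\sum_{|\beta|=k}\|\partial_\beta u\|_{\mathrm{L}^2_{\rho^\alpha}(B^2)}^2$ ($\beta$ ranging over multi-indices). $\mathrm{Proj}^{(\alpha)}_N$ is the $\mathrm{L}^2_{\rho^\alpha}(B^2)$-orthogonal projection onto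 the space $\Pi^2_N$ of complex polynomials in two variables of total degree at most $N$. *)

theory Defs
  imports "HOL-Analysis.Analysis"
begin

text \<open>Elements of the function spaces are represented by functions \<open>real ^ 2 \<Rightarrow> complex\<close>; only
  their values on the disk, up to Lebesgue-null sets, matter.\<close>

definition unit_disk :: "(real ^ 2) set" where
  "unit_disk = {x. norm x < 1}"

definition rho :: "real ^ 2 \<Rightarrow> real" where
  "rho x = 1 - (norm x)\<^sup>2"

definition L2w :: "real \<Rightarrow> (real ^ 2 \<Rightarrow> complex) set" where
  "L2w \<alpha> = {u. u \<in> borel_measurable (lebesgue_on unit_disk) \<and>
     integrable (lebesgue_on unit_disk) (\<lambda>x. (norm (u x))\<^sup>2 * rho x powr \<alpha>)}"

definition L2w_inner :: "real \<Rightarrow> (real ^ 2 \<Rightarrow> complex) \<Rightarrow> (real ^ 2 \<Rightarrow> complex) \<Rightarrow> complex" where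
  "L2w_inner \<alpha> u v =
     (LINT x|lebesgue_on unit_disk. u x * cnj (v x) * of_real (rho x powr \<alpha>))"

definition L2w_norm :: "real \<Rightarrow> (real ^ 2 \<Rightarrow> complex) \<Rightarrow> real" where
  "L2w_norm \<alpha> u = sqrt (LINT x|lebesgue_on unit_disk. (norm (u x))\<^sup>2 * rho x powr \<alpha>)"


text \<open>A multi-index is a pair \<open>\<beta> = (\<beta>\<^sub>1, \<beta>\<^sub>2)\<close>.\<close>

definition partial :: "2 \<Rightarrow> (real ^ 2 \<Rightarrow> complex) \<Rightarrow> real ^ 2 \<Rightarrow> complex" where
  "partial i f x = vector_derivative (\<lambda>t. f (x + t *\<^sub>R axis i 1)) (at 0)"

definition partials :: "nat \<times> nat \<Rightarrow> (real ^ 2 \<Rightarrow> complex) \<Rightarrow> real ^ 2 \<Rightarrow> complex" where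
  "partials \<beta> f = (partial 1 ^^ fst \<beta>) ((partial 2 ^^ snd \<beta>) f)"

definition multi_indices :: "nat \<Rightarrow> (nat \<times> nat) set" where
  "multi_indices k = {\<beta>. fst \<beta> + snd \<beta> = k}"

text \<open>\<open>C\<^sup>\<infinity>\<close>: every iterated partial derivative, in whatever order, is differentiable
  (hence continuous) everywhere.\<close>

definition smooth :: "(real ^ 2 \<Rightarrow> complex) \<Rightarrow> bool" where
  "smooth f \<longleftrightarrow> (\<forall>ds :: 2 list. foldr partial ds f differentiable_on UNIV)"

definition test_function :: "(real ^ 2 \<Rightarrow> complex) \<Rightarrow> bool" where
  "test_function \<phi> \<longleftrightarrow> smooth \<phi> \<and> closure {x. \<phi> x \<noteq> 0} \<subseteq> unit_disk"

definition locally_integrable :: "(real ^ 2 \<Rightarrow> complex) \<Rightarrow> bool" where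
  "locally_integrable u \<longleftrightarrow>
     (\<forall>K. compact K \<and> K \<subseteq> unit_disk \<longrightarrow> u absolutely_integrable_on K)"

definition has_weak_deriv ::
    "nat \<times> nat \<Rightarrow> (real ^ 2 \<Rightarrow> complex) \<Rightarrow> (real ^ 2 \<Rightarrow> complex) \<Rightarrow> bool" where
  "has_weak_deriv \<beta> u v \<longleftrightarrow> locally_integrable u \<and> locally_integrable v \<and>
     (\<forall>\<phi>. test_function \<phi> \<longrightarrow>
        (LINT x|lebesgue_on unit_disk. u x * partials \<beta> \<phi> x) =
        (-1) ^ (fst \<beta> + snd \<beta>) * (LINT x|lebesgue_on unit_disk. v x * \<phi> x))"

text \<open>Weak derivatives are unique up to null sets, so the norm below does not depend on the
  representative chosen here.\<close>

definition weak_deriv :: "nat \<times> nat \<Rightarrow> (real ^ 2 \<Rightarrow> complex) \<Rightarrow> real ^ 2 \<Rightarrow> complex" where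
  "weak_deriv \<beta> u = (SOME v. has_weak_deriv \<beta> u v)"

definition Hw :: "nat \<Rightarrow> real \<Rightarrow> (real ^ 2 \<Rightarrow> complex) set" where
  "Hw m \<alpha> = {u \<in> L2w \<alpha>. \<forall>k\<le>m. \<forall>\<beta>\<in>multi_indices k. \<exists>v\<in>L2w \<alpha>. has_weak_deriv \<beta> u v}"

definition Hw_norm :: "nat \<Rightarrow> real \<Rightarrow> (real ^ 2 \<Rightarrow> complex) \<Rightarrow> real" where
  "Hw_norm m \<alpha> u =
     sqrt (\<Sum>k\<le>m. \<Sum>\<beta>\<in>multi_indices k. (L2w_norm \<alpha> (weak_deriv \<beta> u))\<^sup>2)"


definition polys :: "nat \<Rightarrow> (real ^ 2 \<Rightarrow> complex) set" where
  "polys N = {p. \<exists>c :: nat \<times> nat \<Rightarrow> complex. p =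
     (\<lambda>x. \<Sum>k\<le>N. \<Sum>\<beta>\<in>multi_indices k. c \<beta> * of_real ((x $ 1) ^ fst \<beta> * (x $ 2) ^ snd \<beta>))}"

definition Proj :: "real \<Rightarrow> nat \<Rightarrow> (real ^ 2 \<Rightarrow> complex) \<Rightarrow> real ^ 2 \<Rightarrow> complex" where
  "Proj \<alpha> N u = (THE p. p \<in> polys N \<and> (\<forall>q\<in>polys N. L2w_inner \<alpha> (\<lambda>x. u x - p x) q = 0))"

end

theory Submission
  imports Defs
begin

text \<open>
  Integration by parts gives \<open>\<partial>\<^sub>j (Proj a (n + 1) u) = Proj (a + 1) n (\<partial>\<^sub>j u)\<close>, and the rotation field
  \<open>x\<^sub>1 \<partial>\<^sub>2 - x\<^sub>2 \<partial>\<^sub>1\<close> commutes with \<open>Proj a n\<close>. The Dirichlet form with weight exponent \<open>a + 1\<close> on the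
  gradient and \<open>a\<close> on the angular derivative acts on the orthogonal polynomials of degree \<open>k\<close> as
  multiplication by \<open>k (k + 2 a + 2)\<close>. By induction on \<open>l\<close> this yields an error of order \<open>N powr - l\<close>
  in the weighted \<open>L\<^sup>2\<close> norm, and it also gives the Markov inequality \<open>|\<partial>\<^sub>j p| \<le> C N\<^sup>2 |p|\<close> for
  polynomials of degree \<open>N\<close>.

  With \<open>w = \<partial>\<^sub>j u\<close> and \<open>z = w - Proj a n w\<close> one has \<open>\<partial>\<^sub>j (u - Proj a (n + 1) u) = z - Proj (a + 1) n z\<close>.
  Since \<open>z\<close> is orthogonal to the polynomials of degree \<open>n\<close> for the exponent \<open>a\<close>, the polynomial
  \<open>Proj (a + 1) n z\<close> has only components of degrees \<open>n\<close> and \<open>n - 1\<close> for the exponent \<open>a + 1\<close>, and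
  on such components the two norms differ by a factor of order \<open>n powr (1/2)\<close>. That factor and the
  factor \<open>N\<^sup>2\<close> which the Markov inequality costs for each further derivative make up the exponent.
\<close>

section \<open>Polynomials and partial derivatives\<close>

text \<open>No orthogonal basis is written down. On a monomial \<open>diffop\<close> is a scalar
  depending only on the degree, up to terms of lower degree, and its form is symmetric; that alone
  separates the orthogonal degree components. The angular term makes the scalar possible: the
  weighted gradient alone gives \<open>|x|^2\<close> times the Laplacian in top degree, which is no
  scalar on homogeneous polynomials, and subtracting the square of the rotation field leaves the
  square of the Euler field. The obstacle is a mismatch of weights: the derivative of a projection
  is a projection for exponent \<open>a + 1\<close>, while the error is measured with exponent
  \<open>a\<close>, where the norm is stronger. For the same reason the \<open>L2\<close> estimate
  is proved for all \<open>a > -1\<close> at once. Weak derivatives are known only through test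
  functions supported inside the disk. Integration by parts against the weight therefore uses a
  polynomial times a smooth cutoff of \<open>rho\<close>, and the cutoff is removed by dominated
  convergence.\<close>

definition mon :: "nat \<Rightarrow> nat \<Rightarrow> real ^ 2 \<Rightarrow> complex" where
  "mon a b x = of_real ((x $ 1) ^ a * (x $ 2) ^ b)"

lemma finite_multi_indices [simp]: "finite (multi_indices k)"
proof (rule finite_subset)
  show "multi_indices k \<subseteq> {..k} \<times> {..k}" by (auto simp: multi_indices_def)
qed simp

lemma polys_iff:
  "p \<in> polys N \<longleftrightarrow> (\<exists>c. p = (\<lambda>x. \<Sum>k\<le>N. \<Sum>\<beta>\<in>multi_indices k. c \<beta> * mon (fst \<beta>) (snd \<beta>) x))"
  by (simp add: polys_def mon_def)

lemma polys_add: "p \<in> polys N \<Longrightarrow> q \<in> polys N \<Longrightarrow> (\<lambda>x. p x + q x) \<in> polys N"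
  unfolding polys_iff
  apply (elim exE)
  subgoal for c d
    by (rule exI[of _ "\<lambda>\<beta>. c \<beta> + d \<beta>"]) (simp add: distrib_right sum.distrib)
  done

lemma polys_scale: "p \<in> polys N \<Longrightarrow> (\<lambda>x. c * p x) \<in> polys N"
  unfolding polys_iff
  apply (elim exE)
  subgoal for d
    by (rule exI[of _ "\<lambda>\<beta>. c * d \<beta>"]) (simp add: sum_distrib_left mult.assoc)
  done

lemma polys_zero: "(\<lambda>x. 0) \<in> polys N"
  unfolding polys_iff by (rule exI[of _ "\<lambda>_. 0"]) simp

lemma mon_in_polys:
  assumes "a + b \<le> N"
  shows "mon a b \<in> polys N"
proof -
  have "(\<Sum>\<beta>\<in>multi_indices k. (if \<beta> = (a, b) then 1 else 0) * mon (fst \<beta>) (snd \<beta>) x)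
      = (if k = a + b then mon a b x else 0)" for k x
  proof -
    have "(\<Sum>\<beta>\<in>multi_indices k. (if \<beta> = (a, b) then 1 else 0) * mon (fst \<beta>) (snd \<beta>) x)
      = (\<Sum>\<beta>\<in>multi_indices k. if \<beta> = (a, b) then mon a b x else 0)"
      by (rule sum.cong) auto
    also have "\<dots> = (if (a, b) \<in> multi_indices k then mon a b x else 0)"
      by (rule sum.delta) simp
    also have "(a, b) \<in> multi_indices k \<longleftrightarrow> k = a + b" by (auto simp: multi_indices_def)
    finally show ?thesis .
  qed
  then have "(\<lambda>x. \<Sum>k\<le>N. \<Sum>\<beta>\<in>multi_indices k. (if \<beta> = (a, b) then 1 else 0) * mon (fst \<beta>) (snd \<beta>) x) = mon a b"
    using assms by (simp add: fun_eq_iff)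
  then show ?thesis unfolding polys_iff
    by (intro exI[of _ "\<lambda>\<beta>. if \<beta> = (a, b) then 1 else 0"]) (rule sym)
qed

lemma polys_sum:
  "finite A \<Longrightarrow> (\<And>i. i \<in> A \<Longrightarrow> f i \<in> polys N) \<Longrightarrow> (\<lambda>x. \<Sum>i\<in>A. f i x) \<in> polys N"
  by (induction A rule: finite_induct) (auto intro: polys_zero polys_add)

lemma sum_closed_induct:
  assumes "finite A" and "P (\<lambda>x. 0)" and "\<And>f g. P f \<Longrightarrow> P g \<Longrightarrow> P (\<lambda>x. f x + g x)"
    and "\<And>i. i \<in> A \<Longrightarrow> P (f i)"
  shows "P (\<lambda>x. \<Sum>i\<in>A. f i x)"
  using assms(1,4) by (induction A rule: finite_induct) (auto intro: assms(2,3))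

text \<open>Facts that are linear in the polynomial are thereby reduced to monomials. Case
  \<open>add\<close> also hands over membership of both summands, because additivity of
  \<open>partial\<close> and of the integrals needs differentiability or integrability of
  each.\<close>

lemma polys_induct [consumes 1, case_names zero add mon]:
  assumes "p \<in> polys N"
    and zero: "P (\<lambda>x. 0)" and add: "\<And>f g. f \<in> polys N \<Longrightarrow> g \<in> polys N \<Longrightarrow> P f \<Longrightarrow> P g \<Longrightarrow> P (\<lambda>x. f x + g x)"
    and mon: "\<And>c a b. a + b \<le> N \<Longrightarrow> P (\<lambda>x. c * mon a b x)"
  shows "P p"
proof -
  obtain c where c: "p = (\<lambda>x. \<Sum>k\<le>N. \<Sum>\<beta>\<in>multi_indices k. c \<beta> * mon (fst \<beta>) (snd \<beta>) x)"
    using assms(1) by (auto simp: polys_iff)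
  let ?Q = "\<lambda>f. f \<in> polys N \<and> P f"
  have "?Q p" unfolding c
  proof (rule sum_closed_induct[where P = ?Q])
    fix k assume "k \<in> {..N}"
    show "?Q (\<lambda>x. \<Sum>\<beta>\<in>multi_indices k. c \<beta> * mon (fst \<beta>) (snd \<beta>) x)"
    proof (rule sum_closed_induct[where P = ?Q])
      fix \<beta> assume "\<beta> \<in> multi_indices k"
      then have "fst \<beta> + snd \<beta> \<le> N" using \<open>k \<in> _\<close> by (auto simp: multi_indices_def)
      then show "?Q (\<lambda>x. c \<beta> * mon (fst \<beta>) (snd \<beta>) x)"
        by (auto intro: mon polys_scale mon_in_polys)
    qed (auto simp: polys_zero zero intro: polys_add add)
  qed (auto simp: polys_zero zero intro: polys_add add)
  then show ?thesis by simp
qed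

lemma polys_mono: "p \<in> polys M \<Longrightarrow> M \<le> N \<Longrightarrow> p \<in> polys N"
proof (induction rule: polys_induct)
  case (mon c a b)
  then show ?case by (intro polys_scale mon_in_polys) simp
qed (simp_all add: polys_zero polys_add)

lemma polys_uminus: "p \<in> polys N \<Longrightarrow> (\<lambda>x. - p x) \<in> polys N"
  using polys_scale[of p N "-1"] by simp

lemma polys_diff: "p \<in> polys N \<Longrightarrow> q \<in> polys N \<Longrightarrow> (\<lambda>x. p x - q x) \<in> polys N"
  using polys_add[OF _ polys_uminus, of p N q] by simp

lemma mon_mult: "mon a b x * mon c d x = mon (a + c) (b + d) x"
  by (simp add: mon_def power_add)

lemma polys_mult:
  assumes p: "p \<in> polys M" and q: "q \<in> polys N"
  shows "(\<lambda>x. p x * q x) \<in> polys (M + N)"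
  using p
proof (induction rule: polys_induct)
  case (mon c a b)
  show ?case using q
  proof (induction rule: polys_induct)
    case (mon c' a' b')
    have "(\<lambda>x. c * mon a b x * (c' * mon a' b' x)) = (\<lambda>x. (c * c') * mon (a + a') (b + b') x)"
      by (simp add: fun_eq_iff mult_ac flip: mon_mult)
    then show ?case using mon \<open>a + b \<le> M\<close> by (auto intro!: polys_scale mon_in_polys)
  qed (auto simp: polys_zero distrib_left intro: polys_add)
qed (auto simp: polys_zero distrib_right intro: polys_add)

lemma polys_cnj: "p \<in> polys N \<Longrightarrow> (\<lambda>x. cnj (p x)) \<in> polys N"
proof (induction rule: polys_induct)
  case (mon c a b)
  have "(\<lambda>x. cnj (c * mon a b x)) = (\<lambda>x. cnj c * mon a b x)" by (simp add: mon_def fun_eq_iff)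
  then show ?case using mon by (auto intro!: polys_scale mon_in_polys)
qed (auto simp: polys_zero intro: polys_add)

lemma polys_const: "(\<lambda>x. c) \<in> polys N"
  using polys_scale[OF mon_in_polys[of 0 0 N], of c] by (simp add: mon_def)

lemma polys_coord: "(\<lambda>x. of_real (x $ j)) \<in> polys (Suc 0)"
proof -
  have *: "(\<lambda>x::real^2. complex_of_real (x $ 1)) = mon 1 0" "(\<lambda>x::real^2. complex_of_real (x $ 2)) = mon 0 1"
    by (auto simp: mon_def fun_eq_iff)
  show ?thesis using exhaust_2[of j] by (auto simp: * intro!: mon_in_polys)
qed

lemma polys_mult_coord: "p \<in> polys N \<Longrightarrow> (\<lambda>x. of_real (x $ j) * p x) \<in> polys (Suc N)"
  using polys_mult[OF polys_coord[of j], of p N] by simp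

lemma rho_eq: "rho x = 1 - (x $ 1)\<^sup>2 - (x $ 2)\<^sup>2"
  by (simp add: rho_def norm_vec_def L2_set_def sum_2 real_sqrt_pow2)

lemma polys_rho: "p \<in> polys N \<Longrightarrow> (\<lambda>x. of_real (rho x) * p x) \<in> polys (N + 2)"
proof -
  assume p: "p \<in> polys N"
  have "(\<lambda>x. of_real (rho x) * p x) =
     (\<lambda>x. (p x - of_real (x $ 1) * (of_real (x $ 1) * p x)) - of_real (x $ 2) * (of_real (x $ 2) * p x))"
    by (simp add: rho_eq fun_eq_iff power2_eq_square left_diff_distrib mult.assoc)
  also have "\<dots> \<in> polys (Suc (Suc N))"
    using p by (intro polys_diff polys_mult_coord polys_mono[OF p]) auto
  finally show ?thesis by simp
qed

lemma partial_eqI: "(f has_derivative f') (at x) \<Longrightarrow> partial i f x = f' (axis i 1)"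
proof -
  assume d: "(f has_derivative f') (at x)"
  have g: "((\<lambda>t. x + t *\<^sub>R axis i 1) has_derivative (\<lambda>t. t *\<^sub>R axis i (1::real))) (at (0::real))"
    by (rule derivative_eq_intros refl | simp)+
  have "((\<lambda>t. f (x + t *\<^sub>R axis i 1)) has_derivative (\<lambda>t. f' (t *\<^sub>R axis i 1))) (at (0::real))"
    by (rule has_derivative_compose[OF g]) (simp add: d)
  moreover have "f' (t *\<^sub>R axis i 1) = t *\<^sub>R f' (axis i 1)" for t
    using d has_derivative_linear linear_scale by blast
  ultimately have "((\<lambda>t. f (x + t *\<^sub>R axis i 1)) has_vector_derivative f' (axis i 1)) (at 0)"
    by (simp add: has_vector_derivative_def)
  then show ?thesis unfolding partial_def by (rule vector_derivative_at)
qed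

lemma partial_diff_eq: "f differentiable (at x) \<Longrightarrow> partial i f x = frechet_derivative f (at x) (axis i 1)"
  by (rule partial_eqI) (simp add: frechet_derivative_works)

lemma partial_add:
  "f differentiable (at x) \<Longrightarrow> g differentiable (at x) \<Longrightarrow>
   partial i (\<lambda>x. f x + g x) x = partial i f x + partial i g x"
  by (rule trans[OF partial_eqI[OF has_derivative_add[OF frechet_derivative_works[THEN iffD1] frechet_derivative_works[THEN iffD1]]]])
    (simp_all add: partial_diff_eq)

lemma partial_diff:
  "f differentiable (at x) \<Longrightarrow> g differentiable (at x) \<Longrightarrow>
   partial i (\<lambda>x. f x - g x) x = partial i f x - partial i g x"
  by (rule trans[OF partial_eqI[OF has_derivative_diff[OF frechet_derivative_works[THEN iffD1] frechet_derivative_works[THEN iffD1]]]])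
    (simp_all add: partial_diff_eq)

lemma partial_mult:
  "f differentiable (at x) \<Longrightarrow> g differentiable (at x) \<Longrightarrow>
   partial i (\<lambda>x. f x * g x) x = f x * partial i g x + partial i f x * g x"
  by (rule trans[OF partial_eqI[OF has_derivative_mult[OF frechet_derivative_works[THEN iffD1] frechet_derivative_works[THEN iffD1]]]])
    (simp_all add: partial_diff_eq)

lemma partial_const: "partial i (\<lambda>x. c) x = 0"
  by (rule partial_eqI) (rule has_derivative_const)

lemma partial_cmult:
  "f differentiable (at x) \<Longrightarrow> partial i (\<lambda>x. c * f x) x = c * partial i f x"
  using partial_mult[of "\<lambda>_. c" x f i] by (simp add: partial_const)

lemma partial_cnj:
  "f differentiable (at x) \<Longrightarrow> partial i (\<lambda>x. cnj (f x)) x = cnj (partial i f x)"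
  by (rule trans[OF partial_eqI[OF bounded_linear.has_derivative[OF bounded_linear_cnj frechet_derivative_works[THEN iffD1]]]])
    (simp_all add: partial_diff_eq)

lemma mon_has_derivative:
  "(mon a b has_derivative (\<lambda>h. of_real (of_nat a * (x $ 1) ^ (a - 1) * h $ 1 * (x $ 2) ^ b
     + of_nat b * (x $ 2) ^ (b - 1) * h $ 2 * (x $ 1) ^ a))) (at x)"
proof -
  have c: "((\<lambda>x::real^2. x $ j) has_derivative (\<lambda>h. h $ j)) (at x)" for j
    by (rule bounded_linear_imp_has_derivative) (rule bounded_linear_vec_nth)
  have "((\<lambda>x::real^2. (x $ 1) ^ a * (x $ 2) ^ b) has_derivative
     (\<lambda>h. of_nat a * (x $ 1) ^ (a - 1) * h $ 1 * (x $ 2) ^ b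
     + of_nat b * (x $ 2) ^ (b - 1) * h $ 2 * (x $ 1) ^ a)) (at x)"
    by (rule has_derivative_eq_rhs[OF has_derivative_mult[OF has_derivative_power[OF c] has_derivative_power[OF c]]])
      (simp add: fun_eq_iff mult_ac add_ac)
  from bounded_linear.has_derivative[OF bounded_linear_of_real this]
  show ?thesis by (simp add: mon_def[abs_def])
qed

lemma mon_differentiable: "mon a b differentiable (at x)"
  using mon_has_derivative differentiable_def by blast

lemma partial_mon:
  "partial 1 (mon a b) x = of_nat a * mon (a - 1) b x"
  "partial 2 (mon a b) x = of_nat b * mon a (b - 1) x"
  by (simp_all add: partial_eqI[OF mon_has_derivative] axis_def mon_def)

lemma polys_differentiable: "p \<in> polys N \<Longrightarrow> p differentiable (at x)"
  by (induction rule: polys_induct) (auto intro!: differentiable_add differentiable_mult mon_differentiable)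

lemma polys_continuous: "p \<in> polys N \<Longrightarrow> continuous_on S p"
  by (meson polys_differentiable differentiable_imp_continuous_within continuous_at_imp_continuous_on)

lemma partial_cmon:
  "partial i (\<lambda>x. c * mon a b x) = (\<lambda>x. c * partial i (mon a b) x)"
  by (simp add: fun_eq_iff partial_cmult mon_differentiable)

lemma partial_polys_aux: "a + b \<le> N \<Longrightarrow> partial i (\<lambda>x. c * mon a b x) \<in> polys (N - 1)"
proof -
  assume ab: "a + b \<le> N"
  have 1: "partial 1 (mon a b) \<in> polys (N - 1)"
  proof (cases "a = 0")
    case True
    then have "partial 1 (mon a b) = (\<lambda>x. 0)" by (simp add: fun_eq_iff partial_mon)
    then show ?thesis by (simp add: polys_zero)
  next
    case False
    have "partial 1 (mon a b) = (\<lambda>x. of_nat a * mon (a - 1) b x)" by (simp add: fun_eq_iff partial_mon)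
    then show ?thesis using False ab by (auto intro!: polys_scale mon_in_polys)
  qed
  have 2: "partial 2 (mon a b) \<in> polys (N - 1)"
  proof (cases "b = 0")
    case True
    then have "partial 2 (mon a b) = (\<lambda>x. 0)" by (simp add: fun_eq_iff partial_mon)
    then show ?thesis by (simp add: polys_zero)
  next
    case False
    have "partial 2 (mon a b) = (\<lambda>x. of_nat b * mon a (b - 1) x)" by (simp add: fun_eq_iff partial_mon)
    then show ?thesis using False ab by (auto intro!: polys_scale mon_in_polys)
  qed
  show ?thesis using 1 2 exhaust_2[of i] by (auto simp: partial_cmon intro: polys_scale)
qed

lemma partial_polys: "p \<in> polys N \<Longrightarrow> partial i p \<in> polys (N - 1)"
proof (induction rule: polys_induct)
  case zero
  have "partial i (\<lambda>x. 0) = (\<lambda>x. 0)" by (simp add: fun_eq_iff partial_const)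
  then show ?case by (simp add: polys_zero)
next
  case (add f g)
  have "partial i (\<lambda>x. f x + g x) = (\<lambda>x. partial i f x + partial i g x)"
    using add by (auto simp: fun_eq_iff intro!: partial_add polys_differentiable)
  then show ?case using add by (simp add: polys_add)
next
  case (mon c a b) then show ?case by (rule partial_polys_aux)
qed

lemma partial_polys': "p \<in> polys N \<Longrightarrow> partial i p \<in> polys N"
  using partial_polys polys_mono by (metis diff_le_self)

lemma partial_polys_0: "p \<in> polys 0 \<Longrightarrow> partial i p x = 0"
proof -
  assume p: "p \<in> polys 0"
  have "\<exists>c. p = (\<lambda>x. c)" using p
  proof (induction rule: polys_induct)
    case (mon c a b)
    then show ?case by (auto simp: mon_def)
  qed auto
  then show ?thesis by (auto simp: partial_const)
qed

text \<open>Checked on monomials; the same symmetry for test functions is deduced from it by duality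
  in \<open>partial_commute_test\<close>.\<close>

lemma partial_commute_polys:
  assumes "p \<in> polys N"
  shows "partial i (partial j p) = partial j (partial i p)"
  using assms
proof (induction rule: polys_induct)
  case zero
  then show ?case by (simp add: partial_const[abs_def])
next
  case (add f g)
  have *: "partial i (\<lambda>x. f x + g x) = (\<lambda>x. partial i f x + partial i g x)"
    if "f \<in> polys N" "g \<in> polys N" for f g and i
    using that by (auto simp: fun_eq_iff intro!: partial_add polys_differentiable)
  show ?case using add by (simp add: * partial_polys')
next
  case (mon c a b)
  have **: "partial 1 (mon a b) = (\<lambda>x. of_nat a * mon (a - 1) b x)"
     "partial 2 (mon a b) = (\<lambda>x. of_nat b * mon a (b - 1) x)" for a b
    by (simp_all add: fun_eq_iff partial_mon)
  have "partial 1 (partial 2 (\<lambda>x. c * mon a b x)) = partial 2 (partial 1 (\<lambda>x. c * mon a b x))"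
    by (simp add: partial_cmon ** mult.assoc[symmetric]) (simp add: mult_ac)
  then show ?case using exhaust_2[of i] exhaust_2[of j] by auto
qed

section \<open>Integration against test functions\<close>

abbreviation disk_measure :: "(real ^ 2) measure" where
  "disk_measure \<equiv> lebesgue_on unit_disk"

lemma unit_disk_ball: "unit_disk = ball 0 1"
  by (auto simp: unit_disk_def dist_norm)

lemma open_unit_disk: "open unit_disk"
  by (simp add: unit_disk_ball)

lemma unit_disk_sets [measurable]: "unit_disk \<in> sets lebesgue"
  by (simp add: unit_disk_ball)

lemma finite_measure_disk: "finite_measure disk_measure"
proof
  have "unit_disk \<in> lmeasurable" by (simp add: unit_disk_ball)
  then show "emeasure disk_measure (space disk_measure) \<noteq> \<infinity>"
    by (auto simp: emeasure_restrict_space fmeasurable_def)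
qed

lemma rho_pos_iff: "0 < rho x \<longleftrightarrow> x \<in> unit_disk"
  by (simp add: rho_def unit_disk_def abs_square_less_1)

lemma rho_le_1: "rho x \<le> 1"
  by (simp add: rho_def)

lemma continuous_rho: "continuous_on S rho"
  unfolding rho_def by (intro continuous_intros)

lemma continuous_disk_measurable:
  fixes f :: "real ^ 2 \<Rightarrow> 'b::euclidean_space"
  assumes "continuous_on UNIV f"
  shows "f \<in> borel_measurable disk_measure"
  by (meson assms continuous_imp_measurable_on_sets_lebesgue continuous_on_subset subset_UNIV unit_disk_sets)

lemma rho_measurable: "rho \<in> borel_measurable disk_measure"
  by (rule continuous_disk_measurable[OF continuous_rho])

lemma rho_powr_measurable: "(\<lambda>x. rho x powr a) \<in> borel_measurable disk_measure"
  using rho_measurable by measurable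

lemma polys_measurable: "p \<in> polys N \<Longrightarrow> p \<in> borel_measurable disk_measure"
  by (rule continuous_disk_measurable[OF polys_continuous])

lemma bounded_on_disk:
  fixes f :: "real ^ 2 \<Rightarrow> 'b::real_normed_vector"
  assumes "continuous_on UNIV f"
  obtains B where "B > 0" "\<And>x. norm x \<le> 1 \<Longrightarrow> norm (f x) \<le> B"
proof -
  have "compact (f ` cball 0 1)"
    by (rule compact_continuous_image) (auto intro: continuous_on_subset[OF assms])
  then have "bounded (f ` cball 0 1)" by (rule compact_imp_bounded)
  then obtain B where "B > 0" "\<forall>y\<in>f ` cball 0 1. norm y \<le> B" by (auto simp: bounded_pos)
  then show thesis by (intro that[of B]) auto
qed

lemma AE_disk_measureI: "(\<And>x. x \<in> unit_disk \<Longrightarrow> P x) \<Longrightarrow> AE x in disk_measure. P x"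
  by (rule AE_I2) simp

text \<open>Passes to \<open>lborel\<close> on the whole plane, where translation invariance is
  available.\<close>

lemma integral_disk_eq_lborel:
  fixes f :: "real ^ 2 \<Rightarrow> complex"
  assumes f: "f \<in> borel_measurable borel" and 0: "\<And>x. x \<notin> unit_disk \<Longrightarrow> f x = 0"
  shows "integral\<^sup>L disk_measure f = integral\<^sup>L lborel f"
proof -
  have "integral\<^sup>L disk_measure f = integral\<^sup>L lebesgue (\<lambda>x. indicator unit_disk x *\<^sub>R f x)"
    by (rule integral_restrict_space) simp
  also have "(\<lambda>x. indicator unit_disk x *\<^sub>R f x) = f"
    using 0 by (auto simp: indicator_def fun_eq_iff)
  also have "integral\<^sup>L lebesgue f = integral\<^sup>L lborel f"
    by (rule integral_completion) (use f in simp)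
  finally show ?thesis .
qed

lemma partial_eq_0_outside:
  assumes "x \<notin> closure {x. f x \<noteq> 0}"
  shows "partial j f x = 0"
proof -
  have "(f has_derivative (\<lambda>h. 0)) (at x)"
  proof (rule has_derivative_transform_within_open[where f = "\<lambda>x. 0"])
    show "open (- closure {x. f x \<noteq> 0})" by auto
    show "0 = f y" if "y \<in> - closure {x. f x \<noteq> 0}" for y
      using that closure_subset[of "{x. f x \<noteq> 0}"] by auto
  qed (use assms in auto)
  from partial_eqI[OF this] show ?thesis by simp
qed

lemma support_partial: "closure {x. partial j f x \<noteq> 0} \<subseteq> closure {x. f x \<noteq> 0}"
  using partial_eq_0_outside by (intro closure_minimal) auto

lemma continuous_support_bounded:
  fixes f :: "real ^ 2 \<Rightarrow> complex"
  assumes "continuous_on UNIV f" and "closure {x. f x \<noteq> 0} \<subseteq> unit_disk"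
  obtains B where "B > 0" "\<And>x. norm (f x) \<le> B"
proof -
  obtain B where B: "B > 0" "\<And>x. norm x \<le> 1 \<Longrightarrow> norm (f x) \<le> B"
    using bounded_on_disk[OF assms(1)] by blast
  have "norm (f x) \<le> B" for x
  proof (cases "norm x \<le> 1")
    case False
    then have "x \<notin> unit_disk" by (simp add: unit_disk_def)
    then have "f x = 0" using assms(2) closure_subset[of "{x. f x \<noteq> 0}"] by auto
    then show ?thesis using B by simp
  qed (use B in auto)
  then show thesis using B that by blast
qed

text \<open>Difference quotients have integral zero by translation invariance and converge boundedly to
  the partial derivative.\<close>

lemma integral_partial_eq_0:
  fixes \<psi> :: "real ^ 2 \<Rightarrow> complex"
  assumes diff: "\<And>x. \<psi> differentiable (at x)"
    and cont: "continuous_on UNIV (partial j \<psi>)"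
    and supp: "closure {x. \<psi> x \<noteq> 0} \<subseteq> unit_disk"
  shows "(LINT x|disk_measure. partial j \<psi> x) = 0"
proof -
  have supp': "closure {x. partial j \<psi> x \<noteq> 0} \<subseteq> unit_disk"
    using support_partial supp by blast
  obtain B where B: "B > 0" "\<And>x. norm (partial j \<psi> x) \<le> B"
    using continuous_support_bounded[OF cont supp'] by blast
  have c\<psi>: "continuous_on UNIV \<psi>"
    using diff by (meson continuous_at_imp_continuous_on differentiable_imp_continuous_within)
  then obtain C where C: "\<And>x. norm (\<psi> x) \<le> C"
    using continuous_support_bounded[OF _ supp] by blast
  from c\<psi> have m\<psi>: "\<psi> \<in> borel_measurable borel" by (rule borel_measurable_continuous_onI)
  \<comment> \<open>A sequence of steps, since dominated convergence is used for sequences; steps of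
    length at most 1 keep all shifted supports in the ball of radius 2.\<close>
  define t where "t n = inverse (real (Suc n))" for n
  have t: "0 < t n" "t n \<le> 1" for n by (auto simp: t_def divide_simps)
  have t0: "t \<longlonglongrightarrow> 0" unfolding t_def by (rule LIMSEQ_inverse_real_of_nat)
  define e :: "real ^ 2" where "e = axis j 1"
  have [simp]: "norm e = 1" by (simp add: e_def norm_axis_1)
  have vd: "((\<lambda>t. \<psi> (x + t *\<^sub>R e)) has_vector_derivative partial j \<psi> (x + t *\<^sub>R e)) (at t within S)" for x t S
  proof -
    have g: "((\<lambda>t. x + t *\<^sub>R e) has_derivative (\<lambda>t. t *\<^sub>R e)) (at t within S)"
      by (rule derivative_eq_intros refl | simp)+
    obtain f' where f': "(\<psi> has_derivative f') (at (x + t *\<^sub>R e))"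
      using diff[of "x + t *\<^sub>R e"] by (auto simp: differentiable_def)
    have "((\<lambda>t. \<psi> (x + t *\<^sub>R e)) has_derivative (\<lambda>h. f' (h *\<^sub>R e))) (at t within S)"
      by (rule has_derivative_compose[OF g f'])
    moreover have "f' (h *\<^sub>R e) = h *\<^sub>R partial j \<psi> (x + t *\<^sub>R e)" for h
      using f' has_derivative_linear linear_scale partial_eqI[OF f', of j]
      by (metis e_def)
    ultimately show ?thesis by (simp add: has_vector_derivative_def)
  qed
  define f where "f n x = (\<psi> (x + t n *\<^sub>R e) - \<psi> x) /\<^sub>R t n" for n x
  have lim: "(\<lambda>n. f n x) \<longlonglongrightarrow> partial j \<psi> x" for x
  proof -
    have "((\<lambda>h. (\<psi> (x + h *\<^sub>R e) - \<psi> x) /\<^sub>R h) \<longlongrightarrow> partial j \<psi> x) (at 0)"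
    proof -
      have "((\<lambda>h. norm (\<psi> (x + h *\<^sub>R e) - \<psi> x - h *\<^sub>R partial j \<psi> x) / norm h) \<longlongrightarrow> 0) (at 0)"
        using vd[of x 0 UNIV] by (simp add: has_vector_derivative_def has_derivative_at)
      moreover have "norm (\<psi> (x + h *\<^sub>R e) - \<psi> x - h *\<^sub>R partial j \<psi> x) / norm h
          = norm ((\<psi> (x + h *\<^sub>R e) - \<psi> x) /\<^sub>R h - partial j \<psi> x)" if "h \<noteq> 0" for h
      proof -
        have "(\<psi> (x + h *\<^sub>R e) - \<psi> x) /\<^sub>R h - partial j \<psi> x = (\<psi> (x + h *\<^sub>R e) - \<psi> x - h *\<^sub>R partial j \<psi> x) /\<^sub>R h"
          using that by (simp add: scaleR_diff_right)
        then show ?thesis by (simp add: divide_inverse)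
      qed
      then have "\<forall>\<^sub>F h in at 0. norm (\<psi> (x + h *\<^sub>R e) - \<psi> x - h *\<^sub>R partial j \<psi> x) / norm h
          = norm ((\<psi> (x + h *\<^sub>R e) - \<psi> x) /\<^sub>R h - partial j \<psi> x)"
        by (simp add: eventually_at_filter)
      ultimately have "((\<lambda>h. norm ((\<psi> (x + h *\<^sub>R e) - \<psi> x) /\<^sub>R h - partial j \<psi> x)) \<longlongrightarrow> 0) (at 0)"
        by (rule Lim_transform_eventually)
      then show ?thesis by (simp add: tendsto_norm_zero_iff LIM_zero_iff)
    qed
    moreover have "filterlim t (at 0) sequentially"
      using t0 t by (auto simp: filterlim_at intro!: always_eventually less_imp_neq[symmetric])
    ultimately show ?thesis unfolding f_def by (rule filterlim_compose)
  qed
  \<comment> \<open>Within radius 2 this is the mean value inequality. Beyond it, both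
    \<open>x\<close> and the shifted point have norm at least 1, where the function
    vanishes.\<close>
  have bnd: "norm (f n x) \<le> B * indicator (cball 0 2) x" for n x
  proof (cases "norm x \<le> 2")
    case True
    have "norm (\<psi> (x + t n *\<^sub>R e) - \<psi> (x + 0 *\<^sub>R e)) \<le> B * norm (t n - 0)"
      by (rule differentiable_bound[of "{0..t n}" "\<lambda>t. \<psi> (x + t *\<^sub>R e)" "\<lambda>s h. h *\<^sub>R partial j \<psi> (x + s *\<^sub>R e)"])
         (use vd B t in \<open>auto simp: has_vector_derivative_def less_imp_le onorm_scaleR_left onorm_id[unfolded id_def]\<close>)
    then have "norm (f n x) \<le> B" using t[of n] by (simp add: f_def divide_simps mult.commute)
    then show ?thesis using True by simp
  next
    case False
    have z: "\<psi> y = 0" if "norm y \<ge> 1" for y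
      using that supp closure_subset[of "{x. \<psi> x \<noteq> 0}"] by (auto simp: unit_disk_def)
    have "norm x \<le> norm (x + t n *\<^sub>R e) + norm (t n *\<^sub>R e)"
      using norm_triangle_ineq4[of "x + t n *\<^sub>R e" "t n *\<^sub>R e"] by simp
    then have "norm (x + t n *\<^sub>R e) \<ge> 1" using False t[of n] by simp
    then show ?thesis using False by (simp add: f_def z)
  qed
  have int_\<psi>: "integrable lborel \<psi>"
  proof (rule integrableI_bounded_set[where A = "cball 0 1" and B = "C"])
    have "\<psi> x = 0" if "norm x > 1" for x
      using that supp closure_subset[of "{x. \<psi> x \<noteq> 0}"] by (auto simp: unit_disk_def)
    then show "AE x in lborel. x \<notin> cball 0 1 \<longrightarrow> \<psi> x = 0" by auto
  qed (use m\<psi> C emeasure_lborel_cball_finite in auto)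
  have shift: "integrable lborel (\<lambda>x. \<psi> (x + c))" "(LINT x|lborel. \<psi> (x + c)) = integral\<^sup>L lborel \<psi>" for c
  proof -
    have "integrable (distr lborel borel ((+) c)) \<psi>" "integral\<^sup>L (distr lborel borel ((+) c)) \<psi> = integral\<^sup>L lborel \<psi>"
      by (simp_all only: lborel_distr_plus int_\<psi>)
    then show "integrable lborel (\<lambda>x. \<psi> (x + c))" "(LINT x|lborel. \<psi> (x + c)) = integral\<^sup>L lborel \<psi>"
      using m\<psi> by (simp_all add: integrable_distr_eq integral_distr add.commute)
  qed
  have "integral\<^sup>L lborel (f n) = 0" for n
    unfolding f_def by (simp add: shift int_\<psi>)
  moreover have "(\<lambda>n. integral\<^sup>L lborel (f n)) \<longlonglongrightarrow> integral\<^sup>L lborel (partial j \<psi>)"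
  proof (rule integral_dominated_convergence[where w = "\<lambda>x. B * indicator (cball 0 2) x"])
    show "partial j \<psi> \<in> borel_measurable lborel"
      using cont borel_measurable_continuous_onI by simp
    show "f n \<in> borel_measurable lborel" for n
    proof -
      have "continuous_on UNIV (f n)" unfolding f_def
        by (intro continuous_intros continuous_on_compose2[OF c\<psi>]) auto
      then show ?thesis using borel_measurable_continuous_onI by simp
    qed
    show "integrable lborel (\<lambda>x. B * indicator (cball 0 2) x :: real)"
      by (intro integrable_mult_right integrable_real_indicator) (simp_all add: emeasure_lborel_cball_finite[unfolded less_top infinity_ennreal_def])
  qed (use lim bnd in auto)
  ultimately have "integral\<^sup>L lborel (partial j \<psi>) = 0"
    by (simp add: LIMSEQ_const_iff)
  moreover have "(LINT x|disk_measure. partial j \<psi> x) = integral\<^sup>L lborel (partial j \<psi>)"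
  proof (rule integral_disk_eq_lborel)
    show "partial j \<psi> \<in> borel_measurable borel"
      using cont borel_measurable_continuous_onI by simp
    show "partial j \<psi> x = 0" if "x \<notin> unit_disk" for x
      using supp' that closure_subset[of "{x. partial j \<psi> x \<noteq> 0}"] by auto
  qed
  ultimately show ?thesis by simp
qed

section \<open>First-order weak derivatives and test functions\<close>

text \<open>The first-order case of \<open>has_weak_deriv\<close>, indexed by a direction: the
  estimates differentiate one step at a time, and multi-indices return only in the comparison with
  the given norms.\<close>

definition weak_partial :: "2 \<Rightarrow> (real ^ 2 \<Rightarrow> complex) \<Rightarrow> (real ^ 2 \<Rightarrow> complex) \<Rightarrow> bool" where
  "weak_partial j u w \<longleftrightarrow> locally_integrable u \<and> locally_integrable w \<and>
     (\<forall>\<phi>. test_function \<phi> \<longrightarrow>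
       (LINT x|disk_measure. u x * partial j \<phi> x) = - (LINT x|disk_measure. w x * \<phi> x))"

lemma test_function_differentiable: "test_function \<phi> \<Longrightarrow> \<phi> differentiable (at x)"
proof -
  assume "test_function \<phi>"
  then have "foldr partial [] \<phi> differentiable_on UNIV" by (auto simp only: test_function_def smooth_def)
  then show ?thesis by (simp add: differentiable_on_def)
qed

lemma test_function_continuous: "test_function \<phi> \<Longrightarrow> continuous_on S \<phi>"
  by (meson test_function_differentiable continuous_at_imp_continuous_on differentiable_imp_continuous_within)

lemma test_function_support: "test_function \<phi> \<Longrightarrow> closure {x. \<phi> x \<noteq> 0} \<subseteq> unit_disk"
  by (simp add: test_function_def)

lemma test_function_partial: "test_function \<phi> \<Longrightarrow> test_function (partial j \<phi>)"
proof -
  assume t: "test_function \<phi>"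
  have "foldr partial ds (partial j \<phi>) = foldr partial (ds @ [j]) \<phi>" for ds by simp
  then have "smooth (partial j \<phi>)" using t unfolding test_function_def smooth_def by metis
  then show ?thesis using t support_partial[of j \<phi>] by (auto simp: test_function_def)
qed

lemma locally_integrable_mult:
  assumes u: "locally_integrable u" and c: "continuous_on UNIV \<phi>"
    and s: "closure {x. \<phi> x \<noteq> 0} \<subseteq> unit_disk"
  shows "integrable disk_measure (\<lambda>x. u x * \<phi> x)"
proof -
  define K where "K = closure {x. \<phi> x \<noteq> 0}"
  have "bounded K" using s bounded_subset[of "ball 0 1"] by (simp add: K_def unit_disk_ball)
  then have "compact K" by (simp add: K_def compact_eq_bounded_closed)
  then have "u absolutely_integrable_on K" using u s by (simp add: locally_integrable_def K_def)
  then have iK: "integrable lebesgue (\<lambda>x. indicator K x *\<^sub>R u x)"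
    by (simp add: set_integrable_def)
  obtain B where B: "B > 0" "\<And>x. norm (\<phi> x) \<le> B"
    using continuous_support_bounded[OF c s] by blast
  have "integrable lebesgue (\<lambda>x. (indicator K x *\<^sub>R u x) * \<phi> x)"
  proof (rule Bochner_Integration.integrable_bound[where f = "\<lambda>x. B * norm (indicator K x *\<^sub>R u x)"])
    show "integrable lebesgue (\<lambda>x. B * norm (indicator K x *\<^sub>R u x))"
      using iK by (intro integrable_mult_right integrable_norm)
    have "\<phi> \<in> borel_measurable lebesgue"
      by (intro measurable_completion) (use c borel_measurable_continuous_onI in auto)
    then show "(\<lambda>x. (indicator K x *\<^sub>R u x) * \<phi> x) \<in> borel_measurable lebesgue"
      using iK by (intro borel_measurable_times) auto
    show "AE x in lebesgue. norm (indicator K x *\<^sub>R u x * \<phi> x) \<le> norm (B * norm (indicator K x *\<^sub>R u x))"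
      using B by (intro AE_I2) (auto simp: norm_mult indicator_def mult.commute[of "cmod (u _)"] intro!: mult_right_mono)
  qed
  moreover have "(\<lambda>x. (indicator K x *\<^sub>R u x) * \<phi> x) = (\<lambda>x. indicator unit_disk x *\<^sub>R (u x * \<phi> x))"
  proof
    fix x show "(indicator K x *\<^sub>R u x) * \<phi> x = indicator unit_disk x *\<^sub>R (u x * \<phi> x)"
    using s closure_subset[of "{x. \<phi> x \<noteq> 0}"] by (cases "\<phi> x = 0") (auto simp: K_def indicator_def)
  qed
  ultimately show ?thesis by (simp add: integrable_restrict_space)
qed

lemma locally_integrable_test:
  "locally_integrable u \<Longrightarrow> test_function \<phi> \<Longrightarrow> integrable disk_measure (\<lambda>x. u x * \<phi> x)"
  by (rule locally_integrable_mult) (simp_all add: test_function_continuous test_function_support)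

text \<open>By the product rule the claim says that a derivative of the product has integral 0; the
  product inherits its support from the test function.\<close>

lemma integral_parts_test_polys:
  assumes t: "test_function \<phi>" and p: "p \<in> polys N"
  shows "(LINT x|disk_measure. p x * partial j \<phi> x) = - (LINT x|disk_measure. partial j p x * \<phi> x)"
proof -
  have pm: "partial j (\<lambda>x. p x * \<phi> x) x = p x * partial j \<phi> x + partial j p x * \<phi> x" for x
    by (intro partial_mult polys_differentiable[OF p] test_function_differentiable[OF t])
  have cont: "continuous_on UNIV (\<lambda>x. p x * partial j \<phi> x + partial j p x * \<phi> x)"
    by (intro continuous_intros polys_continuous[OF p] polys_continuous[OF partial_polys[OF p]]
        test_function_continuous t test_function_partial)
  have "{x. p x * \<phi> x \<noteq> 0} \<subseteq> {x. \<phi> x \<noteq> 0}" by auto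
  then have supp: "closure {x. p x * \<phi> x \<noteq> 0} \<subseteq> unit_disk"
    using test_function_support[OF t] closure_mono by blast
  have zero: "(LINT x|disk_measure. p x * partial j \<phi> x + partial j p x * \<phi> x) = 0"
    using integral_partial_eq_0[of "\<lambda>x. p x * \<phi> x" j] supp cont
    by (simp add: pm[abs_def] differentiable_mult polys_differentiable[OF p] test_function_differentiable[OF t])
  have "integrable disk_measure (\<lambda>x. q x * \<psi> x)" if "q \<in> polys M" "test_function \<psi>" for q \<psi> M
  proof (rule locally_integrable_test[OF _ that(2)])
    show "locally_integrable q" unfolding locally_integrable_def
      using borel_integrable_compact[OF _ polys_continuous[OF that(1)]]
      by (simp add: set_integrable_def integrable_completion)
  qed
  from Bochner_Integration.integral_add[OF this[OF p test_function_partial[OF t]] this[OF partial_polys'[OF p] t]]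
  show ?thesis using zero by (simp add: add_eq_0_iff)
qed

text \<open>As \<open>e\<close> tends to 0, \<open>cutoff e s 0\<close> increases to the weight \<open>t powr s\<close>; the index \<open>n\<close> counts the
  poles at \<open>t = e\<close> produced by differentiation.\<close>

definition cutoff :: "real \<Rightarrow> real \<Rightarrow> nat \<Rightarrow> real \<Rightarrow> real" where
  "cutoff e s n t = (if t \<le> e then 0 else t powr s * inverse (t - e) ^ n * exp (- e * inverse (t - e)))"

text \<open>The family is closed under differentiation: the three terms come from the power, from
  the pole factor and from the exponential. Only the glueing at \<open>t = e\<close> needs an
  argument, since there the exponential must beat every pole.\<close>

lemma cutoff_deriv:
  assumes e: "0 < e"
  shows "(cutoff e s n has_real_derivative
    s * cutoff e (s - 1) n t - real n * cutoff e s (n + 1) t + e * cutoff e s (n + 2) t) (at t)"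
proof -
  consider "t > e" | "t < e" | "t = e" by linarith
  then show ?thesis
  proof cases
    case 1
    have A: "((\<lambda>t. t powr s) has_real_derivative s * t powr (s - 1)) (at t)"
      using 1 e by (intro has_real_derivative_powr) simp
    have I: "((\<lambda>t. inverse (t - e)) has_real_derivative - (inverse (t - e))\<^sup>2) (at t)"
      using 1 by (auto intro!: derivative_eq_intros simp: power2_eq_square)
    have B: "((\<lambda>t. inverse (t - e) ^ n) has_real_derivative - real n * inverse (t - e) ^ (n + 1)) (at t)"
      by (rule DERIV_cong[OF DERIV_power[OF I, of n]]) (cases n; simp add: power2_eq_square algebra_simps)
    have C: "((\<lambda>t. exp (- e * inverse (t - e))) has_real_derivative
        exp (- e * inverse (t - e)) * (e * (inverse (t - e))\<^sup>2)) (at t)"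
      using DERIV_fun_exp[OF DERIV_cmult[OF I, of "- e"]] by simp
    have "((\<lambda>t. t powr s * inverse (t - e) ^ n * exp (- e * inverse (t - e))) has_real_derivative
      s * cutoff e (s - 1) n t - real n * cutoff e s (n + 1) t + e * cutoff e s (n + 2) t) (at t)"
      by (rule DERIV_cong[OF DERIV_mult[OF DERIV_mult[OF A B] C]])
         (use 1 in \<open>simp add: cutoff_def algebra_simps power2_eq_square\<close>)
    then show ?thesis
      by (rule has_field_derivative_transform_within_open[where S = "{e<..}"]) (use 1 in \<open>auto simp: cutoff_def\<close>)
  next
    case 2
    then have *: "s * cutoff e (s - 1) n t - real n * cutoff e s (n + 1) t + e * cutoff e s (n + 2) t = 0"
      by (simp add: cutoff_def)
    show ?thesis unfolding *
      by (rule has_field_derivative_transform_within_open[where S = "{..<e}" and f = "\<lambda>_. 0"])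
         (use 2 in \<open>auto simp: cutoff_def\<close>)
  next
    case 3
    then have *: "s * cutoff e (s - 1) n t - real n * cutoff e s (n + 1) t + e * cutoff e s (n + 2) t = 0"
      by (simp add: cutoff_def)
    have L: "((\<lambda>h. (cutoff e s n (t + h) - cutoff e s n t) / h) \<longlongrightarrow> 0) (at_left 0)"
    proof (rule tendsto_eventually)
      show "\<forall>\<^sub>F h in at_left 0. (cutoff e s n (t + h) - cutoff e s n t) / h = 0"
        using 3 by (auto simp: eventually_at_filter cutoff_def)
    qed
    \<comment> \<open>With \<open>y = e / h\<close> the right difference quotient is a convergent
      factor times \<open>y ^ (n + 1) / exp y\<close>, which tends to 0 as \<open>h\<close>
      decreases to 0.\<close>
    have y: "filterlim (\<lambda>h. e * inverse h) at_top (at_right (0::real))"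
      by (rule filterlim_tendsto_pos_mult_at_top[OF tendsto_const e filterlim_inverse_at_top_right])
    have "((\<lambda>h. (e * inverse h) ^ (n + 1) / exp (e * inverse h)) \<longlongrightarrow> 0) (at_right (0::real))"
      by (rule filterlim_compose[OF tendsto_power_div_exp_0 y])
    moreover have "((\<lambda>h. (e + h) powr s / e ^ (n + 1)) \<longlongrightarrow> (e + 0) powr s / e ^ (n + 1)) (at_right 0)"
      using e by (intro tendsto_intros) auto
    ultimately have "((\<lambda>h. (e + h) powr s / e ^ (n + 1) * ((e * inverse h) ^ (n + 1) / exp (e * inverse h)))
        \<longlongrightarrow> (e + 0) powr s / e ^ (n + 1) * 0) (at_right 0)"
      by (intro tendsto_mult)
    then have "((\<lambda>h. (e + h) powr s / e ^ (n + 1) * ((e * inverse h) ^ (n + 1) / exp (e * inverse h)))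
        \<longlongrightarrow> 0) (at_right 0)" by simp
    moreover have "\<forall>\<^sub>F h in at_right 0. (e + h) powr s / e ^ (n + 1) * ((e * inverse h) ^ (n + 1) / exp (e * inverse h))
       = (cutoff e s n (t + h) - cutoff e s n t) / h"
      using 3 e by (auto simp: eventually_at_filter cutoff_def power_mult_distrib exp_minus field_simps)
    ultimately have R: "((\<lambda>h. (cutoff e s n (t + h) - cutoff e s n t) / h) \<longlongrightarrow> 0) (at_right 0)"
      by (rule Lim_transform_eventually)
    show ?thesis unfolding * DERIV_def using L R by (simp add: filterlim_split_at)
  qed
qed

lemma rho_has_derivative: "(rho has_derivative (\<lambda>h. - 2 * (x \<bullet> h))) (at x)"
proof -
  have "((\<lambda>x::real^2. 1 - x \<bullet> x) has_derivative (\<lambda>h. - 2 * (x \<bullet> h))) (at x)"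
    by (rule derivative_eq_intros refl)+ (simp add: fun_eq_iff inner_commute)
  then show ?thesis by (simp add: rho_def[abs_def] power2_norm_eq_inner)
qed

lemma cutoff_rho_has_derivative:
  assumes "0 < e"
  shows "((\<lambda>x. complex_of_real (cutoff e s n (rho x))) has_derivative (\<lambda>h. of_real (- 2 * (x \<bullet> h) *
     (s * cutoff e (s - 1) n (rho x) - real n * cutoff e s (n + 1) (rho x) + e * cutoff e s (n + 2) (rho x))))) (at x)"
  using bounded_linear.has_derivative[OF bounded_linear_of_real
      has_derivative_compose[OF rho_has_derivative cutoff_deriv[OF assms, of s n "rho x", unfolded has_field_derivative_def]]]
  by (simp only: mult.commute)

lemma partial_cutoff_rho:
  assumes "0 < e"
  shows "partial i (\<lambda>x. complex_of_real (cutoff e s n (rho x))) x = of_real (- 2 * (x $ i) *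
     (s * cutoff e (s - 1) n (rho x) - real n * cutoff e s (n + 1) (rho x) + e * cutoff e s (n + 2) (rho x)))"
  by (subst partial_eqI[OF cutoff_rho_has_derivative[OF assms]]) (simp add: inner_axis)

lemma cutoff_rho_differentiable:
  "0 < e \<Longrightarrow> (\<lambda>x. complex_of_real (cutoff e s n (rho x))) differentiable (at x)"
  using cutoff_rho_has_derivative differentiable_def by blast

text \<open>A class of functions closed under partial derivatives, which makes its members smooth.\<close>

inductive cutoff_fun :: "real \<Rightarrow> (real ^ 2 \<Rightarrow> complex) \<Rightarrow> bool" for e where
  base: "q \<in> polys N \<Longrightarrow> cutoff_fun e (\<lambda>x. q x * of_real (cutoff e s n (rho x)))"
| add: "cutoff_fun e f \<Longrightarrow> cutoff_fun e g \<Longrightarrow> cutoff_fun e (\<lambda>x. f x + g x)"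

lemma cutoff_fun_differentiable: "cutoff_fun e f \<Longrightarrow> 0 < e \<Longrightarrow> f differentiable (at x)"
proof (induction rule: cutoff_fun.induct)
  case (base q N s n)
  then show ?case
    by (intro differentiable_mult polys_differentiable cutoff_rho_differentiable)
qed (simp add: differentiable_add)

lemma partial_poly_cutoff:
  assumes "q \<in> polys N" "0 < e"
  shows "partial i (\<lambda>x. q x * of_real (cutoff e s n (rho x))) x =
    partial i q x * of_real (cutoff e s n (rho x)) - 2 * of_real (x $ i) * q x * 
     of_real (s * cutoff e (s - 1) n (rho x) - real n * cutoff e s (n + 1) (rho x) + e * cutoff e s (n + 2) (rho x))"
  by (simp add: partial_mult polys_differentiable[OF assms(1)] cutoff_rho_differentiable[OF assms(2)]
      partial_cutoff_rho[OF assms(2)])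

lemma cutoff_fun_partial: "cutoff_fun e f \<Longrightarrow> 0 < e \<Longrightarrow> cutoff_fun e (partial i f)"
proof (induction rule: cutoff_fun.induct)
  case (base q N s n)
  have xq: "(\<lambda>x. c * (of_real (x $ i) * q x)) \<in> polys (Suc N)" for c
    using base by (intro polys_scale polys_mult_coord)
  have eq: "partial i (\<lambda>x. q x * of_real (cutoff e s n (rho x))) = (\<lambda>x.
     (partial i q x * of_real (cutoff e s n (rho x))
     + (- 2 * s) * (of_real (x $ i) * q x) * of_real (cutoff e (s - 1) n (rho x)))
     + ((2 * of_nat n) * (of_real (x $ i) * q x) * of_real (cutoff e s (n + 1) (rho x))
     + (- 2 * e) * (of_real (x $ i) * q x) * of_real (cutoff e s (n + 2) (rho x))))"
    by (rule ext) (simp add: partial_poly_cutoff[OF base] ring_distribs mult_ac)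
  show ?case unfolding eq
    by (intro cutoff_fun.add cutoff_fun.base[OF partial_polys[OF base(1)]] cutoff_fun.base[OF xq])
next
  case (add f g)
  have "partial i (\<lambda>x. f x + g x) = (\<lambda>x. partial i f x + partial i g x)"
    using cutoff_fun_differentiable[OF add.hyps(1) add.prems] cutoff_fun_differentiable[OF add.hyps(2) add.prems]
    by (intro ext partial_add)
  then show ?case using add by (simp add: cutoff_fun.add)
qed

lemma cutoff_fun_smooth: "cutoff_fun e f \<Longrightarrow> 0 < e \<Longrightarrow> smooth f"
proof -
  assume f: "cutoff_fun e f" and e: "0 < e"
  have "cutoff_fun e (foldr partial ds f)" for ds
    by (induction ds) (simp_all add: f e cutoff_fun_partial)
  then show ?thesis unfolding smooth_def
    using cutoff_fun_differentiable[OF _ e] differentiable_at_withinI by (metis differentiable_on_def)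
qed

lemma cutoff_eq_0: "t \<le> e \<Longrightarrow> cutoff e s n t = 0"
  by (simp add: cutoff_def)

text \<open>The product vanishes where \<open>rho x <= e\<close>, so its support lies in the closed
  set \<open>e <= rho x\<close>, inside the open disk. These products are the concrete test
  functions fed into the weak formulation.\<close>

lemma test_function_cutoff:
  assumes "0 < e" "q \<in> polys N"
  shows "test_function (\<lambda>x. q x * of_real (cutoff e s n (rho x)))"
proof -
  have "closure {x. q x * of_real (cutoff e s n (rho x)) \<noteq> 0} \<subseteq> {x. e \<le> rho x}"
  proof (rule closure_minimal)
    show "{x. q x * of_real (cutoff e s n (rho x)) \<noteq> 0} \<subseteq> {x. e \<le> rho x}"
      using cutoff_eq_0[of "rho _" e] by (force simp: not_le[symmetric])
    show "closed {x. e \<le> rho x}"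
      by (intro closed_Collect_le continuous_rho continuous_on_const)
  qed
  also have "\<dots> \<subseteq> unit_disk" using assms(1) by (auto simp: rho_pos_iff[symmetric])
  finally show ?thesis unfolding test_function_def
    using cutoff_fun_smooth[OF cutoff_fun.base[OF assms(2)] assms(1)] by blast
qed

text \<open>Connects the polynomial functions of the Stone-Weierstrass theorem with
  \<open>polys\<close>. The degree is existential because only density is drawn from it.\<close>

lemma real_polynomial_function_polys:
  assumes "real_polynomial_function (f :: real ^ 2 \<Rightarrow> real)"
  shows "\<exists>N. (\<lambda>x. complex_of_real (f x)) \<in> polys N"
  using assms
proof (induction rule: real_polynomial_function.induct)
  case (linear f)
  have fx: "f x = f (axis 1 1) * x $ 1 + f (axis 2 1) * x $ 2" for x
  proof -
    have "x = x $ 1 *\<^sub>R axis 1 1 + x $ 2 *\<^sub>R axis 2 1"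
      by (auto simp: vec_eq_iff axis_def forall_2)
    then have "f x = f (x $ 1 *\<^sub>R axis 1 1 + x $ 2 *\<^sub>R axis 2 1)" by simp
    also have "\<dots> = x $ 1 * f (axis 1 1) + x $ 2 * f (axis 2 1)"
      using linear by (simp add: linear_simps)
    finally show ?thesis by (simp add: mult.commute)
  qed
  have "(\<lambda>x. complex_of_real (f x)) = (\<lambda>x. of_real (f (axis 1 1)) * of_real (x $ 1) + of_real (f (axis 2 1)) * of_real (x $ 2))"
    by (rule ext) (subst fx, simp)
  also have "\<dots> \<in> polys (Suc 0)" by (intro polys_add polys_scale polys_coord)
  finally show ?case by blast
next
  case (const c) then show ?case using polys_const by blast
next
  case (add f g)
  then obtain M N where "(\<lambda>x. complex_of_real (f x)) \<in> polys M" "(\<lambda>x. complex_of_real (g x)) \<in> polys N" by blast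
  then have "(\<lambda>x. complex_of_real (f x) + of_real (g x)) \<in> polys (max M N)"
    by (intro polys_add) (auto elim: polys_mono)
  then show ?case by auto
next
  case (mult f g)
  then obtain M N where "(\<lambda>x. complex_of_real (f x)) \<in> polys M" "(\<lambda>x. complex_of_real (g x)) \<in> polys N" by blast
  from polys_mult[OF this] show ?case by auto
qed

lemma polynomial_function_polys:
  assumes "polynomial_function (p :: real ^ 2 \<Rightarrow> complex)"
  shows "\<exists>N. p \<in> polys N"
proof -
  have "real_polynomial_function (Re \<circ> p)" "real_polynomial_function (Im \<circ> p)"
    using assms bounded_linear_Re bounded_linear_Im by (auto simp: polynomial_function_def)
  then obtain M N where MN: "(\<lambda>x. complex_of_real ((Re \<circ> p) x)) \<in> polys M" "(\<lambda>x. complex_of_real ((Im \<circ> p) x)) \<in> polys N"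
    using real_polynomial_function_polys by meson
  have "p = (\<lambda>x. complex_of_real ((Re \<circ> p) x) + \<i> * of_real ((Im \<circ> p) x))"
    by (auto simp: fun_eq_iff complex_eq_iff)
  also have "\<dots> \<in> polys (max M N)"
    using MN by (intro polys_add polys_scale) (auto elim: polys_mono)
  finally show ?thesis by blast
qed

text \<open>A measurable function is an almost everywhere limit of continuous ones, and
  Stone-Weierstrass replaces each of these by a polynomial. The uniform bound is what later makes
  dominated convergence applicable.\<close>

lemma polys_approx_AE:
  assumes h: "h \<in> borel_measurable disk_measure" and B: "0 \<le> B" "\<And>x. x \<in> unit_disk \<Longrightarrow> norm (h x) \<le> B"
  obtains p where "\<And>n::nat. \<exists>N. p n \<in> polys N" "\<And>n x. x \<in> unit_disk \<Longrightarrow> norm (p n x) \<le> B + 1"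
    "AE x in disk_measure. (\<lambda>n. p n x) \<longlonglongrightarrow> (h x :: complex)"
proof -
  have "h measurable_on unit_disk" using h measurable_on_iff_borel_measurable[OF unit_disk_sets] by blast
  then obtain N g where N: "negligible N" and g: "\<And>n. continuous_on UNIV (g n)"
    and lim: "\<And>x. x \<notin> N \<Longrightarrow> (\<lambda>n. g n x) \<longlonglongrightarrow> (if x \<in> unit_disk then h x else 0)"
    by (auto simp: measurable_on_def)
  \<comment> \<open>Projecting the values onto the ball of radius \<open>B\<close> keeps the
    approximants bounded and leaves the limit alone, whose values already lie there. The polynomial
    error of at most 1 accounts for \<open>B + 1\<close>.\<close>
  define c where "c = closest_point (cball (0::complex) B)"
  have c: "continuous_on UNIV c" "c z \<in> cball 0 B" "z \<in> cball 0 B \<Longrightarrow> c z = z" for z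
    unfolding c_def using B(1) closest_point_in_set[of "cball 0 B" z]
    by (auto intro!: continuous_on_closest_point closest_point_self)
  have cg: "continuous_on (cball 0 1) (\<lambda>x. c (g n x))" for n
    by (rule continuous_on_compose2[OF c(1) continuous_on_subset[OF g]]) auto
  have "\<exists>p. polynomial_function p \<and> (\<forall>x\<in>cball 0 1. norm (c (g n x) - p x) < inverse (real (Suc n)))" for n
    by (rule Stone_Weierstrass_polynomial_function[OF _ cg]) auto
  then obtain p where p: "\<And>n. polynomial_function (p n)"
      "\<And>n x. x \<in> cball 0 1 \<Longrightarrow> norm (c (g n x) - p n x) < inverse (real (Suc n))"
    by metis
  show thesis
  proof (rule that[of p])
    show "\<exists>N. p n \<in> polys N" for n using polynomial_function_polys p(1) by blast
    fix n x assume x: "x \<in> unit_disk"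
    then have "x \<in> cball 0 1" by (auto simp: unit_disk_def)
    then have "norm (c (g n x) - p n x) < inverse (real (Suc n))" by (rule p(2))
    also have "\<dots> \<le> 1" by (simp add: divide_simps)
    finally have "norm (c (g n x) - p n x) < 1" .
    moreover have "norm (c (g n x)) \<le> B" using c(2)[of "g n x"] by simp
    ultimately show "norm (p n x) \<le> B + 1"
      using norm_triangle_ineq4[of "c (g n x)" "c (g n x) - p n x"] by simp
  next
    have *: "(\<lambda>n. p n x) \<longlonglongrightarrow> h x" if "x \<notin> N" "x \<in> unit_disk" for x
    proof -
      have "(\<lambda>n. g n x) \<longlonglongrightarrow> h x" using lim[of x] that by simp
      then have "(\<lambda>n. c (g n x)) \<longlonglongrightarrow> c (h x)"
        by (rule continuous_on_tendsto_compose[OF c(1)]) auto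
      also have "c (h x) = h x" using B(2)[OF that(2)] by (intro c(3)) simp
      finally have 1: "(\<lambda>n. c (g n x)) \<longlonglongrightarrow> h x" .
      have "(\<lambda>n. c (g n x) - p n x) \<longlonglongrightarrow> 0"
      proof (rule Lim_null_comparison[OF _ LIMSEQ_inverse_real_of_nat])
        have "x \<in> cball 0 1" using that by (auto simp: unit_disk_def)
        then show "\<forall>\<^sub>F n in sequentially. norm (c (g n x) - p n x) \<le> inverse (real (Suc n))"
          using p(2) by (auto intro!: always_eventually less_imp_le)
      qed
      from tendsto_diff[OF 1 this] show ?thesis by simp
    qed
    have "AE x in lebesgue. x \<notin> N"
      using N by (intro AE_not_in) (simp add: negligible_iff_null_sets)
    then have "AE x in lebesgue. x \<in> unit_disk \<longrightarrow> (\<lambda>n. p n x) \<longlonglongrightarrow> h x"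
      by eventually_elim (use * in auto)
    then show "AE x in disk_measure. (\<lambda>n. p n x) \<longlonglongrightarrow> h x"
      by (simp add: AE_restrict_space_iff)
  qed
qed

text \<open>Bounded polynomials converge to the conjugate phase of \<open>g\<close>; in the limit,
  orthogonality says that the integral of \<open>|g|\<close> is 0.\<close>

lemma AE_eq_0_if_orthogonal_polys:
  assumes g: "integrable disk_measure g"
    and 0: "\<And>p N. p \<in> polys N \<Longrightarrow> (LINT x|disk_measure. g x * p x) = 0"
  shows "AE x in disk_measure. g x = (0::complex)"
proof -
  define h where "h x = cnj (sgn (g x))" for x
  have gm [measurable]: "g \<in> borel_measurable disk_measure" using g by simp
  have sg: "sgn \<in> borel_measurable (borel :: complex measure)"
    unfolding sgn_div_norm[abs_def] by measurable
  have hm: "h \<in> borel_measurable disk_measure" unfolding h_def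
    by (intro measurable_compose[OF measurable_compose[OF gm sg]] borel_measurable_continuous_onI continuous_intros)
  obtain p where p: "\<And>n::nat. \<exists>N. p n \<in> polys N" "\<And>n x. x \<in> unit_disk \<Longrightarrow> norm (p n x) \<le> 1 + 1"
    "AE x in disk_measure. (\<lambda>n. p n x) \<longlonglongrightarrow> h x"
    by (rule polys_approx_AE[OF hm, of 1]) (auto simp: h_def norm_sgn)
  have "(\<lambda>n. LINT x|disk_measure. g x * p n x) \<longlonglongrightarrow> (LINT x|disk_measure. g x * h x)"
  proof (rule integral_dominated_convergence[where w = "\<lambda>x. 2 * norm (g x)"])
    show "(\<lambda>x. g x * h x) \<in> borel_measurable disk_measure" using hm by measurable
    show "(\<lambda>x. g x * p n x) \<in> borel_measurable disk_measure" for n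
    proof -
      have [measurable]: "p n \<in> borel_measurable disk_measure" using p(1) polys_measurable by blast
      show ?thesis by measurable
    qed
    show "integrable disk_measure (\<lambda>x. 2 * norm (g x))" using g by simp
    show "AE x in disk_measure. (\<lambda>n. g x * p n x) \<longlonglongrightarrow> g x * h x"
      using p(3) by eventually_elim (intro tendsto_intros)
    show "AE x in disk_measure. norm (g x * p n x) \<le> 2 * norm (g x)" for n
      using p(2) by (intro AE_disk_measureI) (simp add: norm_mult mult.commute[of "cmod (g _)"] mult_right_mono)
  qed
  moreover have "(LINT x|disk_measure. g x * p n x) = 0" for n using p(1) 0 by blast
  ultimately have "(LINT x|disk_measure. g x * h x) = 0" by (simp add: LIMSEQ_const_iff)
  moreover have "g x * h x = of_real (norm (g x))" for x
  proof (cases "g x = 0")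
    case False
    have "g x * h x = of_real (inverse (norm (g x))) * (g x * cnj (g x))"
      by (simp add: h_def sgn_div_norm scaleR_conv_of_real mult.left_commute)
    also have "\<dots> = of_real (norm (g x))"
      using False by (simp add: complex_norm_square[symmetric] power2_eq_square)
    finally show ?thesis .
  qed (simp add: h_def)
  ultimately have "(LINT x|disk_measure. norm (g x)) = 0"
    by (simp add: integral_complex_of_real)
  then have "AE x in disk_measure. norm (g x) = 0"
    using g by (subst (asm) integral_nonneg_eq_0_iff_AE) auto
  then show ?thesis by simp
qed

text \<open>A polynomial times a cutoff is a test function, so \<open>f\<close> times the cutoff is
  integrable and orthogonal to all polynomials. Countably many cutoffs exhaust the disk.\<close>

lemma AE_eq_0_if_orthogonal_test_functions:
  assumes f: "locally_integrable f"
    and 0: "\<And>\<phi>. test_function \<phi> \<Longrightarrow> (LINT x|disk_measure. f x * \<phi> x) = 0"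
  shows "AE x in disk_measure. f x = 0"
proof -
  have "AE x in disk_measure. f x * of_real (cutoff (inverse (real (Suc n))) 0 0 (rho x)) = 0" for n
  proof (rule AE_eq_0_if_orthogonal_polys)
    have e: "0 < inverse (real (Suc n))" by simp
    show "integrable disk_measure (\<lambda>x. f x * of_real (cutoff (inverse (real (Suc n))) 0 0 (rho x)))"
      using locally_integrable_test[OF f test_function_cutoff[OF e polys_const[of 1]]] by simp
    show "(LINT x|disk_measure. f x * of_real (cutoff (inverse (real (Suc n))) 0 0 (rho x)) * p x) = 0"
      if "p \<in> polys N" for p N
      using 0[OF test_function_cutoff[OF e that]] by (simp add: mult_ac)
  qed
  then have "AE x in disk_measure. \<forall>n. f x * of_real (cutoff (inverse (real (Suc n))) 0 0 (rho x)) = 0"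
    unfolding AE_all_countable by blast
  moreover have "AE x in disk_measure. x \<in> unit_disk" by (rule AE_disk_measureI)
  ultimately show ?thesis
  proof eventually_elim
    case (elim x)
    then obtain n where "inverse (real (Suc n)) < rho x" using reals_Archimedean rho_pos_iff by blast
    then have "cutoff (inverse (real (Suc n))) 0 0 (rho x) \<noteq> 0"
      using elim(2) by (auto simp: cutoff_def rho_pos_iff[symmetric])
    then show ?case using elim(1) by (metis mult_eq_0_iff of_real_eq_0_iff)
  qed
qed

section \<open>The weighted spaces\<close>

lemma L2w_measurable: "u \<in> L2w a \<Longrightarrow> u \<in> borel_measurable disk_measure"
  by (simp add: L2w_def)

lemma L2w_integrable: "u \<in> L2w a \<Longrightarrow> integrable disk_measure (\<lambda>x. (norm (u x))\<^sup>2 * rho x powr a)"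
  by (simp add: L2w_def)

lemma L2w_norm_nonneg [simp]: "0 \<le> L2w_norm a u"
  by (simp add: L2w_norm_def integral_nonneg_AE)

lemma L2w_norm_sq: "(L2w_norm a u)\<^sup>2 = (LINT x|disk_measure. (norm (u x))\<^sup>2 * rho x powr a)"
  unfolding L2w_norm_def by (rule real_sqrt_pow2) (simp add: integral_nonneg_AE)

lemma L2w_norm_leI: "(L2w_norm a u)\<^sup>2 \<le> c\<^sup>2 \<Longrightarrow> 0 \<le> c \<Longrightarrow> L2w_norm a u \<le> c"
  by (rule power2_le_imp_le)

lemma weighted_square_measurable:
  assumes [measurable]: "u \<in> borel_measurable disk_measure"
  shows "(\<lambda>x. (norm (u x :: complex))\<^sup>2 * rho x powr a) \<in> borel_measurable disk_measure"
proof -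
  note rho_powr_measurable[measurable]
  show ?thesis by measurable
qed

lemma L2w_bound:
  assumes "u \<in> borel_measurable disk_measure" "v \<in> L2w a" "0 \<le> c"
    and le: "\<And>x. x \<in> unit_disk \<Longrightarrow> norm (u x) \<le> c * norm (v x)"
  shows "u \<in> L2w a" "L2w_norm a u \<le> c * L2w_norm a v"
proof -
  have le2: "(norm (u x))\<^sup>2 * rho x powr a \<le> c\<^sup>2 * ((norm (v x))\<^sup>2 * rho x powr a)" if "x \<in> unit_disk" for x
  proof -
    have "(norm (u x))\<^sup>2 \<le> (c * norm (v x))\<^sup>2" using le[OF that] by (intro power_mono) auto
    then show ?thesis by (simp add: power_mult_distrib mult.assoc[symmetric] mult_right_mono)
  qed
  have I: "integrable disk_measure (\<lambda>x. c\<^sup>2 * ((norm (v x))\<^sup>2 * rho x powr a))"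
    using assms(2) by (simp add: L2w_integrable)
  have J: "integrable disk_measure (\<lambda>x. (norm (u x))\<^sup>2 * rho x powr a)"
  proof (rule Bochner_Integration.integrable_bound[OF I])
    show "(\<lambda>x. (norm (u x))\<^sup>2 * rho x powr a) \<in> borel_measurable disk_measure"
      by (rule weighted_square_measurable[OF assms(1)])
  qed (use le2 in \<open>auto intro!: AE_disk_measureI simp: abs_mult\<close>)
  then show "u \<in> L2w a" using assms(1) by (simp add: L2w_def)
  have "(LINT x|disk_measure. (norm (u x))\<^sup>2 * rho x powr a) \<le> (LINT x|disk_measure. c\<^sup>2 * ((norm (v x))\<^sup>2 * rho x powr a))"
    by (rule integral_mono_AE[OF J I]) (use le2 in \<open>auto intro!: AE_disk_measureI\<close>)
  then show "L2w_norm a u \<le> c * L2w_norm a v"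
    using assms(3) by (intro L2w_norm_leI) (simp_all add: L2w_norm_sq power_mult_distrib)
qed

lemma L2w_add: "u \<in> L2w a \<Longrightarrow> v \<in> L2w a \<Longrightarrow> (\<lambda>x. u x + v x) \<in> L2w a"
proof -
  assume u: "u \<in> L2w a" and v: "v \<in> L2w a"
  have m: "(\<lambda>x. u x + v x) \<in> borel_measurable disk_measure"
    using u v by (intro borel_measurable_add L2w_measurable)
  have "integrable disk_measure (\<lambda>x. (norm (u x + v x))\<^sup>2 * rho x powr a)"
  proof (rule Bochner_Integration.integrable_bound)
    show "integrable disk_measure (\<lambda>x. 2 * ((norm (u x))\<^sup>2 * rho x powr a) + 2 * ((norm (v x))\<^sup>2 * rho x powr a))"
      using u v by (simp add: L2w_integrable)
    show "(\<lambda>x. (norm (u x + v x))\<^sup>2 * rho x powr a) \<in> borel_measurable disk_measure"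
      by (rule weighted_square_measurable[OF m])
    have "(norm (u x + v x))\<^sup>2 * rho x powr a \<le> 2 * ((norm (u x))\<^sup>2 * rho x powr a) + 2 * ((norm (v x))\<^sup>2 * rho x powr a)" for x
    proof -
      have "(norm (u x + v x))\<^sup>2 \<le> (norm (u x) + norm (v x))\<^sup>2"
        by (intro power_mono norm_triangle_ineq) auto
      also have "\<dots> \<le> 2 * (norm (u x))\<^sup>2 + 2 * (norm (v x))\<^sup>2"
        using sum_squares_bound[of "norm (u x)" "norm (v x)"] by (simp add: power2_sum)
      finally have "(norm (u x + v x))\<^sup>2 * rho x powr a \<le> (2 * (norm (u x))\<^sup>2 + 2 * (norm (v x))\<^sup>2) * rho x powr a"
        by (rule mult_right_mono) simp
      then show ?thesis by (simp add: algebra_simps)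
    qed
    then show "AE x in disk_measure. norm ((norm (u x + v x))\<^sup>2 * rho x powr a)
      \<le> norm (2 * ((norm (u x))\<^sup>2 * rho x powr a) + 2 * ((norm (v x))\<^sup>2 * rho x powr a))"
      by (intro AE_I2) (simp add: abs_mult)
  qed
  then show ?thesis using m by (simp add: L2w_def)
qed

lemma L2w_cmult:
  assumes "u \<in> L2w a"
  shows "(\<lambda>x. c * u x) \<in> L2w a" "L2w_norm a (\<lambda>x. c * u x) \<le> norm c * L2w_norm a u"
  using L2w_bound[of "\<lambda>x. c * u x" u a "norm c"] assms L2w_measurable[OF assms]
  by (auto simp: norm_mult)

lemma L2w_minus:
  assumes "u \<in> L2w a"
  shows "(\<lambda>x. - u x) \<in> L2w a"
  using L2w_cmult(1)[OF assms, of "-1"] by simp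

lemma L2w_diff: "u \<in> L2w a \<Longrightarrow> v \<in> L2w a \<Longrightarrow> (\<lambda>x. u x - v x) \<in> L2w a"
  using L2w_add[OF _ L2w_minus, of u a v] by simp

lemma L2w_cnj:
  assumes "u \<in> L2w a"
  shows "(\<lambda>x. cnj (u x)) \<in> L2w a"
proof -
  have "(\<lambda>x. cnj (u x)) \<in> borel_measurable disk_measure"
    by (rule measurable_compose[OF L2w_measurable[OF assms]])
      (intro borel_measurable_continuous_onI continuous_intros)
  then show ?thesis using assms by (simp add: L2w_def)
qed

lemma L2w_norm_cnj: "L2w_norm a (\<lambda>x. cnj (u x)) = L2w_norm a u"
  by (simp add: L2w_norm_def)

lemma L2w_coord_mult:
  assumes u: "u \<in> L2w a"
  shows "(\<lambda>x. of_real (x $ j) * u x) \<in> L2w a" "L2w_norm a (\<lambda>x. of_real (x $ j) * u x) \<le> L2w_norm a u"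
proof -
  have m: "(\<lambda>x. of_real (x $ j) * u x) \<in> borel_measurable disk_measure"
    using continuous_disk_measurable[OF polys_continuous[OF polys_coord[of j]]] L2w_measurable[OF u] by simp
  have le: "norm (of_real (x $ j) * u x) \<le> 1 * norm (u x)" if "x \<in> unit_disk" for x
  proof -
    have "\<bar>x $ j\<bar> \<le> 1" using component_le_norm_cart[of x j] that by (simp add: unit_disk_def)
    then show ?thesis by (simp add: norm_mult mult_left_le_one_le)
  qed
  show "(\<lambda>x. of_real (x $ j) * u x) \<in> L2w a" "L2w_norm a (\<lambda>x. of_real (x $ j) * u x) \<le> L2w_norm a u"
    using L2w_bound[OF m u, of 1] le by auto
qed

lemma L2w_AE_cong:
  assumes "u \<in> L2w a" "v \<in> borel_measurable disk_measure" "AE x in disk_measure. u x = v x"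
  shows "v \<in> L2w a" "L2w_norm a v = L2w_norm a u"
proof -
  have m: "(\<lambda>x. (norm (v x))\<^sup>2 * rho x powr a) \<in> borel_measurable disk_measure"
    "(\<lambda>x. (norm (u x))\<^sup>2 * rho x powr a) \<in> borel_measurable disk_measure"
    using assms(1,2) by (simp_all add: weighted_square_measurable L2w_measurable)
  have e: "AE x in disk_measure. (norm (u x))\<^sup>2 * rho x powr a = (norm (v x))\<^sup>2 * rho x powr a"
    using assms(3) by eventually_elim simp
  show "v \<in> L2w a" using assms(1,2) integrable_cong_AE[OF m(2) m(1) e] by (simp add: L2w_def)
  show "L2w_norm a v = L2w_norm a u" using integral_cong_AE[OF m(2) m(1) e] by (simp add: L2w_norm_def)
qed

lemma rho_powr_mono: "x \<in> unit_disk \<Longrightarrow> a \<le> b \<Longrightarrow> rho x powr b \<le> rho x powr a"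
  using powr_mono'[of a b "rho x"] rho_pos_iff[of x] rho_le_1[of x] by simp

lemma L2w_mono:
  assumes u: "u \<in> L2w a" and ab: "a \<le> b"
  shows "u \<in> L2w b" "L2w_norm b u \<le> L2w_norm a u"
proof -
  have le: "(norm (u x))\<^sup>2 * rho x powr b \<le> (norm (u x))\<^sup>2 * rho x powr a" if "x \<in> unit_disk" for x
    using rho_powr_mono[OF that ab] by (intro mult_left_mono) auto
  have J: "integrable disk_measure (\<lambda>x. (norm (u x))\<^sup>2 * rho x powr b)"
  proof (rule Bochner_Integration.integrable_bound[OF L2w_integrable[OF u]])
    show "(\<lambda>x. (norm (u x))\<^sup>2 * rho x powr b) \<in> borel_measurable disk_measure"
      by (rule weighted_square_measurable[OF L2w_measurable[OF u]])
  qed (use le in \<open>auto intro!: AE_disk_measureI simp: abs_mult\<close>)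
  then show "u \<in> L2w b" using u by (simp add: L2w_def)
  have "(LINT x|disk_measure. (norm (u x))\<^sup>2 * rho x powr b) \<le> (LINT x|disk_measure. (norm (u x))\<^sup>2 * rho x powr a)"
    by (rule integral_mono_AE[OF J L2w_integrable[OF u]]) (use le in \<open>auto intro!: AE_disk_measureI\<close>)
  then show "L2w_norm b u \<le> L2w_norm a u"
    by (intro L2w_norm_leI) (simp_all add: L2w_norm_sq)
qed

text \<open>The two factors carry different weights: the Markov inequality below needs exponents \<open>a + 2\<close> and \<open>a\<close>.\<close>

lemma mixed_weight_pointwise:
  fixes p q s :: real
  assumes "x \<in> unit_disk" "0 < s" "0 \<le> p" "0 \<le> q"
  shows "p * q * rho x powr ((a + b) / 2) \<le> (s * (p\<^sup>2 * rho x powr a) + (q\<^sup>2 * rho x powr b) / s) / 2"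
proof -
  define y where "y = rho x powr (a / 2)"
  define z where "z = rho x powr (b / 2)"
  have yz: "rho x powr a = y\<^sup>2" "rho x powr b = z\<^sup>2" "rho x powr ((a + b) / 2) = y * z"
    by (simp_all add: y_def z_def power2_eq_square add_divide_distrib flip: powr_add)
  have "0 \<le> (sqrt s * (p * y) - q * z / sqrt s)\<^sup>2" by simp
  also have "\<dots> = s * (p\<^sup>2 * y\<^sup>2) + (q\<^sup>2 * z\<^sup>2) / s - 2 * (p * q * (y * z))"
    using assms(2) by (simp add: power2_diff power_mult_distrib power_divide)
  finally show ?thesis unfolding yz by simp
qed

text \<open>Optimises the scaled arithmetic-geometric mean inequality over \<open>s\<close>. The
  best choice \<open>y / x\<close> exists only for positive \<open>x\<close> and \<open>y\<close>;
  in the degenerate cases \<open>s\<close> is sent to infinity or to 0.\<close>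

lemma le_mult_if_le_scaled:
  fixes x y c :: real
  assumes "\<And>s. 0 < s \<Longrightarrow> c \<le> (s * x\<^sup>2 + y\<^sup>2 / s) / 2" "0 \<le> x" "0 \<le> y"
  shows "c \<le> x * y"
proof -
  have key: "c \<le> 0 + e" if "c \<le> (p + q) / 2" "p \<le> e" "q \<le> e" for p q e :: real
    using that by simp
  consider "x = 0" | "y = 0" | "0 < x" "0 < y" using assms(2,3) by linarith
  then show ?thesis
  proof cases
    case 1
    have "c \<le> 0"
    proof (rule field_le_epsilon)
      fix e :: real assume e: "0 < e"
      show "c \<le> 0 + e"
      proof (rule key[OF assms(1)])
        show "0 < (y\<^sup>2 + 1) / e" using e by (simp add: add_nonneg_pos)
        show "(y\<^sup>2 + 1) / e * x\<^sup>2 \<le> e" using 1 e by simp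
        show "y\<^sup>2 / ((y\<^sup>2 + 1) / e) \<le> e" using e by (simp add: divide_simps add_nonneg_pos mult_left_mono)
      qed
    qed
    then show ?thesis using 1 by simp
  next
    case 2
    have "c \<le> 0"
    proof (rule field_le_epsilon)
      fix e :: real assume e: "0 < e"
      show "c \<le> 0 + e"
      proof (rule key[OF assms(1)])
        show "0 < e / (x\<^sup>2 + 1)" using e by (simp add: add_nonneg_pos)
        show "y\<^sup>2 / (e / (x\<^sup>2 + 1)) \<le> e" using 2 e by simp
        show "e / (x\<^sup>2 + 1) * x\<^sup>2 \<le> e" using e by (simp add: divide_simps add_nonneg_pos mult_left_mono not_less)
      qed
    qed
    then show ?thesis using 2 by simp
  next
    case 3
    then show ?thesis using assms(1)[of "y / x"] by (simp add: power2_eq_square)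
  qed
qed

text \<open>Cauchy-Schwarz with a different weight on each factor. The exponent \<open>c\<close> is
  a separate variable with an equation so that the rule applies to exponents such as
  \<open>a + 1\<close>, the mean of \<open>a + 2\<close> and \<open>a\<close>.\<close>

lemma L2w_mixed_integrable:
  assumes u: "u \<in> L2w a" and v: "v \<in> L2w b" and c: "c = (a + b) / 2"
  shows "integrable disk_measure (\<lambda>x. norm (u x) * norm (v x) * rho x powr c)"
    "integrable disk_measure (\<lambda>x. u x * v x * of_real (rho x powr c))"
    "(LINT x|disk_measure. norm (u x) * norm (v x) * rho x powr c) \<le> L2w_norm a u * L2w_norm b v"
proof -
  have J: "integrable disk_measure (\<lambda>x. (s * ((norm (u x))\<^sup>2 * rho x powr a) + ((norm (v x))\<^sup>2 * rho x powr b) / s) / 2)" for s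
    using L2w_integrable[OF u] L2w_integrable[OF v] by (auto intro!: integrable_divide)
  note pw = mixed_weight_pointwise[of _ _ "norm _" "norm _" a b, folded c]
  have meas: "(\<lambda>x. norm (u x) * norm (v x) * rho x powr c) \<in> borel_measurable disk_measure"
    "(\<lambda>x. u x * v x * of_real (rho x powr c)) \<in> borel_measurable disk_measure"
    using L2w_measurable[OF u] L2w_measurable[OF v] rho_powr_measurable by measurable
  show I: "integrable disk_measure (\<lambda>x. norm (u x) * norm (v x) * rho x powr c)"
    by (rule Bochner_Integration.integrable_bound[OF J[of 1] meas(1)])
       (use pw[of _ 1] in \<open>auto intro!: AE_disk_measureI simp: abs_mult\<close>)
  show "integrable disk_measure (\<lambda>x. u x * v x * of_real (rho x powr c))"
    by (rule Bochner_Integration.integrable_bound[OF I meas(2)]) (auto simp: norm_mult abs_mult)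
  show "(LINT x|disk_measure. norm (u x) * norm (v x) * rho x powr c) \<le> L2w_norm a u * L2w_norm b v"
  proof (rule le_mult_if_le_scaled)
    fix s :: real assume s: "0 < s"
    have "(LINT x|disk_measure. norm (u x) * norm (v x) * rho x powr c) \<le>
       (LINT x|disk_measure. (s * ((norm (u x))\<^sup>2 * rho x powr a) + ((norm (v x))\<^sup>2 * rho x powr b) / s) / 2)"
      by (rule integral_mono_AE[OF I J]) (use pw s in \<open>auto intro!: AE_disk_measureI\<close>)
    also have "\<dots> = (s * (L2w_norm a u)\<^sup>2 + (L2w_norm b v)\<^sup>2 / s) / 2"
      using L2w_integrable[OF u] L2w_integrable[OF v] by (simp add: L2w_norm_sq)
    finally show "(LINT x|disk_measure. norm (u x) * norm (v x) * rho x powr c) \<le> \<dots>" .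
  qed auto
qed

lemma L2w_norm_triangle:
  assumes u: "u \<in> L2w a" and v: "v \<in> L2w a"
  shows "L2w_norm a (\<lambda>x. u x + v x) \<le> L2w_norm a u + L2w_norm a v"
proof (rule L2w_norm_leI)
  have a: "a = (a + a) / 2" by simp
  note [simp] = L2w_mixed_integrable(1)[OF u v a] L2w_integrable[OF u] L2w_integrable[OF v] L2w_integrable[OF L2w_add[OF u v]]
  have "(L2w_norm a (\<lambda>x. u x + v x))\<^sup>2 \<le> (LINT x|disk_measure. (norm (u x))\<^sup>2 * rho x powr a + 
     (2 * (norm (u x) * norm (v x) * rho x powr a) + (norm (v x))\<^sup>2 * rho x powr a))"
    unfolding L2w_norm_sq
  proof (rule integral_mono)
    fix x
    have "(norm (u x + v x))\<^sup>2 * rho x powr a \<le> (norm (u x) + norm (v x))\<^sup>2 * rho x powr a"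
      by (intro mult_right_mono power_mono norm_triangle_ineq) auto
    then show "(norm (u x + v x))\<^sup>2 * rho x powr a \<le> (norm (u x))\<^sup>2 * rho x powr a + 
     (2 * (norm (u x) * norm (v x) * rho x powr a) + (norm (v x))\<^sup>2 * rho x powr a)"
      by (simp add: power2_sum algebra_simps)
  qed auto
  also have "\<dots> = (L2w_norm a u)\<^sup>2 + (2 * (LINT x|disk_measure. norm (u x) * norm (v x) * rho x powr a) + (L2w_norm a v)\<^sup>2)"
    by (simp add: L2w_norm_sq)
  also have "\<dots> \<le> (L2w_norm a u + L2w_norm a v)\<^sup>2"
    using L2w_mixed_integrable(3)[OF u v a] by (simp add: power2_sum)
  finally show "(L2w_norm a (\<lambda>x. u x + v x))\<^sup>2 \<le> (L2w_norm a u + L2w_norm a v)\<^sup>2" .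
qed auto

text \<open>The inner product without the conjugate. Integration by parts is bilinear, and since
  \<open>polys N\<close> is closed under conjugation, orthogonality to polynomials means the same
  for both forms.\<close>

definition pairing :: "real \<Rightarrow> (real ^ 2 \<Rightarrow> complex) \<Rightarrow> (real ^ 2 \<Rightarrow> complex) \<Rightarrow> complex" where
  "pairing c u v = (LINT x|disk_measure. u x * v x * of_real (rho x powr c))"

lemma pairing_inner: "L2w_inner c u v = pairing c u (\<lambda>x. cnj (v x))"
  by (simp add: L2w_inner_def pairing_def)

lemma pairing_mixed_bound:
  assumes "u \<in> L2w a" "v \<in> L2w b" "c = (a + b) / 2"
  shows "norm (pairing c u v) \<le> L2w_norm a u * L2w_norm b v"
proof -
  have "norm (pairing c u v) \<le> (LINT x|disk_measure. norm (u x * v x * of_real (rho x powr c)))"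
    unfolding pairing_def by (rule integral_norm_bound)
  also have "\<dots> = (LINT x|disk_measure. norm (u x) * norm (v x) * rho x powr c)"
    by (simp add: norm_mult)
  finally show ?thesis using L2w_mixed_integrable(3)[OF assms] by linarith
qed

lemma pairing_bound: "u \<in> L2w a \<Longrightarrow> v \<in> L2w a \<Longrightarrow> norm (pairing a u v) \<le> L2w_norm a u * L2w_norm a v"
  by (rule pairing_mixed_bound) auto

lemma pairing_integrable:
  "u \<in> L2w a \<Longrightarrow> v \<in> L2w a \<Longrightarrow> integrable disk_measure (\<lambda>x. u x * v x * of_real (rho x powr a))"
  by (rule L2w_mixed_integrable(2)) auto

lemma pairing_commute: "pairing a u v = pairing a v u"
  by (simp add: pairing_def mult.commute)

lemma pairing_add_left:
  "u \<in> L2w a \<Longrightarrow> v \<in> L2w a \<Longrightarrow> w \<in> L2w a \<Longrightarrow> pairing a (\<lambda>x. u x + v x) w = pairing a u w + pairing a v w"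
  unfolding pairing_def by (simp add: distrib_right pairing_integrable)

lemma pairing_diff_left:
  "u \<in> L2w a \<Longrightarrow> v \<in> L2w a \<Longrightarrow> w \<in> L2w a \<Longrightarrow> pairing a (\<lambda>x. u x - v x) w = pairing a u w - pairing a v w"
  unfolding pairing_def by (simp add: left_diff_distrib pairing_integrable)

lemma pairing_cmult_left: "pairing a (\<lambda>x. c * u x) w = c * pairing a u w"
  unfolding pairing_def by (simp add: mult.assoc)

lemma pairing_add_right:
  "u \<in> L2w a \<Longrightarrow> v \<in> L2w a \<Longrightarrow> w \<in> L2w a \<Longrightarrow> pairing a w (\<lambda>x. u x + v x) = pairing a w u + pairing a w v"
  using pairing_add_left by (simp add: pairing_commute[of a w])

lemma pairing_diff_right:
  "u \<in> L2w a \<Longrightarrow> v \<in> L2w a \<Longrightarrow> w \<in> L2w a \<Longrightarrow> pairing a w (\<lambda>x. u x - v x) = pairing a w u - pairing a w v"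
  using pairing_diff_left by (simp add: pairing_commute[of a w])

lemma pairing_cmult_right: "pairing a w (\<lambda>x. c * u x) = c * pairing a w u"
  using pairing_cmult_left by (simp add: pairing_commute[of a w])

lemma pairing_cnj_self: "pairing a u (\<lambda>x. cnj (u x)) = of_real ((L2w_norm a u)\<^sup>2)"
  unfolding pairing_def L2w_norm_sq
  by (subst integral_complex_of_real[symmetric]) (simp add: complex_norm_square del: of_real_power flip: of_real_power)

lemma pairing_cnj_cnj: "pairing a (\<lambda>x. cnj (u x)) (\<lambda>x. cnj (v x)) = cnj (pairing a u v)"
proof -
  have "pairing a (\<lambda>x. cnj (u x)) (\<lambda>x. cnj (v x)) = (LINT x|disk_measure. cnj (u x * v x * of_real (rho x powr a)))"
    by (simp add: pairing_def)
  also have "\<dots> = cnj (pairing a u v)" unfolding pairing_def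
    by (rule integral_bounded_linear'[OF bounded_linear_cnj bounded_linear_cnj]) simp
  finally show ?thesis .
qed

text \<open>The step between neighbouring exponents: \<open>rho\<close> is positive in the disk, so
  the extra factor can be moved onto the second argument, where it costs a polynomial two
  degrees.\<close>

lemma pairing_shift: "pairing (a + 1) u v = pairing a u (\<lambda>x. of_real (rho x) * v x)"
proof -
  have "rho x powr (a + 1) = rho x powr a * rho x" if "x \<in> unit_disk" for x
    using that rho_pos_iff[of x] by (simp add: powr_add)
  then show ?thesis unfolding pairing_def
    by (intro Bochner_Integration.integral_cong) auto
qed

section \<open>Integration by parts against the weight\<close>

lemma cutoff_nonneg: "0 \<le> cutoff e s n t"
  by (simp add: cutoff_def)

lemma cutoff_le_powr: "0 < e \<Longrightarrow> cutoff e s 0 t \<le> t powr s"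
  by (auto simp: cutoff_def intro!: mult_left_le)

text \<open>For \<open>t > e\<close> and \<open>y = e / (t - e)\<close> the left side is
  \<open>t powr (s - 1) * y * (1 + y) * exp (- y)\<close>, and
  \<open>y * (1 + y) <= 2 * exp y\<close>. This dominates, uniformly in \<open>e\<close>, the term
  of the derivative that tends to 0 only pointwise.\<close>

lemma cutoff_2_le_powr:
  assumes "0 < e"
  shows "e * cutoff e s 2 t \<le> 2 * t powr (s - 1)"
proof (cases "t \<le> e")
  case False
  define y where "y = e * inverse (t - e)"
  have y: "0 < y" using False assms by (simp add: y_def)
  have t: "t * inverse (t - e) = 1 + y"
    using False by (simp add: y_def field_simps)
  have "e * cutoff e s 2 t = (t powr (s - 1) * t) * (e * inverse (t - e) * inverse (t - e)) * exp (- y)"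
    using False assms by (simp add: cutoff_def y_def power2_eq_square powr_diff)
  also have "\<dots> = t powr (s - 1) * (y * (1 + y) * exp (- y))"
    unfolding t[symmetric] by (simp add: y_def mult_ac)
  also have "\<dots> \<le> t powr (s - 1) * 2"
  proof (rule mult_left_mono)
    have "1 + y + y\<^sup>2 / 2 \<le> exp y" using y by (intro exp_lower_Taylor_quadratic) simp
    then have "y * (1 + y) \<le> 2 * exp y" using y by (simp add: power2_eq_square distrib_left)
    then show "y * (1 + y) * exp (- y) \<le> 2" by (simp add: exp_minus field_simps)
  qed simp
  finally show ?thesis by simp
qed (simp add: cutoff_def)

lemma partial_poly_cutoff_0:
  assumes "q \<in> polys N" "0 < e"
  shows "partial i (\<lambda>x. q x * of_real (cutoff e s 0 (rho x))) x =
    partial i q x * of_real (cutoff e s 0 (rho x)) - 2 * of_real (x $ i) * q x *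
     of_real (s * cutoff e (s - 1) 0 (rho x) + e * cutoff e s 2 (rho x))"
  using partial_poly_cutoff[OF assms, of i s 0 x] by (simp add: numeral_2_eq_2)

definition eps :: "nat \<Rightarrow> real" where "eps n = inverse (real (Suc n))"

lemma eps_pos [simp]: "0 < eps n" by (simp add: eps_def)

lemma eps_lim: "eps \<longlonglongrightarrow> 0"
  unfolding eps_def by (rule LIMSEQ_inverse_real_of_nat)

lemma cutoff_lim:
  assumes "0 < t"
  shows "(\<lambda>n. cutoff (eps n) s k t) \<longlonglongrightarrow> t powr s * inverse t ^ k"
proof (rule Lim_transform_eventually)
  have "(\<lambda>n. t powr s * inverse (t - eps n) ^ k * exp (- eps n * inverse (t - eps n)))
     \<longlonglongrightarrow> t powr s * inverse (t - 0) ^ k * exp (- 0 * inverse (t - 0))"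
    using assms by (intro tendsto_intros eps_lim) auto
  then show "(\<lambda>n. t powr s * inverse (t - eps n) ^ k * exp (- eps n * inverse (t - eps n)))
     \<longlonglongrightarrow> t powr s * inverse t ^ k" by simp
  have "\<forall>\<^sub>F n in sequentially. eps n < t" using order_tendstoD(2)[OF eps_lim assms] .
  then show "\<forall>\<^sub>F n in sequentially. t powr s * inverse (t - eps n) ^ k * exp (- eps n * inverse (t - eps n)) = cutoff (eps n) s k t"
    by eventually_elim (simp add: cutoff_def)
qed

lemma cutoff_lim_0: "0 < t \<Longrightarrow> (\<lambda>n. cutoff (eps n) s 0 t) \<longlonglongrightarrow> t powr s"
  using cutoff_lim[of t s 0] by simp

lemma cutoff_lim_2: "0 < t \<Longrightarrow> (\<lambda>n. eps n * cutoff (eps n) s 2 t) \<longlonglongrightarrow> 0"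
  using tendsto_mult[OF eps_lim cutoff_lim[of t s 2]] by simp

lemma polys_locally_integrable: "p \<in> polys N \<Longrightarrow> locally_integrable p"
  using borel_integrable_compact[OF _ polys_continuous]
  by (simp add: locally_integrable_def set_integrable_def integrable_completion)

lemma test_function_integrable: "test_function \<phi> \<Longrightarrow> integrable disk_measure \<phi>"
  using locally_integrable_test[OF polys_locally_integrable[OF polys_const[of 1 0]]] by simp

lemma partial_coord: "partial i (\<lambda>x. complex_of_real (x $ j)) x = (if i = j then 1 else 0)"
proof -
  have "bounded_linear (\<lambda>x::real^2. complex_of_real (x $ j))"
    by (rule bounded_linear_compose[OF bounded_linear_of_real bounded_linear_vec_nth])
  from partial_eqI[OF bounded_linear_imp_has_derivative[OF this]]
  show ?thesis by (auto simp: axis_def)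
qed

lemma partial_coord_mult:
  "p \<in> polys N \<Longrightarrow> partial i (\<lambda>x. of_real (x $ j) * p x) x = of_real (x $ j) * partial i p x + (if i = j then p x else 0)"
  by (simp add: partial_mult polys_differentiable[OF polys_coord] polys_differentiable partial_coord)

text \<open>The divergence theorem for the field \<open>x * cutoff (rho x)\<close> bounds the integral of
  \<open>|x|\<^sup>2 * rho x powr a\<close>.\<close>

lemma cutoff_integral_bound:
  assumes a: "-1 < a" and e: "0 < e"
  shows "integrable disk_measure (\<lambda>x. (norm x)\<^sup>2 * cutoff e a 0 (rho x))"
    "(a + 1) * (LINT x|disk_measure. (norm x)\<^sup>2 * cutoff e a 0 (rho x)) \<le> measure disk_measure unit_disk"
proof -
  \<comment> \<open>\<open>D\<close> is the derivative of \<open>cutoff e (a + 1) 0\<close>, that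
    is, \<open>cutoff_deriv\<close> without a pole.\<close>
  define D where "D t = (a + 1) * cutoff e a 0 t + e * cutoff e (a + 1) 2 t" for t
  have re: "integrable disk_measure f" if "integrable disk_measure (\<lambda>x. complex_of_real (f x))" for f
    using that complex_of_real_integrable_eq by blast
  have intq: "integrable disk_measure (\<lambda>x. (x $ j)\<^sup>2 * cutoff e s n (rho x))" for s n and j :: 2
  proof (rule re)
    have "(\<lambda>x. of_real (x $ j) * of_real (x $ j)) \<in> polys (Suc (Suc 0))" by (intro polys_mult_coord polys_coord)
    from test_function_integrable[OF test_function_cutoff[OF e this, of s n]]
    show "integrable disk_measure (\<lambda>x. complex_of_real ((x $ j)\<^sup>2 * cutoff e s n (rho x)))"
      by (simp add: power2_eq_square)
  qed
  have intc: "integrable disk_measure (\<lambda>x. cutoff e (a + 1) 0 (rho x))"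
    by (rule re) (use test_function_integrable[OF test_function_cutoff[OF e polys_const[of 1 0], of "a + 1" 0]] in simp)
  have intD: "integrable disk_measure (\<lambda>x. (x $ j)\<^sup>2 * D (rho x))" for j :: 2
  proof -
    have "integrable disk_measure (\<lambda>x. (a + 1) * ((x $ j)\<^sup>2 * cutoff e a 0 (rho x)) + e * ((x $ j)\<^sup>2 * cutoff e (a + 1) 2 (rho x)))"
      using intq by simp
    then show ?thesis by (simp add: D_def algebra_simps)
  qed
  have div: "(LINT x|disk_measure. cutoff e (a + 1) 0 (rho x)) = 2 * (LINT x|disk_measure. (x $ j)\<^sup>2 * D (rho x))" for j :: 2
  proof -
    define \<phi> where "\<phi> = (\<lambda>x::real^2. of_real (x $ j) * complex_of_real (cutoff e (a + 1) 0 (rho x)))"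
    have t: "test_function \<phi>" unfolding \<phi>_def by (rule test_function_cutoff[OF e polys_coord])
    have "0 = (LINT x|disk_measure. partial j \<phi> x)"
      using integral_partial_eq_0[of \<phi> j] t
      by (simp add: test_function_differentiable test_function_continuous test_function_partial test_function_support)
    also have "\<dots> = (LINT x|disk_measure. complex_of_real (cutoff e (a + 1) 0 (rho x) - 2 * ((x $ j)\<^sup>2 * D (rho x))))"
      by (rule Bochner_Integration.integral_cong)
        (simp_all add: \<phi>_def partial_poly_cutoff_0[OF polys_coord e] partial_coord D_def power2_eq_square)
    also have "\<dots> = of_real ((LINT x|disk_measure. cutoff e (a + 1) 0 (rho x)) - 2 * (LINT x|disk_measure. (x $ j)\<^sup>2 * D (rho x)))"
      unfolding integral_complex_of_real using intc intD by simp
    finally have "0 = complex_of_real ((LINT x|disk_measure. cutoff e (a + 1) 0 (rho x)) - 2 * (LINT x|disk_measure. (x $ j)\<^sup>2 * D (rho x)))" .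
    from sym[OF this] show ?thesis unfolding of_real_eq_0_iff right_minus_eq .
  qed
  have nsq: "(norm x)\<^sup>2 = (x $ 1)\<^sup>2 + (x $ 2)\<^sup>2" for x :: "real ^ 2"
    using rho_eq[of x] by (simp add: rho_def)
  show I: "integrable disk_measure (\<lambda>x. (norm x)\<^sup>2 * cutoff e a 0 (rho x))"
    unfolding nsq distrib_right using intq by simp
  \<comment> \<open>Discarding the nonnegative exponential term of \<open>D\<close> leaves the
    wanted integral. Adding the divergence identity over both coordinates then bounds it by the
    integral of \<open>cutoff e (a + 1) 0\<close>, whose exponent is positive.\<close>
  have "(LINT x|disk_measure. (a + 1) * ((norm x)\<^sup>2 * cutoff e a 0 (rho x)))
      \<le> (LINT x|disk_measure. (x $ 1)\<^sup>2 * D (rho x) + (x $ 2)\<^sup>2 * D (rho x))"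
  proof (rule integral_mono)
    fix x
    have "0 \<le> (norm x)\<^sup>2 * (e * cutoff e (a + 1) 2 (rho x))"
      using e cutoff_nonneg by simp
    then show "(a + 1) * ((norm x)\<^sup>2 * cutoff e a 0 (rho x)) \<le> (x $ 1)\<^sup>2 * D (rho x) + (x $ 2)\<^sup>2 * D (rho x)"
      unfolding nsq D_def by (simp add: algebra_simps)
  qed (use I intD in auto)
  also have "\<dots> = (LINT x|disk_measure. cutoff e (a + 1) 0 (rho x))"
    using intD div[of 1] div[of 2] by simp
  also have "\<dots> \<le> (LINT x|disk_measure. 1)"
  proof (rule integral_mono_AE[OF intc])
    show "integrable disk_measure (\<lambda>x. 1 :: real)"
      by (rule finite_measure.integrable_const[OF finite_measure_disk])
    have "cutoff e (a + 1) 0 (rho x) \<le> 1" if "x \<in> unit_disk" for x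
    proof -
      have "rho x powr (a + 1) \<le> rho x powr 0" using that a by (intro rho_powr_mono) auto
      then show ?thesis using cutoff_le_powr[OF e, of "a + 1" "rho x"] that by (simp add: rho_pos_iff[symmetric] split: if_splits)
    qed
    then show "AE x in disk_measure. cutoff e (a + 1) 0 (rho x) \<le> 1" by (rule AE_disk_measureI)
  qed
  finally show "(a + 1) * (LINT x|disk_measure. (norm x)\<^sup>2 * cutoff e a 0 (rho x)) \<le> measure disk_measure unit_disk"
    using I by simp
qed

text \<open>Fatou's lemma removes the cutoff from the preceding uniform bound, which controls
  \<open>|x|^2\<close> times the weight. The factor \<open>|x|^2\<close> goes by
  \<open>rho powr a = |x|^2 * rho powr a + rho powr (a + 1)\<close>, whose last term is
  bounded.\<close>

lemma rho_powr_integrable: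
  assumes a: "-1 < a"
  shows "integrable disk_measure (\<lambda>x. rho x powr a)"
proof -
  define K where "K = measure disk_measure unit_disk / (a + 1)"
  have m: "(\<lambda>x. (norm x)\<^sup>2 * rho x powr a) \<in> borel_measurable disk_measure"
    by (intro borel_measurable_times rho_powr_measurable continuous_disk_measurable continuous_intros)
  have "(\<integral>\<^sup>+x. ennreal ((norm x)\<^sup>2 * rho x powr a) \<partial>disk_measure) =
      (\<integral>\<^sup>+x. liminf (\<lambda>n. ennreal ((norm x)\<^sup>2 * cutoff (eps n) a 0 (rho x))) \<partial>disk_measure)"
  proof (rule nn_integral_cong)
    fix x assume "x \<in> space disk_measure"
    then have "0 < rho x" by (simp add: rho_pos_iff)
    then have "(\<lambda>n. ennreal ((norm x)\<^sup>2 * cutoff (eps n) a 0 (rho x))) \<longlonglongrightarrow> ennreal ((norm x)\<^sup>2 * rho x powr a)"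
      by (intro tendsto_ennrealI tendsto_mult tendsto_const cutoff_lim_0)
    from lim_imp_Liminf[OF sequentially_bot this]
    show "ennreal ((norm x)\<^sup>2 * rho x powr a) = liminf (\<lambda>n. ennreal ((norm x)\<^sup>2 * cutoff (eps n) a 0 (rho x)))" by simp
  qed
  also have "\<dots> \<le> liminf (\<lambda>n. \<integral>\<^sup>+x. ennreal ((norm x)\<^sup>2 * cutoff (eps n) a 0 (rho x)) \<partial>disk_measure)"
    by (rule nn_integral_liminf) (use cutoff_integral_bound(1)[OF a eps_pos] in simp)
  also have "\<dots> \<le> ennreal K"
  proof (rule order_trans[OF Liminf_le_Limsup Limsup_bounded])
    show "\<forall>\<^sub>F n in sequentially. (\<integral>\<^sup>+x. ennreal ((norm x)\<^sup>2 * cutoff (eps n) a 0 (rho x)) \<partial>disk_measure) \<le> ennreal K"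
    proof (rule always_eventually, rule allI)
      fix n
      have "(\<integral>\<^sup>+x. ennreal ((norm x)\<^sup>2 * cutoff (eps n) a 0 (rho x)) \<partial>disk_measure)
         = ennreal (LINT x|disk_measure. (norm x)\<^sup>2 * cutoff (eps n) a 0 (rho x))"
        using cutoff_nonneg by (intro nn_integral_eq_integral cutoff_integral_bound(1)[OF a eps_pos]) auto
      also have "\<dots> \<le> ennreal K"
        using cutoff_integral_bound(2)[OF a eps_pos, of n] a by (intro ennreal_leI) (simp add: K_def field_simps)
      finally show "(\<integral>\<^sup>+x. ennreal ((norm x)\<^sup>2 * cutoff (eps n) a 0 (rho x)) \<partial>disk_measure) \<le> ennreal K" .
    qed
  qed simp
  finally have "(\<integral>\<^sup>+x. ennreal ((norm x)\<^sup>2 * rho x powr a) \<partial>disk_measure) < \<infinity>"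
    by (simp add: less_top[symmetric] top_unique) (metis ennreal_less_top infinity_ennreal_def leD top.not_eq_extremum)
  then have 1: "integrable disk_measure (\<lambda>x. (norm x)\<^sup>2 * rho x powr a)"
    by (intro integrableI_nonneg m) auto
  have 2: "integrable disk_measure (\<lambda>x. rho x powr (a + 1))"
  proof (rule Bochner_Integration.integrable_bound[OF _ rho_powr_measurable])
    show "integrable disk_measure (\<lambda>x. 1 :: real)"
      by (rule finite_measure.integrable_const[OF finite_measure_disk])
    have "rho x powr (a + 1) \<le> rho x powr 0" if "x \<in> unit_disk" for x using that a by (intro rho_powr_mono) auto
    then show "AE x in disk_measure. norm (rho x powr (a + 1)) \<le> norm (1::real)"
      by (intro AE_disk_measureI) (auto simp: rho_pos_iff[symmetric] split: if_splits)
  qed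
  have "rho x powr a = (norm x)\<^sup>2 * rho x powr a + rho x powr (a + 1)" if "x \<in> unit_disk" for x
  proof -
    have "rho x powr (a + 1) = rho x powr a * rho x" using that rho_pos_iff[of x] by (simp add: powr_add)
    then show ?thesis by (simp add: rho_def algebra_simps)
  qed
  then have "integrable disk_measure (\<lambda>x. rho x powr a) \<longleftrightarrow>
      integrable disk_measure (\<lambda>x. (norm x)\<^sup>2 * rho x powr a + rho x powr (a + 1))"
    by (intro Bochner_Integration.integrable_cong) auto
  then show ?thesis using 1 2 by simp
qed

lemma bounded_in_L2w:
  assumes a: "-1 < a" and u: "u \<in> borel_measurable disk_measure" and B: "\<And>x. x \<in> unit_disk \<Longrightarrow> norm (u x) \<le> B"
  shows "u \<in> L2w a"
proof -
  have "(\<lambda>x. 1) \<in> L2w a" using rho_powr_integrable[OF a] by (simp add: L2w_def)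
  from L2w_bound(1)[OF u this, of "max 0 B"] B show ?thesis by force
qed

lemma polys_L2w: "-1 < a \<Longrightarrow> p \<in> polys N \<Longrightarrow> p \<in> L2w a"
proof -
  assume a: "-1 < a" and p: "p \<in> polys N"
  obtain B where B: "\<And>x. norm x \<le> 1 \<Longrightarrow> norm (p x) \<le> B"
    using bounded_on_disk[OF polys_continuous[OF p]] by blast
  show ?thesis
    by (rule bounded_in_L2w[OF a polys_measurable[OF p], of B]) (use B in \<open>auto simp: unit_disk_def\<close>)
qed

lemma L2w_weighted_integrable:
  assumes "-1 < a" "u \<in> L2w a"
  shows "integrable disk_measure (\<lambda>x. norm (u x) * rho x powr a)"
  using L2w_mixed_integrable(1)[OF assms(2) polys_L2w[OF assms(1) polys_const[of 1 0]], of a] by simp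

text \<open>On a nonempty compact subset of the disk the weight has a positive minimum, whatever the
  sign of \<open>a\<close>.\<close>

lemma L2w_locally_integrable:
  assumes a: "-1 < a" and u: "u \<in> L2w a"
  shows "locally_integrable u"
  unfolding locally_integrable_def
proof (intro allI impI, elim conjE)
  fix K assume K: "compact K" "K \<subseteq> unit_disk"
  have Ks: "K \<in> sets lebesgue" using K(1) by (simp add: lmeasurable_compact fmeasurableD)
  have "continuous_on K (\<lambda>x. rho x powr a)"
    using K(2) by (intro continuous_on_powr' continuous_rho continuous_on_const) (auto simp: rho_pos_iff[symmetric] less_imp_le dest: subsetD)
  then obtain m where m: "0 < m" "\<And>x. x \<in> K \<Longrightarrow> m \<le> rho x powr a"
  proof (cases "K = {}")
    case False
    then obtain x0 where "x0 \<in> K" "\<And>x. x \<in> K \<Longrightarrow> rho x0 powr a \<le> rho x powr a"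
      using continuous_attains_inf[OF K(1) False \<open>continuous_on K _\<close>] by blast
    moreover have "0 < rho x0 powr a" using \<open>x0 \<in> K\<close> K(2) rho_pos_iff by force
    ultimately show thesis using that by blast
  qed (use that[of 1] in auto)
  have D: "integrable lebesgue (\<lambda>x. indicator unit_disk x *\<^sub>R (norm (u x) * rho x powr a))"
    using L2w_weighted_integrable[OF a u] by (simp add: integrable_restrict_space)
  have um: "(\<lambda>x. indicator unit_disk x *\<^sub>R u x) \<in> borel_measurable lebesgue"
    using L2w_measurable[OF u] by (simp add: borel_measurable_restrict_space_iff)
  have "integrable lebesgue (\<lambda>x. indicator K x *\<^sub>R u x)"
  proof (rule Bochner_Integration.integrable_bound[OF integrable_mult_right[OF D, of "inverse m"]])
    have "(\<lambda>x. indicator K x *\<^sub>R (indicator unit_disk x *\<^sub>R u x)) \<in> borel_measurable lebesgue"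
      by (intro borel_measurable_scaleR[OF borel_measurable_indicator[OF Ks] um])
    moreover have "(\<lambda>x. indicator K x *\<^sub>R (indicator unit_disk x *\<^sub>R u x)) = (\<lambda>x. indicator K x *\<^sub>R u x)"
      using K(2) by (auto simp: indicator_def fun_eq_iff)
    ultimately show "(\<lambda>x. indicator K x *\<^sub>R u x) \<in> borel_measurable lebesgue" by (simp only:)
    have "norm (u x) \<le> inverse m * (norm (u x) * rho x powr a)" if "x \<in> K" for x
      using m(2)[OF that] m(1) mult_left_mono[of m "rho x powr a" "norm (u x)"] by (simp add: field_simps)
    then show "AE x in lebesgue. norm (indicator K x *\<^sub>R u x) \<le> norm (inverse m * indicator unit_disk x *\<^sub>R (norm (u x) * rho x powr a))"
      using K(2) m(1) by (intro AE_I2) (auto simp: indicator_def abs_mult)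
  qed
  then show "u absolutely_integrable_on K" by (simp add: set_integrable_def)
qed

text \<open>The common limit step of the two integrations by parts below: dominating the test
  functions by the weight is enough, because an element of \<open>L2w a\<close> is integrable
  against the weight.\<close>

lemma weighted_dominated_convergence:
  fixes v G :: "real ^ 2 \<Rightarrow> complex"
  assumes v: "v \<in> borel_measurable disk_measure" "integrable disk_measure (\<lambda>x. norm (v x) * rho x powr a)"
    and F: "\<And>n. F n \<in> borel_measurable disk_measure"
    and lim: "\<And>x. x \<in> unit_disk \<Longrightarrow> (\<lambda>n. F n x) \<longlonglongrightarrow> G x"
    and bnd: "\<And>n x. x \<in> unit_disk \<Longrightarrow> norm (F n x) \<le> K * rho x powr a"
  shows "(\<lambda>n. LINT x|disk_measure. v x * F n x) \<longlonglongrightarrow> (LINT x|disk_measure. v x * G x)"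
proof (rule integral_dominated_convergence)
  have "G \<in> borel_measurable disk_measure"
    by (rule borel_measurable_LIMSEQ_metric[OF F]) (use lim in simp)
  then show "(\<lambda>x. v x * G x) \<in> borel_measurable disk_measure" using v(1) by simp
  show "(\<lambda>x. v x * F n x) \<in> borel_measurable disk_measure" for n using v(1) F by simp
  show "integrable disk_measure (\<lambda>x. K * (norm (v x) * rho x powr a))" using v(2) by simp
  show "AE x in disk_measure. (\<lambda>n. v x * F n x) \<longlonglongrightarrow> v x * G x"
    by (intro AE_disk_measureI tendsto_mult tendsto_const lim)
  show "AE x in disk_measure. norm (v x * F n x) \<le> K * (norm (v x) * rho x powr a)" for n
  proof (rule AE_disk_measureI)
    fix x assume "x \<in> unit_disk"
    from mult_left_mono[OF bnd[OF this, of n], of "norm (v x)"]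
    show "norm (v x * F n x) \<le> K * (norm (v x) * rho x powr a)" by (simp add: norm_mult mult_ac)
  qed
qed

text \<open>Test with \<open>q\<close> times a cutoff of \<open>rho powr (a + 1)\<close> and remove
  the cutoff; as \<open>a + 1 > 0\<close>, no boundary term is left. After \<open>rho powr a\<close>
  is factored out, the second argument on the right is a polynomial whose degree exceeds that of
  \<open>q\<close> by at most one.\<close>

lemma weak_parts:
  assumes a: "-1 < a" and u: "u \<in> L2w a" and w: "w \<in> L2w a" and d: "weak_partial j u w" and q: "q \<in> polys N"
  shows "pairing (a + 1) w q = pairing a u (\<lambda>x. of_real (2 * (a + 1)) * (of_real (x $ j) * q x) - of_real (rho x) * partial j q x)"
proof -
  define \<phi> where "\<phi> n = (\<lambda>x. q x * complex_of_real (cutoff (eps n) (a + 1) 0 (rho x)))" for n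
  have t: "test_function (\<phi> n)" for n unfolding \<phi>_def by (rule test_function_cutoff[OF eps_pos q])
  have p\<phi>: "partial j (\<phi> n) x = partial j q x * of_real (cutoff (eps n) (a + 1) 0 (rho x)) - 2 * of_real (x $ j) * q x *
     of_real ((a + 1) * cutoff (eps n) a 0 (rho x) + eps n * cutoff (eps n) (a + 1) 2 (rho x))" for n x
    unfolding \<phi>_def by (simp add: partial_poly_cutoff_0[OF q eps_pos])
  obtain B where B: "B > 0" "\<And>x. norm x \<le> 1 \<Longrightarrow> norm (q x) \<le> B"
    using bounded_on_disk[OF polys_continuous[OF q]] by blast
  obtain B' where B': "B' > 0" "\<And>x. norm x \<le> 1 \<Longrightarrow> norm (partial j q x) \<le> B'"
    using bounded_on_disk[OF polys_continuous[OF partial_polys[OF q]]] by blast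
  have le1: "norm x \<le> 1" if "x \<in> unit_disk" for x using that by (simp add: unit_disk_def)
  have powr1: "rho x powr (a + 1) \<le> rho x powr a" if "x \<in> unit_disk" for x using that by (intro rho_powr_mono) auto
  have tm: "f \<in> borel_measurable disk_measure" if "test_function f" for f
    by (rule continuous_disk_measurable) (rule test_function_continuous[OF that])
  have L1: "(\<lambda>n. LINT x|disk_measure. w x * \<phi> n x) \<longlonglongrightarrow> (LINT x|disk_measure. w x * (q x * of_real (rho x powr (a + 1))))"
  proof (rule weighted_dominated_convergence[OF L2w_measurable[OF w] L2w_weighted_integrable[OF a w]])
    fix x assume x: "x \<in> unit_disk"
    then have r: "0 < rho x" by (simp add: rho_pos_iff)
    show "(\<lambda>n. \<phi> n x) \<longlonglongrightarrow> q x * of_real (rho x powr (a + 1))"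
      unfolding \<phi>_def by (intro tendsto_intros cutoff_lim_0 r)
    show "norm (\<phi> n x) \<le> B * rho x powr a" for n
    proof -
      have "cutoff (eps n) (a + 1) 0 (rho x) \<le> rho x powr a"
        using cutoff_le_powr[OF eps_pos, of n "a + 1" "rho x"] powr1[OF x] by linarith
      then show ?thesis using B(2)[OF le1[OF x]] B(1) cutoff_nonneg
        by (simp add: \<phi>_def norm_mult mult_mono)
    qed
  qed (rule tm[OF t])
  have L2: "(\<lambda>n. LINT x|disk_measure. u x * partial j (\<phi> n) x) \<longlonglongrightarrow> (LINT x|disk_measure. u x *
     (partial j q x * of_real (rho x powr (a + 1)) - 2 * of_real (x $ j) * q x * of_real ((a + 1) * rho x powr a + 0)))"
  proof (rule weighted_dominated_convergence[OF L2w_measurable[OF u] L2w_weighted_integrable[OF a u]])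
    fix x assume x: "x \<in> unit_disk"
    then have r: "0 < rho x" by (simp add: rho_pos_iff)
    show "(\<lambda>n. partial j (\<phi> n) x) \<longlonglongrightarrow> partial j q x * of_real (rho x powr (a + 1)) - 2 * of_real (x $ j) * q x * of_real ((a + 1) * rho x powr a + 0)"
      unfolding p\<phi> by (intro tendsto_intros cutoff_lim_0 cutoff_lim_2 r)
    \<comment> \<open>\<open>B'\<close> bounds the derivative falling on \<open>q\<close>. In
      \<open>a + 3\<close> the part \<open>a + 1\<close> comes from differentiating the power and
      the 2 from \<open>cutoff_2_le_powr\<close>.\<close>
    show "norm (partial j (\<phi> n) x) \<le> (B' + 2 * B * (a + 3)) * rho x powr a" for n
    proof -
      let ?D = "(a + 1) * cutoff (eps n) a 0 (rho x) + eps n * cutoff (eps n) (a + 1) 2 (rho x)"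
      have xj: "\<bar>x $ j\<bar> \<le> 1" using component_le_norm_cart[of x j] le1[OF x] by linarith
      have c1: "cutoff (eps n) (a + 1) 0 (rho x) \<le> rho x powr a"
        using cutoff_le_powr[OF eps_pos, of n "a + 1" "rho x"] powr1[OF x] by linarith
      have "(a + 1) * cutoff (eps n) a 0 (rho x) \<le> (a + 1) * rho x powr a"
        using cutoff_le_powr[OF eps_pos, of n a "rho x"] a by (intro mult_left_mono) auto
      then have c2: "?D \<le> (a + 3) * rho x powr a"
        using cutoff_2_le_powr[OF eps_pos, of n "a + 1" "rho x"] by (simp add: algebra_simps)
      have "0 \<le> a + 1" "0 \<le> eps n" using a less_imp_le[OF eps_pos[of n]] by simp_all
      then have c2': "0 \<le> ?D" by (rule add_nonneg_nonneg[OF mult_nonneg_nonneg[OF _ cutoff_nonneg] mult_nonneg_nonneg[OF _ cutoff_nonneg]])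
      have "norm (partial j (\<phi> n) x) \<le> norm (partial j q x) * cutoff (eps n) (a + 1) 0 (rho x) + 2 * \<bar>x $ j\<bar> * norm (q x) * ?D"
        unfolding p\<phi> by (rule order_trans[OF norm_triangle_ineq4])
          (use c2' cutoff_nonneg[of "eps n" "a + 1" 0 "rho x"] in \<open>simp add: norm_mult del: of_real_add of_real_mult\<close>)
      also have "\<dots> \<le> B' * rho x powr a + 2 * 1 * B * ((a + 3) * rho x powr a)"
        using c1 c2 c2' xj B(1) B'(1) B(2)[OF le1[OF x]] B'(2)[OF le1[OF x]] cutoff_nonneg
        by (intro add_mono mult_mono mult_nonneg_nonneg) auto
      finally show ?thesis by (simp add: algebra_simps)
    qed
  qed (rule tm[OF test_function_partial[OF t]])
  have wn: "(LINT x|disk_measure. w x * \<phi> n x) = - (LINT x|disk_measure. u x * partial j (\<phi> n) x)" for n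
    using d t[of n] by (simp add: weak_partial_def)
  have eq: "(LINT x|disk_measure. w x * (q x * of_real (rho x powr (a + 1)))) = - (LINT x|disk_measure. u x *
     (partial j q x * of_real (rho x powr (a + 1)) - 2 * of_real (x $ j) * q x * of_real ((a + 1) * rho x powr a + 0)))"
    by (rule LIMSEQ_unique[OF L1]) (unfold wn, rule tendsto_minus[OF L2])
  have "pairing (a + 1) w q = (LINT x|disk_measure. w x * (q x * of_real (rho x powr (a + 1))))"
    by (simp add: pairing_def mult.assoc)
  also have "\<dots> = (LINT x|disk_measure. u x * (2 * of_real (x $ j) * q x * of_real ((a + 1) * rho x powr a) - partial j q x * of_real (rho x powr (a + 1))))"
    unfolding eq by (simp flip: integral_minus add: algebra_simps)
  also have "\<dots> = pairing a u (\<lambda>x. of_real (2 * (a + 1)) * (of_real (x $ j) * q x) - of_real (rho x) * partial j q x)"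
    unfolding pairing_def
  proof (rule Bochner_Integration.integral_cong[OF refl])
    fix x assume "x \<in> space disk_measure"
    then have "rho x powr (a + 1) = rho x powr a * rho x" using rho_pos_iff[of x] by (simp add: powr_add)
    then show "u x * (2 * of_real (x $ j) * q x * of_real ((a + 1) * rho x powr a) - partial j q x * of_real (rho x powr (a + 1)))
      = u x * (of_real (2 * (a + 1)) * (of_real (x $ j) * q x) - of_real (rho x) * partial j q x) * of_real (rho x powr a)"
      by (simp add: algebra_simps)
  qed
  finally show ?thesis .
qed

text \<open>The rotation field is tangent to the circles on which \<open>rho\<close> is constant, so
  the derivative never hits the weight: the exponent stays \<open>a\<close> and the degree of
  \<open>q\<close> does not rise.\<close>

lemma weak_parts_angular:
  assumes a: "-1 < a" and u: "u \<in> L2w a" and w1: "w1 \<in> L2w a" and w2: "w2 \<in> L2w a"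
    and d1: "weak_partial 1 u w1" and d2: "weak_partial 2 u w2" and q: "q \<in> polys N"
  shows "pairing a (\<lambda>x. of_real (x $ 1) * w2 x - of_real (x $ 2) * w1 x) q
    = - pairing a u (\<lambda>x. of_real (x $ 1) * partial 2 q x - of_real (x $ 2) * partial 1 q x)"
proof -
  define v where "v x = of_real (x $ 1) * w2 x - of_real (x $ 2) * w1 x" for x
  have v: "v \<in> L2w a" unfolding v_def by (intro L2w_diff L2w_coord_mult w1 w2)
  define q' where "q' x = of_real (x $ 1) * partial 2 q x - of_real (x $ 2) * partial 1 q x" for x
  have q': "q' \<in> polys (Suc N)" unfolding q'_def
    by (intro polys_diff polys_mult_coord partial_polys'[OF q])
  define \<phi> where "\<phi> j n = (\<lambda>x. (of_real (x $ j) * q x) * complex_of_real (cutoff (eps n) a 0 (rho x)))" for j :: 2 and n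
  have t: "test_function (\<phi> j n)" for j n unfolding \<phi>_def by (rule test_function_cutoff[OF eps_pos polys_mult_coord[OF q]])
  have p\<phi>: "partial i (\<phi> j n) x = (of_real (x $ j) * partial i q x + (if i = j then q x else 0)) * of_real (cutoff (eps n) a 0 (rho x)) 
     - 2 * of_real (x $ i) * (of_real (x $ j) * q x) *
     of_real (a * cutoff (eps n) (a - 1) 0 (rho x) + eps n * cutoff (eps n) a 2 (rho x))" for i j n x
    unfolding \<phi>_def by (simp add: partial_poly_cutoff_0[OF polys_mult_coord[OF q] eps_pos] partial_coord_mult[OF q])
  \<comment> \<open>The terms from differentiating the cutoff carry the symmetric factor
    \<open>x1 * x2\<close> and cancel.\<close>
  have diff: "partial 2 (\<phi> 1 n) x - partial 1 (\<phi> 2 n) x = q' x * of_real (cutoff (eps n) a 0 (rho x))" for n x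
    unfolding p\<phi> q'_def by (simp add: algebra_simps)
  have li: "locally_integrable u" "locally_integrable w1" "locally_integrable w2"
    using L2w_locally_integrable[OF a] u w1 w2 by auto
  have key: "(LINT x|disk_measure. v x * (q x * of_real (cutoff (eps n) a 0 (rho x))))
      = - (LINT x|disk_measure. u x * (q' x * of_real (cutoff (eps n) a 0 (rho x))))" for n
  proof -
    have "(LINT x|disk_measure. v x * (q x * of_real (cutoff (eps n) a 0 (rho x))))
      = (LINT x|disk_measure. w2 x * \<phi> 1 n x - w1 x * \<phi> 2 n x)"
      by (simp add: v_def \<phi>_def algebra_simps)
    also have "\<dots> = (LINT x|disk_measure. w2 x * \<phi> 1 n x) - (LINT x|disk_measure. w1 x * \<phi> 2 n x)"
      by (intro Bochner_Integration.integral_diff locally_integrable_test li t)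
    also have "\<dots> = - ((LINT x|disk_measure. u x * partial 2 (\<phi> 1 n) x) - (LINT x|disk_measure. u x * partial 1 (\<phi> 2 n) x))"
      using d1 d2 t by (simp add: weak_partial_def)
    also have "(LINT x|disk_measure. u x * partial 2 (\<phi> 1 n) x) - (LINT x|disk_measure. u x * partial 1 (\<phi> 2 n) x)
      = (LINT x|disk_measure. u x * partial 2 (\<phi> 1 n) x - u x * partial 1 (\<phi> 2 n) x)"
      by (intro Bochner_Integration.integral_diff[symmetric] locally_integrable_test li test_function_partial t)
    finally show ?thesis by (simp add: diff flip: right_diff_distrib)
  qed
  have lim: "(\<lambda>n. LINT x|disk_measure. f x * (p x * of_real (cutoff (eps n) a 0 (rho x)))) \<longlonglongrightarrow> pairing a f p"
    if f: "f \<in> L2w a" and p: "p \<in> polys M" for f p M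
  proof -
    obtain B where B: "B > 0" "\<And>x. norm x \<le> 1 \<Longrightarrow> norm (p x) \<le> B"
      using bounded_on_disk[OF polys_continuous[OF p]] by blast
    have "(\<lambda>n. LINT x|disk_measure. f x * (p x * of_real (cutoff (eps n) a 0 (rho x)))) \<longlonglongrightarrow>
      (LINT x|disk_measure. f x * (p x * of_real (rho x powr a)))"
    proof (rule weighted_dominated_convergence[OF L2w_measurable[OF f] L2w_weighted_integrable[OF a f]])
      show "(\<lambda>x. p x * of_real (cutoff (eps n) a 0 (rho x))) \<in> borel_measurable disk_measure" for n
        by (rule continuous_disk_measurable) (rule test_function_continuous[OF test_function_cutoff[OF eps_pos p]])
      fix x assume x: "x \<in> unit_disk"
      then have r: "0 < rho x" by (simp add: rho_pos_iff)
      show "(\<lambda>n. p x * of_real (cutoff (eps n) a 0 (rho x))) \<longlonglongrightarrow> p x * of_real (rho x powr a)"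
        by (intro tendsto_intros cutoff_lim_0 r)
      show "norm (p x * of_real (cutoff (eps n) a 0 (rho x))) \<le> B * rho x powr a" for n
        using cutoff_le_powr[OF eps_pos, of n a "rho x"] B(1) B(2)[of x] x cutoff_nonneg
        by (simp add: norm_mult mult_mono unit_disk_def)
    qed
    then show ?thesis by (simp add: pairing_def mult.assoc)
  qed
  have "pairing a v q = - pairing a u q'"
    using LIMSEQ_unique[OF lim[OF v q]] tendsto_minus[OF lim[OF u q']] by (simp add: key)
  then show ?thesis unfolding v_def q'_def .
qed

section \<open>Polynomials that vanish almost everywhere on the disk\<close>

lemma continuous_AE_0_imp_0:
  fixes f :: "real ^ 2 \<Rightarrow> complex"
  assumes c: "continuous_on UNIV f" and 0: "AE x in disk_measure. f x = 0" and x: "x \<in> unit_disk"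
  shows "f x = 0"
proof -
  define U where "U = unit_disk \<inter> {x. f x \<noteq> 0}"
  have U: "open U" unfolding U_def
    by (intro open_Int open_unit_disk open_Collect_neq c continuous_on_const)
  have "AE x in lebesgue. x \<notin> U" using 0 by (simp add: AE_restrict_space_iff U_def)
  moreover have "U \<in> sets lebesgue" using U by simp
  ultimately have "U \<in> null_sets lebesgue" by (simp add: AE_iff_null_sets[symmetric])
  then have "negligible U" by (simp add: negligible_iff_null_sets)
  then have "U = {}" using U open_not_negligible by blast
  then show "f x = 0" using x by (auto simp: U_def)
qed

text \<open>\<open>Proj\<close> picks a function on the whole plane, so its uniqueness requires that
  a polynomial is determined by its values on the disk. Along the line through \<open>x\<close> it
  is a polynomial in one variable \<open>t\<close>, and all small \<open>t > 0\<close> are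
  roots.\<close>

lemma polys_zero_if_zero_on_disk:
  assumes p: "p \<in> polys N" and 0: "\<And>x. x \<in> unit_disk \<Longrightarrow> p x = 0"
  shows "p = (\<lambda>x. 0)"
proof
  fix x
  obtain c where c: "p = (\<lambda>x. \<Sum>k\<le>N. \<Sum>\<beta>\<in>multi_indices k. c \<beta> * mon (fst \<beta>) (snd \<beta>) x)"
    using p by (auto simp: polys_iff)
  define h where "h k = (\<Sum>\<beta>\<in>multi_indices k. c \<beta> * mon (fst \<beta>) (snd \<beta>) x)" for k
  have scale: "p (t *\<^sub>R x) = (\<Sum>k\<le>N. h k * of_real t ^ k)" for t
  proof -
    have "mon (fst \<beta>) (snd \<beta>) (t *\<^sub>R x) = of_real t ^ k * mon (fst \<beta>) (snd \<beta>) x" if "\<beta> \<in> multi_indices k" for \<beta> k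
      using that by (auto simp: mon_def multi_indices_def power_mult_distrib power_add)
    then have "(\<Sum>\<beta>\<in>multi_indices k. c \<beta> * mon (fst \<beta>) (snd \<beta>) (t *\<^sub>R x)) = h k * of_real t ^ k" for k
      unfolding h_def sum_distrib_right by (intro sum.cong) auto
    then show ?thesis by (simp add: c)
  qed
  \<comment> \<open>For such \<open>t\<close> the point \<open>t * x\<close> has norm at most
    \<open>norm x / (1 + norm x)\<close>, hence lies in the disk.\<close>
  let ?T = "{0<..<inverse (1 + norm x)}"
  have pos: "0 < inverse (1 + norm x)" by (simp add: add_pos_nonneg)
  have root: "(\<Sum>k\<le>N. h k * of_real t ^ k) = 0" if "t \<in> ?T" for t
  proof -
    have "norm (t *\<^sub>R x) \<le> inverse (1 + norm x) * norm x" using that by (simp add: mult_right_mono)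
    also have "\<dots> < 1" by (simp add: divide_simps add_pos_nonneg)
    finally show ?thesis using 0[of "t *\<^sub>R x"] scale[of t] by (simp add: unit_disk_def)
  qed
  have hz: "h k = 0" if "k \<le> N" for k
  proof (rule ccontr)
    assume "h k \<noteq> 0"
    then have "finite {z. (\<Sum>k\<le>N. h k * z ^ k) = 0}" using that by (intro polyfun_roots_finite)
    moreover have "complex_of_real ` ?T \<subseteq> {z. (\<Sum>k\<le>N. h k * z ^ k) = 0}" using root by auto
    ultimately have "finite (complex_of_real ` ?T)" by (rule finite_subset[rotated])
    then have "finite ?T" by (rule finite_imageD) (auto simp: inj_on_def)
    then show False using pos infinite_Ioo by blast
  qed
  show "p x = 0" using scale[of 1] hz by simp
qed

lemma L2w_norm_eq_0_AE:
  assumes u: "u \<in> L2w a" and 0: "L2w_norm a u = 0"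
  shows "AE x in disk_measure. u x = 0"
proof -
  have "(LINT x|disk_measure. (norm (u x))\<^sup>2 * rho x powr a) = 0" using L2w_norm_sq[of a u] 0 by simp
  then have "AE x in disk_measure. (norm (u x))\<^sup>2 * rho x powr a = 0"
    using L2w_integrable[OF u] by (subst (asm) integral_nonneg_eq_0_iff_AE) auto
  moreover have "AE x in disk_measure. x \<in> unit_disk" by (rule AE_disk_measureI)
  ultimately show ?thesis
  proof eventually_elim
    case (elim x)
    then have "0 < rho x" by (simp add: rho_pos_iff)
    then show ?case using elim(1) by simp
  qed
qed

lemma polys_norm_eq_0:
  assumes a: "-1 < a" and p: "p \<in> polys N" and 0: "L2w_norm a p = 0"
  shows "p = (\<lambda>x. 0)"
  by (rule polys_zero_if_zero_on_disk[OF p])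
    (rule continuous_AE_0_imp_0[OF polys_continuous[OF p] L2w_norm_eq_0_AE[OF polys_L2w[OF a p] 0]])

section \<open>The orthogonal projection\<close>

lemma L2w_inner_bound: "u \<in> L2w a \<Longrightarrow> v \<in> L2w a \<Longrightarrow> norm (L2w_inner a u v) \<le> L2w_norm a u * L2w_norm a v"
  using pairing_bound[OF _ L2w_cnj] by (simp add: pairing_inner L2w_norm_cnj)

lemma L2w_inner_diff_left:
  "u \<in> L2w a \<Longrightarrow> v \<in> L2w a \<Longrightarrow> w \<in> L2w a \<Longrightarrow> L2w_inner a (\<lambda>x. u x - v x) w = L2w_inner a u w - L2w_inner a v w"
  by (simp add: pairing_inner pairing_diff_left L2w_cnj)

lemma L2w_inner_cmult_left: "L2w_inner a (\<lambda>x. c * u x) w = c * L2w_inner a u w"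
  by (simp add: pairing_inner pairing_cmult_left)

lemma L2w_inner_add_right:
  "u \<in> L2w a \<Longrightarrow> v \<in> L2w a \<Longrightarrow> w \<in> L2w a \<Longrightarrow> L2w_inner a w (\<lambda>x. u x + v x) = L2w_inner a w u + L2w_inner a w v"
  by (simp add: pairing_inner pairing_add_right L2w_cnj)

lemma L2w_inner_cmult_right: "L2w_inner a w (\<lambda>x. c * u x) = cnj c * L2w_inner a w u"
  by (simp add: pairing_inner pairing_cmult_right)

lemma L2w_inner_self: "L2w_inner a u u = of_real ((L2w_norm a u)\<^sup>2)"
  by (simp add: pairing_inner pairing_cnj_self)

text \<open>One Gram-Schmidt step: the new direction is \<open>f\<close> minus its projection
  \<open>g\<close>. The coefficients stay explicit, so that the statement does not depend on how the
  enlarged space is described.\<close>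

lemma projection_extend:
  assumes V: "\<And>p. p \<in> V \<Longrightarrow> p \<in> L2w a" "\<And>p q. p \<in> V \<Longrightarrow> q \<in> V \<Longrightarrow> (\<lambda>x. p x + q x) \<in> V"
      "\<And>p c. p \<in> V \<Longrightarrow> (\<lambda>x. c * p x) \<in> V"
    and proj: "\<And>u. u \<in> L2w a \<Longrightarrow> \<exists>p\<in>V. \<forall>q\<in>V. L2w_inner a (\<lambda>x. u x - p x) q = 0"
    and f: "f \<in> L2w a" and u: "u \<in> L2w a"
  shows "\<exists>p\<in>V. \<exists>c. \<forall>q\<in>V. \<forall>d. L2w_inner a (\<lambda>x. u x - (p x + c * f x)) (\<lambda>x. q x + d * f x) = 0"
proof -
  obtain g where g: "g \<in> V" "\<And>q. q \<in> V \<Longrightarrow> L2w_inner a (\<lambda>x. f x - g x) q = 0" using proj[OF f] by blast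
  obtain p where p: "p \<in> V" "\<And>q. q \<in> V \<Longrightarrow> L2w_inner a (\<lambda>x. u x - p x) q = 0" using proj[OF u] by blast
  define f' where "f' x = f x - g x" for x
  define e where "e x = u x - p x" for x
  have L: "f' \<in> L2w a" "e \<in> L2w a" unfolding f'_def e_def using f u V(1) g(1) p(1) by (auto intro: L2w_diff)
  \<comment> \<open>If \<open>f'\<close> has norm 0, the quotient is 0 by the convention for
    division, and the inner product with \<open>f'\<close> vanishes for any \<open>c\<close> by
    Cauchy-Schwarz.\<close>
  define c where "c = L2w_inner a e f' / L2w_inner a f' f'"
  have c: "L2w_inner a (\<lambda>x. e x - c * f' x) f' = 0"
  proof (cases "L2w_norm a f' = 0")
    case True
    then show ?thesis
      using L2w_inner_bound[OF L2w_diff[OF L(2) L2w_cmult(1)[OF L(1), of c]] L(1)] by simp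
  next
    case False
    have "L2w_inner a (\<lambda>x. e x - c * f' x) f' = L2w_inner a e f' - c * L2w_inner a f' f'"
      by (simp add: L2w_inner_diff_left L2w_inner_cmult_left L L2w_cmult)
    then show ?thesis using False by (simp add: c_def L2w_inner_self)
  qed
  have orth: "L2w_inner a (\<lambda>x. e x - c * f' x) q = 0" if "q \<in> V" for q
  proof -
    have "L2w_inner a e q = 0" "L2w_inner a f' q = 0"
      unfolding e_def f'_def by (rule p(2)[OF that], rule g(2)[OF that])
    then show ?thesis
      by (simp add: L2w_inner_diff_left L2w_inner_cmult_left L L2w_cmult V(1)[OF that])
  qed
  show ?thesis
  proof (rule bexI, rule exI, intro ballI allI)
    \<comment> \<open>The projection is \<open>p + c * f'\<close>; writing \<open>f'\<close> as
      \<open>f - g\<close> moves \<open>- c * g\<close> into the component from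
      \<open>V\<close>.\<close>
    show pV: "(\<lambda>x. p x + (- c) * g x) \<in> V" by (rule V(2)[OF p(1) V(3)[OF g(1)]])
    fix q d assume q: "q \<in> V"
    have E: "(\<lambda>x. e x - c * f' x) \<in> L2w a" using L by (intro L2w_diff L2w_cmult)
    have qd: "(\<lambda>x. q x + d * g x) \<in> V" by (rule V(2)[OF q V(3)[OF g(1)]])
    have "(\<lambda>x. u x - (p x + (- c) * g x + c * f x)) = (\<lambda>x. e x - c * f' x)"
      by (simp add: e_def f'_def algebra_simps)
    moreover have "(\<lambda>x. q x + d * f x) = (\<lambda>x. (q x + d * g x) + d * f' x)"
      by (simp add: f'_def algebra_simps)
    moreover have "L2w_inner a (\<lambda>x. e x - c * f' x) (\<lambda>x. (q x + d * g x) + d * f' x) = 0"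
      by (subst L2w_inner_add_right[OF V(1)[OF qd] L2w_cmult(1)[OF L(1)] E])
        (simp only: orth[OF qd] L2w_inner_cmult_right c, simp)
    ultimately show "L2w_inner a (\<lambda>x. u x - (p x + (- c) * g x + c * f x)) (\<lambda>x. q x + d * f x) = 0"
      by (simp only:)
  qed
qed

text \<open>The span over an arbitrary set of exponents, so that the projection can be built by
  adding one monomial at a time.\<close>

definition mon_span :: "(nat \<times> nat) set \<Rightarrow> (real ^ 2 \<Rightarrow> complex) set" where
  "mon_span I = {p. \<exists>c. p = (\<lambda>x. \<Sum>\<beta>\<in>I. c \<beta> * mon (fst \<beta>) (snd \<beta>) x)}"

lemma mon_span_insert:
  assumes "finite I" "\<beta> \<notin> I"
  shows "p \<in> mon_span (insert \<beta> I) \<longleftrightarrow> (\<exists>q\<in>mon_span I. \<exists>c. p = (\<lambda>x. q x + c * mon (fst \<beta>) (snd \<beta>) x))"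
proof
  assume "p \<in> mon_span (insert \<beta> I)"
  then obtain c where "p = (\<lambda>x. \<Sum>\<beta>\<in>insert \<beta> I. c \<beta> * mon (fst \<beta>) (snd \<beta>) x)" by (auto simp: mon_span_def)
  then have "p = (\<lambda>x. (\<Sum>\<beta>\<in>I. c \<beta> * mon (fst \<beta>) (snd \<beta>) x) + c \<beta> * mon (fst \<beta>) (snd \<beta>) x)"
    using assms by (simp add: add.commute)
  then show "\<exists>q\<in>mon_span I. \<exists>c. p = (\<lambda>x. q x + c * mon (fst \<beta>) (snd \<beta>) x)"
    unfolding mon_span_def by (intro bexI[of _ "\<lambda>x. \<Sum>\<beta>\<in>I. c \<beta> * mon (fst \<beta>) (snd \<beta>) x"] exI[of _ "c \<beta>"]) auto
next
  assume "\<exists>q\<in>mon_span I. \<exists>c. p = (\<lambda>x. q x + c * mon (fst \<beta>) (snd \<beta>) x)"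
  then obtain d c where p: "p = (\<lambda>x. (\<Sum>\<beta>\<in>I. d \<beta> * mon (fst \<beta>) (snd \<beta>) x) + c * mon (fst \<beta>) (snd \<beta>) x)"
    by (auto simp: mon_span_def)
  have "(\<Sum>\<gamma>\<in>insert \<beta> I. (d(\<beta> := c)) \<gamma> * mon (fst \<gamma>) (snd \<gamma>) x) = p x" for x
  proof -
    have "(\<Sum>\<gamma>\<in>I. (d(\<beta> := c)) \<gamma> * mon (fst \<gamma>) (snd \<gamma>) x) = (\<Sum>\<gamma>\<in>I. d \<gamma> * mon (fst \<gamma>) (snd \<gamma>) x)"
      using assms(2) by (intro sum.cong) auto
    then show ?thesis using assms by (simp add: p add.commute)
  qed
  then show "p \<in> mon_span (insert \<beta> I)"
    unfolding mon_span_def by (intro CollectI exI[of _ "d(\<beta> := c)"]) simp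
qed

lemma mon_span_projection:
  assumes "finite I" and a: "-1 < a" and u: "u \<in> L2w a"
  shows "\<exists>p\<in>mon_span I. \<forall>q\<in>mon_span I. L2w_inner a (\<lambda>x. u x - p x) q = 0"
  using assms(1) u
proof (induction I arbitrary: u rule: finite_induct)
  case empty
  show ?case by (simp add: mon_span_def L2w_inner_def)
next
  case (insert \<beta> I)
  have L: "p \<in> L2w a" if pI: "p \<in> mon_span I" for p
  proof -
    obtain c where c: "p = (\<lambda>x. \<Sum>\<beta>\<in>I. c \<beta> * mon (fst \<beta>) (snd \<beta>) x)" using pI by (auto simp: mon_span_def)
    have "mon (fst \<beta>) (snd \<beta>) \<in> polys (\<Sum>\<beta>\<in>I. fst \<beta> + snd \<beta>)" if "\<beta> \<in> I" for \<beta>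
      by (rule mon_in_polys) (use member_le_sum[OF that, of "\<lambda>\<beta>. fst \<beta> + snd \<beta>"] insert.hyps(1) in auto)
    then have "p \<in> polys (\<Sum>\<beta>\<in>I. fst \<beta> + snd \<beta>)"
      unfolding c by (intro polys_sum insert.hyps(1) polys_scale)
    then show ?thesis by (rule polys_L2w[OF a])
  qed
  have "\<exists>p\<in>mon_span I. \<exists>c. \<forall>q\<in>mon_span I. \<forall>d. L2w_inner a (\<lambda>x. u x - (p x + c * mon (fst \<beta>) (snd \<beta>) x))
     (\<lambda>x. q x + d * mon (fst \<beta>) (snd \<beta>) x) = 0"
  proof (rule projection_extend[OF L _ _ insert.IH])
    show "(\<lambda>x. p x + q x) \<in> mon_span I" if pq: "p \<in> mon_span I" "q \<in> mon_span I" for p q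
    proof -
      obtain c d where "p = (\<lambda>x. \<Sum>\<beta>\<in>I. c \<beta> * mon (fst \<beta>) (snd \<beta>) x)" "q = (\<lambda>x. \<Sum>\<beta>\<in>I. d \<beta> * mon (fst \<beta>) (snd \<beta>) x)"
        using pq by (auto simp: mon_span_def)
      then show ?thesis unfolding mon_span_def
        by (intro CollectI exI[of _ "\<lambda>\<beta>. c \<beta> + d \<beta>"]) (simp add: distrib_right sum.distrib)
    qed
    show "(\<lambda>x. k * p x) \<in> mon_span I" if pI: "p \<in> mon_span I" for p k
    proof -
      obtain c where "p = (\<lambda>x. \<Sum>\<beta>\<in>I. c \<beta> * mon (fst \<beta>) (snd \<beta>) x)" using pI by (auto simp: mon_span_def)
      then show ?thesis unfolding mon_span_def
        by (intro CollectI exI[of _ "\<lambda>\<beta>. k * c \<beta>"]) (simp add: sum_distrib_left mult.assoc)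
    qed
    show "mon (fst \<beta>) (snd \<beta>) \<in> L2w a" by (rule polys_L2w[OF a mon_in_polys[OF order_refl]])
  qed (use insert.prems in auto)
  then obtain p c where p: "p \<in> mon_span I" and
    pc: "\<And>q d. q \<in> mon_span I \<Longrightarrow> L2w_inner a (\<lambda>x. u x - (p x + c * mon (fst \<beta>) (snd \<beta>) x))
     (\<lambda>x. q x + d * mon (fst \<beta>) (snd \<beta>) x) = 0" by blast
  show ?case
  proof (rule bexI[of _ "\<lambda>x. p x + c * mon (fst \<beta>) (snd \<beta>) x"], rule ballI)
    fix q assume "q \<in> mon_span (insert \<beta> I)"
    then obtain q' d where "q' \<in> mon_span I" "q = (\<lambda>x. q' x + d * mon (fst \<beta>) (snd \<beta>) x)"
      unfolding mon_span_insert[OF insert.hyps(1,2)] by blast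
    then show "L2w_inner a (\<lambda>x. u x - (p x + c * mon (fst \<beta>) (snd \<beta>) x)) q = 0"
      using pc by simp
  next
    show "(\<lambda>x. p x + c * mon (fst \<beta>) (snd \<beta>) x) \<in> mon_span (insert \<beta> I)"
      unfolding mon_span_insert[OF insert.hyps(1,2)] using p by blast
  qed
qed

lemma polys_eq_mon_span: "polys N = mon_span (\<Union>k\<le>N. multi_indices k)"
proof -
  have "(\<Sum>\<beta>\<in>(\<Union>k\<le>N. multi_indices k). g \<beta>) = (\<Sum>k\<le>N. \<Sum>\<beta>\<in>multi_indices k. g \<beta>)" for g :: "nat \<times> nat \<Rightarrow> complex"
    by (rule sum.UNION_disjoint) (auto simp: multi_indices_def[abs_def] finite_multi_indices[unfolded multi_indices_def])
  then show ?thesis by (auto simp: mon_span_def polys_iff)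
qed

definition orth :: "real \<Rightarrow> nat \<Rightarrow> (real ^ 2 \<Rightarrow> complex) \<Rightarrow> bool" where
  "orth a N v \<longleftrightarrow> (\<forall>q\<in>polys N. pairing a v q = 0)"

lemma orth_inner: "orth a N v \<longleftrightarrow> (\<forall>q\<in>polys N. L2w_inner a v q = 0)"
  unfolding orth_def pairing_inner using polys_cnj by (metis (no_types, lifting) complex_cnj_cnj ext)

lemma orthD: "orth a N v \<Longrightarrow> q \<in> polys N \<Longrightarrow> pairing a v q = 0"
  by (simp add: orth_def)

lemma orth_mono: "orth a N v \<Longrightarrow> M \<le> N \<Longrightarrow> orth a M v"
  using polys_mono by (auto simp: orth_def)

lemma orth_cnj:
  assumes "orth a N v" shows "orth a N (\<lambda>x. cnj (v x))"
  unfolding orth_def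
proof
  fix q assume "q \<in> polys N"
  then have "pairing a v (\<lambda>x. cnj (q x)) = 0" using assms by (simp add: orthD polys_cnj)
  then show "pairing a (\<lambda>x. cnj (v x)) q = 0"
    using pairing_cnj_cnj[of a v "\<lambda>x. cnj (q x)"] by simp
qed

lemma orth_diff: "-1 < a \<Longrightarrow> u \<in> L2w a \<Longrightarrow> v \<in> L2w a \<Longrightarrow> orth a N u \<Longrightarrow> orth a N v \<Longrightarrow> orth a N (\<lambda>x. u x - v x)"
  by (auto simp: orth_def pairing_diff_left polys_L2w)

lemma pythagoras:
  assumes a: "-1 < a" and v: "v \<in> L2w a" "orth a N v" and p: "p \<in> polys N"
  shows "(L2w_norm a (\<lambda>x. v x + p x))\<^sup>2 = (L2w_norm a v)\<^sup>2 + (L2w_norm a p)\<^sup>2"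
proof -
  note L = v(1) polys_L2w[OF a p]
  have "pairing a v (\<lambda>x. cnj (p x)) = 0" by (rule orthD[OF v(2) polys_cnj[OF p]])
  moreover have "pairing a p (\<lambda>x. cnj (v x)) = 0"
    using orthD[OF orth_cnj[OF v(2)] p] by (simp add: pairing_commute)
  moreover have "pairing a (\<lambda>x. v x + p x) (\<lambda>x. cnj (v x) + cnj (p x))
      = pairing a v (\<lambda>x. cnj (v x)) + pairing a v (\<lambda>x. cnj (p x)) + (pairing a p (\<lambda>x. cnj (v x)) + pairing a p (\<lambda>x. cnj (p x)))"
    using L by (simp add: pairing_add_left pairing_add_right L2w_cnj L2w_add)
  ultimately have "complex_of_real ((L2w_norm a (\<lambda>x. v x + p x))\<^sup>2) = of_real ((L2w_norm a v)\<^sup>2 + (L2w_norm a p)\<^sup>2)"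
    using pairing_cnj_self[of a "\<lambda>x. v x + p x"] by (simp add: pairing_cnj_self)
  then show ?thesis by (simp only: of_real_eq_iff)
qed

lemma orth_polys_eq_0:
  assumes "-1 < a" "p \<in> polys N" "orth a N p"
  shows "p = (\<lambda>x. 0)"
proof (rule polys_norm_eq_0[OF assms(1,2)])
  have "complex_of_real ((L2w_norm a p)\<^sup>2) = 0"
    using orthD[OF assms(3) polys_cnj[OF assms(2)]] by (simp only: pairing_cnj_self)
  then show "L2w_norm a p = 0" by simp
qed

text \<open>Discharges the \<open>THE\<close> in \<open>Proj\<close>: from here on, projections are
  identified by exhibiting a polynomial and checking orthogonality.\<close>

lemma Proj_unique:
  assumes a: "-1 < a" and u: "u \<in> L2w a" and p: "p \<in> polys N" "orth a N (\<lambda>x. u x - p x)"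
  shows "Proj a N u = p"
  unfolding Proj_def
proof (rule the_equality)
  show "p \<in> polys N \<and> (\<forall>q\<in>polys N. L2w_inner a (\<lambda>x. u x - p x) q = 0)" using p by (simp add: orth_inner)
  fix p' assume "p' \<in> polys N \<and> (\<forall>q\<in>polys N. L2w_inner a (\<lambda>x. u x - p' x) q = 0)"
  then have p': "p' \<in> polys N" "orth a N (\<lambda>x. u x - p' x)" by (auto simp: orth_inner)
  have "orth a N (\<lambda>x. (u x - p x) - (u x - p' x))"
    by (intro orth_diff a L2w_diff u polys_L2w[OF a p(1)] polys_L2w[OF a p'(1)] p(2) p'(2))
  then have "orth a N (\<lambda>x. p' x - p x)" by simp
  from orth_polys_eq_0[OF a polys_diff[OF p'(1) p(1)] this] show "p' = p" by (simp add: fun_eq_iff)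
qed

lemma
  assumes a: "-1 < a" and u: "u \<in> L2w a"
  shows Proj_polys: "Proj a N u \<in> polys N" and Proj_orth: "orth a N (\<lambda>x. u x - Proj a N u x)"
proof -
  have "\<exists>p\<in>polys N. \<forall>q\<in>polys N. L2w_inner a (\<lambda>x. u x - p x) q = 0"
    unfolding polys_eq_mon_span by (rule mon_span_projection[OF _ a u]) simp
  then obtain p where "p \<in> polys N" "orth a N (\<lambda>x. u x - p x)" by (auto simp: orth_inner)
  moreover from Proj_unique[OF a u this] have "Proj a N u = p" .
  ultimately show "Proj a N u \<in> polys N" "orth a N (\<lambda>x. u x - Proj a N u x)" by simp_all
qed

lemma Proj_L2w: "-1 < a \<Longrightarrow> u \<in> L2w a \<Longrightarrow> Proj a N u \<in> L2w a"
  by (rule polys_L2w[OF _ Proj_polys])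

lemma Proj_diff_L2w: "-1 < a \<Longrightarrow> u \<in> L2w a \<Longrightarrow> (\<lambda>x. u x - Proj a N u x) \<in> L2w a"
  by (intro L2w_diff Proj_L2w)

lemma Proj_norm_split:
  assumes a: "-1 < a" and u: "u \<in> L2w a" and p: "p \<in> polys N"
  shows "(L2w_norm a (\<lambda>x. u x - p x))\<^sup>2 = (L2w_norm a (\<lambda>x. u x - Proj a N u x))\<^sup>2 + (L2w_norm a (\<lambda>x. Proj a N u x - p x))\<^sup>2"
  using pythagoras[OF a Proj_diff_L2w[OF a u] Proj_orth[OF a u] polys_diff[OF Proj_polys[OF a u] p]] by simp

lemma Proj_best: "-1 < a \<Longrightarrow> u \<in> L2w a \<Longrightarrow> p \<in> polys N \<Longrightarrow> L2w_norm a (\<lambda>x. u x - Proj a N u x) \<le> L2w_norm a (\<lambda>x. u x - p x)"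
  by (rule L2w_norm_leI) (simp_all add: Proj_norm_split)

lemma Proj_diff_norm_le: "-1 < a \<Longrightarrow> u \<in> L2w a \<Longrightarrow> L2w_norm a (\<lambda>x. u x - Proj a N u x) \<le> L2w_norm a u"
  using Proj_best[OF _ _ polys_zero] by fastforce

lemma Proj_norm_le: "-1 < a \<Longrightarrow> u \<in> L2w a \<Longrightarrow> L2w_norm a (Proj a N u) \<le> L2w_norm a u"
  by (rule L2w_norm_leI) (use Proj_norm_split[OF _ _ polys_zero, of a u N] in simp_all)

section \<open>The differential operator diagonalised by orthogonal polynomials\<close>

lemma partial_add_polys:
  "p \<in> polys M \<Longrightarrow> q \<in> polys N \<Longrightarrow> partial i (\<lambda>x. p x + q x) = (\<lambda>x. partial i p x + partial i q x)"
  by (intro ext partial_add polys_differentiable)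

lemma partial_cmult_polys: "p \<in> polys M \<Longrightarrow> partial i (\<lambda>x. c * p x) = (\<lambda>x. c * partial i p x)"
  by (intro ext partial_cmult polys_differentiable)

lemma partial_cnj_polys: "p \<in> polys M \<Longrightarrow> partial i (\<lambda>x. cnj (p x)) = (\<lambda>x. cnj (partial i p x))"
  by (intro ext partial_cnj polys_differentiable)

text \<open>The degree must not rise here, as \<open>ang\<close> and \<open>euler\<close> have to
  preserve it. For \<open>N = 0\<close> the bound \<open>N - 1\<close> of
  \<open>partial_polys\<close> does not fall below \<open>N\<close>, but the derivative is
  zero.\<close>

lemma coord_partial_polys: "p \<in> polys N \<Longrightarrow> (\<lambda>x. of_real (x $ i) * partial j p x) \<in> polys N"
proof (cases N)
  case 0
  assume "p \<in> polys N"
  then have "partial j p x = 0" for x using partial_polys_0 0 by blast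
  then show ?thesis by (simp add: polys_zero)
next
  case (Suc n)
  assume "p \<in> polys N"
  from polys_mult_coord[OF partial_polys[OF this]] show ?thesis using Suc by simp
qed

lemma rho_partial_polys: "p \<in> polys N \<Longrightarrow> (\<lambda>x. of_real (rho x) * partial j p x) \<in> polys (Suc N)"
proof (cases N)
  case 0
  assume "p \<in> polys N"
  then have "partial j p x = 0" for x using partial_polys_0 0 by blast
  then show ?thesis by (simp add: polys_zero)
next
  case (Suc n)
  assume "p \<in> polys N"
  from polys_rho[OF partial_polys[OF this]] show ?thesis using Suc by simp
qed

definition ang :: "(real ^ 2 \<Rightarrow> complex) \<Rightarrow> real ^ 2 \<Rightarrow> complex" where
  "ang p x = of_real (x $ 1) * partial 2 p x - of_real (x $ 2) * partial 1 p x"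

definition euler :: "(real ^ 2 \<Rightarrow> complex) \<Rightarrow> real ^ 2 \<Rightarrow> complex" where
  "euler p x = of_real (x $ 1) * partial 1 p x + of_real (x $ 2) * partial 2 p x"

text \<open>On the disk this is \<open>- rho powr (- a) * div (rho powr (a + 1) * grad p)\<close>
  minus the square of the rotation field. Its eigenfunctions are the generalised Zernike
  polynomials.\<close>

definition diffop :: "real \<Rightarrow> (real ^ 2 \<Rightarrow> complex) \<Rightarrow> real ^ 2 \<Rightarrow> complex" where
  "diffop a p x = of_real (2 * (a + 1)) * euler p x
     - of_real (rho x) * (partial 1 (partial 1 p) x + partial 2 (partial 2 p) x) - ang (ang p) x"

text \<open>The summand \<open>2 * (a + 1) * N\<close> comes from the Euler field and
  \<open>N ^ 2\<close> from its square in \<open>laplacian_mon\<close>.\<close>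

definition eigval :: "real \<Rightarrow> nat \<Rightarrow> real" where
  "eigval a N = real N * (real N + 2 * (a + 1))"

lemma eigval_mono: "-1 < a \<Longrightarrow> M \<le> N \<Longrightarrow> eigval a M \<le> eigval a N"
  unfolding eigval_def by (intro mult_mono) auto

lemma ang_polys: "p \<in> polys N \<Longrightarrow> ang p \<in> polys N"
  unfolding ang_def[abs_def] by (intro polys_diff coord_partial_polys)

lemma euler_polys: "p \<in> polys N \<Longrightarrow> euler p \<in> polys N"
  unfolding euler_def[abs_def] by (intro polys_add coord_partial_polys)

lemma ang_add: "p \<in> polys M \<Longrightarrow> q \<in> polys N \<Longrightarrow> ang (\<lambda>x. p x + q x) = (\<lambda>x. ang p x + ang q x)"
  by (simp add: ang_def fun_eq_iff partial_add_polys algebra_simps)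

lemma ang_cmult: "p \<in> polys M \<Longrightarrow> ang (\<lambda>x. c * p x) = (\<lambda>x. c * ang p x)"
  by (simp add: ang_def fun_eq_iff partial_cmult_polys algebra_simps)

lemma ang_cnj: "p \<in> polys M \<Longrightarrow> ang (\<lambda>x. cnj (p x)) = (\<lambda>x. cnj (ang p x))"
  by (simp add: ang_def fun_eq_iff partial_cnj_polys)

lemma euler_add: "p \<in> polys M \<Longrightarrow> q \<in> polys N \<Longrightarrow> euler (\<lambda>x. p x + q x) = (\<lambda>x. euler p x + euler q x)"
  by (simp add: euler_def fun_eq_iff partial_add_polys algebra_simps)

lemma euler_cmult: "p \<in> polys M \<Longrightarrow> euler (\<lambda>x. c * p x) = (\<lambda>x. c * euler p x)"
  by (simp add: euler_def fun_eq_iff partial_cmult_polys algebra_simps)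

lemma euler_cnj: "p \<in> polys M \<Longrightarrow> euler (\<lambda>x. cnj (p x)) = (\<lambda>x. cnj (euler p x))"
  by (simp add: euler_def fun_eq_iff partial_cnj_polys)

lemma diffop_add:
  assumes "p \<in> polys M" "q \<in> polys N"
  shows "diffop a (\<lambda>x. p x + q x) = (\<lambda>x. diffop a p x + diffop a q x)"
  using assms
  by (simp add: diffop_def fun_eq_iff euler_add ang_add partial_add_polys partial_polys[OF assms(1)] partial_polys[OF assms(2)]
      ang_add[OF ang_polys ang_polys] partial_add_polys[OF partial_polys partial_polys])
     (simp add: algebra_simps)

lemma diffop_cmult:
  assumes "p \<in> polys M"
  shows "diffop a (\<lambda>x. c * p x) = (\<lambda>x. c * diffop a p x)"
  using assms
  by (simp add: diffop_def fun_eq_iff euler_cmult ang_cmult partial_cmult_polys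
      ang_cmult[OF ang_polys] partial_cmult_polys[OF partial_polys])
     (simp add: algebra_simps)

lemma partial_mon_fun:
  "partial 1 (mon i j) = (\<lambda>x. of_nat i * mon (i - 1) j x)"
  "partial 2 (mon i j) = (\<lambda>x. of_nat j * mon i (j - 1) x)"
  by (simp_all add: fun_eq_iff partial_mon)

lemma coord_mon:
  "of_real (x $ 1) * mon i j x = mon (Suc i) j x"
  "of_real (x $ 2) * mon i j x = mon i (Suc j) x"
  by (simp_all add: mon_def)

lemma euler_mon: "euler (mon i j) x = of_nat (i + j) * mon i j x"
proof -
  have 1: "of_real (x $ 1) * (of_nat i * mon (i - 1) j x) = of_nat i * mon i j x"
    by (cases i) (simp_all add: mult.left_commute coord_mon)
  have 2: "of_real (x $ 2) * (of_nat j * mon i (j - 1) x) = of_nat j * mon i j x"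
    by (cases j) (simp_all add: mult.left_commute coord_mon)
  show ?thesis unfolding euler_def partial_mon_fun 1 2 by (simp add: distrib_right)
qed

lemma ang_mon: "ang (mon i j) = (\<lambda>x. of_nat j * mon (Suc i) (j - 1) x + (- of_nat i) * mon (i - 1) (Suc j) x)"
  by (simp add: ang_def fun_eq_iff partial_mon_fun mult.left_commute[of "of_real _"] coord_mon)

text \<open>In polar terms this is \<open>r\<^sup>2 * laplacian = euler\<^sup>2 + ang\<^sup>2\<close>, applied to a monomial.\<close>

lemma laplacian_mon:
  "of_real ((x $ 1)\<^sup>2 + (x $ 2)\<^sup>2) * (of_nat (i * (i - 1)) * mon (i - 2) j x + of_nat (j * (j - 1)) * mon i (j - 2) x)
     - ang (ang (mon i j)) x = of_nat ((i + j)\<^sup>2) * mon i j x"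
proof -
  have m: "mon i j \<in> polys (i + j)" for i j by (rule mon_in_polys) simp
  have aa: "ang (ang (mon i j)) x =
     of_nat j * (of_nat (j - 1) * mon (Suc (Suc i)) (j - 1 - 1) x - of_nat (Suc i) * mon i (Suc (j - 1)) x)
     - of_nat i * (of_nat (Suc j) * mon (Suc (i - 1)) j x - of_nat (i - 1) * mon (i - 1 - 1) (Suc (Suc j)) x)"
    unfolding ang_mon[of i j]
    by (simp only: ang_add[OF polys_scale[OF m] polys_scale[OF m]] ang_cmult[OF m] ang_mon)
      (simp add: algebra_simps del: of_nat_Suc)
  define X where "X = complex_of_real (x $ 1)"
  define Y where "Y = complex_of_real (x $ 2)"
  have mon: "mon k l x = X ^ k * Y ^ l" for k l by (simp add: mon_def X_def Y_def)
  have r: "complex_of_real ((x $ 1)\<^sup>2 + (x $ 2)\<^sup>2) = X\<^sup>2 + Y\<^sup>2" by (simp add: X_def Y_def)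
  \<comment> \<open>\<open>A k\<close> is the second derivative of the \<open>k\<close>-th power.
    Multiplied by \<open>z ^ 2\<close> it is a multiple of \<open>z ^ k\<close> for every
    \<open>k\<close>, including those where the exponent \<open>k - 2\<close> is truncated.\<close>
  define A where "A k z = of_nat (k * (k - 1)) * z ^ (k - 2)" for k and z :: complex
  have A2: "z\<^sup>2 * A k z = ((of_nat k)\<^sup>2 - of_nat k) * z ^ k" for k z
  proof -
    consider "k = 0" | "k = 1" | k' where "k = Suc (Suc k')" by (metis One_nat_def not0_implies_Suc)
    then show ?thesis by cases (simp_all add: A_def power2_eq_square algebra_simps)
  qed
  have A1: "of_nat k * (of_nat (k - 1) * z ^ (k - 1 - 1)) = A k z" for k z
    by (simp add: A_def mult.assoc numeral_2_eq_2)
  have S: "of_nat k * z ^ Suc (k - 1) = of_nat k * (z ^ k :: complex)" for k z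
    by (cases k) simp_all
  have "ang (ang (mon i j)) x = (X\<^sup>2 * X ^ i * A j Y - of_nat (Suc i) * X ^ i * (of_nat j * Y ^ Suc (j - 1)))
      - (of_nat (Suc j) * (of_nat i * X ^ Suc (i - 1)) * Y ^ j - A i X * (Y\<^sup>2 * Y ^ j))"
    unfolding aa mon A1[symmetric] by (simp add: power2_eq_square algebra_simps del: of_nat_Suc)
  then have aa': "ang (ang (mon i j)) x = (X\<^sup>2 * X ^ i * A j Y - of_nat (Suc i) * X ^ i * (of_nat j * Y ^ j))
      - (of_nat (Suc j) * (of_nat i * X ^ i) * Y ^ j - A i X * (Y\<^sup>2 * Y ^ j))"
    unfolding S .
  have "of_real ((x $ 1)\<^sup>2 + (x $ 2)\<^sup>2) * (of_nat (i * (i - 1)) * mon (i - 2) j x + of_nat (j * (j - 1)) * mon i (j - 2) x)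
     - ang (ang (mon i j)) x = (X\<^sup>2 + Y\<^sup>2) * (A i X * Y ^ j + X ^ i * A j Y) - ang (ang (mon i j)) x"
    unfolding r mon by (simp add: A_def)
  also have "\<dots> = (X\<^sup>2 * A i X) * Y ^ j + (Y\<^sup>2 * A j Y) * X ^ i
     + (of_nat (Suc i) * of_nat j + of_nat (Suc j) * of_nat i) * (X ^ i * Y ^ j)"
    unfolding aa' by (simp add: algebra_simps del: of_nat_Suc)
  also have "\<dots> = of_nat ((i + j)\<^sup>2) * mon i j x"
    unfolding A2 mon by (simp add: power2_eq_square algebra_simps)
  finally show ?thesis .
qed

lemma partial_partial_mon:
  "partial 1 (partial 1 (mon i j)) x = of_nat (i * (i - 1)) * mon (i - 2) j x"
  "partial 2 (partial 2 (mon i j)) x = of_nat (j * (j - 1)) * mon i (j - 2) x"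
proof -
  have m: "mon i j \<in> polys (i + j)" for i j by (rule mon_in_polys) simp
  show "partial 1 (partial 1 (mon i j)) x = of_nat (i * (i - 1)) * mon (i - 2) j x"
    "partial 2 (partial 2 (mon i j)) x = of_nat (j * (j - 1)) * mon i (j - 2) x"
    by (simp_all add: partial_mon_fun partial_cmult_polys[OF m] numeral_2_eq_2)
qed

text \<open>With \<open>rho = 1 - |x|^2\<close>, the part with \<open>|x|^2\<close> combines with
  the angular term by \<open>laplacian_mon\<close>, and the remaining Laplacian lowers the degree by
  two. So \<open>diffop\<close> is triangular in the degree, with one scalar per degree on the
  diagonal.\<close>

lemma diffop_mon:
  "diffop a (mon i j) x = of_real (eigval a (i + j)) * mon i j x
     - (of_nat (i * (i - 1)) * mon (i - 2) j x + of_nat (j * (j - 1)) * mon i (j - 2) x)"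
proof -
  have "diffop a (mon i j) x = of_real (2 * (a + 1)) * (of_nat (i + j) * mon i j x)
      - of_real (rho x) * (of_nat (i * (i - 1)) * mon (i - 2) j x + of_nat (j * (j - 1)) * mon i (j - 2) x)
      - ang (ang (mon i j)) x"
    unfolding diffop_def euler_mon partial_partial_mon ..
  also have "of_real (rho x) = 1 - complex_of_real ((x $ 1)\<^sup>2 + (x $ 2)\<^sup>2)" by (simp add: rho_eq)
  finally have "diffop a (mon i j) x = of_real (2 * (a + 1)) * (of_nat (i + j) * mon i j x)
      - (of_nat (i * (i - 1)) * mon (i - 2) j x + of_nat (j * (j - 1)) * mon i (j - 2) x)
      + (of_real ((x $ 1)\<^sup>2 + (x $ 2)\<^sup>2) * (of_nat (i * (i - 1)) * mon (i - 2) j x + of_nat (j * (j - 1)) * mon i (j - 2) x)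
      - ang (ang (mon i j)) x)"
    by (simp add: left_diff_distrib)
  then show ?thesis unfolding laplacian_mon
    by (simp add: eigval_def power2_eq_square algebra_simps)
qed

text \<open>The degree condition is asked only for \<open>2 <= i + j\<close>, because below that
  degree both coefficients are zero.\<close>

lemma laplacian_mon_polys:
  assumes "2 \<le> i + j \<Longrightarrow> i + j - 2 \<le> M"
  shows "(\<lambda>x. of_nat (i * (i - 1)) * mon (i - 2) j x + of_nat (j * (j - 1)) * mon i (j - 2) x) \<in> polys M"
proof (intro polys_add)
  show "(\<lambda>x. of_nat (i * (i - 1)) * mon (i - 2) j x) \<in> polys M"
  proof (cases "2 \<le> i")
    case True then show ?thesis using assms by (intro polys_scale mon_in_polys) auto
  next
    case False
    then have "i * (i - 1) = 0" by (cases i) auto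
    then show ?thesis by (simp only: of_nat_0 mult_zero_left polys_zero)
  qed
  show "(\<lambda>x. of_nat (j * (j - 1)) * mon i (j - 2) x) \<in> polys M"
  proof (cases "2 \<le> j")
    case True then show ?thesis using assms by (intro polys_scale mon_in_polys) auto
  next
    case False
    then have "j * (j - 1) = 0" by (cases j) auto
    then show ?thesis by (simp only: of_nat_0 mult_zero_left polys_zero)
  qed
qed

lemma diffop_polys: "p \<in> polys N \<Longrightarrow> diffop a p \<in> polys N"
proof (induction rule: polys_induct)
  case zero
  have "diffop a (\<lambda>x. 0) = (\<lambda>x. 0)" using diffop_cmult[OF polys_zero[of 0], of a 0] by simp
  then show ?case by (simp add: polys_zero)
next
  case (add f g)
  then show ?case by (simp add: diffop_add polys_add)
next
  case (mon c i j)
  have "diffop a (\<lambda>x. c * mon i j x) = (\<lambda>x. c * (of_real (eigval a (i + j)) * mon i j x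
     - (of_nat (i * (i - 1)) * mon (i - 2) j x + of_nat (j * (j - 1)) * mon i (j - 2) x)))"
    by (simp add: diffop_cmult[OF mon_in_polys[OF order_refl]] diffop_mon)
  then show ?case using mon by (simp only:) (intro polys_scale polys_diff mon_in_polys laplacian_mon_polys; simp)
qed

text \<open>Modulo lower degrees \<open>diffop\<close> is the scalar \<open>eigval a N\<close> on
  degree \<open>N\<close>, and \<open>v\<close> does not see lower degrees. Quantifying over
  \<open>M < N\<close> makes the hypothesis vacuous for \<open>N = 0\<close>, where
  \<open>orth a (N - 1) v\<close> would exclude constants.\<close>

lemma pairing_diffop_orth:
  assumes a: "-1 < a" and v: "v \<in> L2w a" and o: "\<And>M. M < N \<Longrightarrow> orth a M v" and p: "p \<in> polys N"
  shows "pairing a v (diffop a p) = of_real (eigval a N) * pairing a v p"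
  using p
proof (induction rule: polys_induct)
  case zero
  have "diffop a (\<lambda>x. 0) = (\<lambda>x. 0)" using diffop_cmult[OF polys_zero[of 0], of a 0] by simp
  then show ?case by (simp add: pairing_def)
next
  case (add f g)
  then show ?case
    using polys_L2w[OF a diffop_polys[OF add(1)]] polys_L2w[OF a diffop_polys[OF add(2)]]
    by (simp add: diffop_add pairing_add_right[OF _ _ v] polys_L2w[OF a add(1)] polys_L2w[OF a add(2)] algebra_simps)
next
  case (mon c i j)
  let ?d = "\<lambda>x. of_nat (i * (i - 1)) * mon (i - 2) j x + of_nat (j * (j - 1)) * mon i (j - 2) x"
  have m: "mon i j \<in> polys (i + j)" by (rule mon_in_polys) simp
  have d0: "pairing a v ?d = 0"
  proof (cases "2 \<le> i + j")
    case True
    then show ?thesis using mon o[of "N - 2"] laplacian_mon_polys[of i j "N - 2"] by (intro orthD[of a "N - 2"]) auto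
  next
    case False
    then have "i * (i - 1) = 0" "j * (j - 1) = 0" by (cases i; cases j; simp)+
    then have "?d = (\<lambda>x. 0)" by (simp only: of_nat_0 mult_zero_left add_0)
    then show ?thesis by (simp add: pairing_def)
  qed
  have e: "of_real (eigval a (i + j)) * pairing a v (mon i j) = of_real (eigval a N) * pairing a v (mon i j)"
    using mon o[of "i + j"] orthD[OF _ m, of a v] by (cases "i + j = N") auto
  have "diffop a (\<lambda>x. c * mon i j x) = (\<lambda>x. c * (of_real (eigval a (i + j)) * mon i j x - ?d x))"
    by (simp add: diffop_cmult[OF m] diffop_mon)
  then have "pairing a v (diffop a (\<lambda>x. c * mon i j x)) = c * pairing a v (\<lambda>x. of_real (eigval a (i + j)) * mon i j x - ?d x)"
    by (simp only: pairing_cmult_right)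
  also have "\<dots> = c * (of_real (eigval a (i + j)) * pairing a v (mon i j) - pairing a v ?d)"
    by (subst pairing_diff_right[OF polys_L2w[OF a polys_scale[OF m]] polys_L2w[OF a laplacian_mon_polys[of i j "i + j"]] v])
       (simp_all add: pairing_cmult_right)
  finally show ?case unfolding d0 e by (simp add: pairing_cmult_right)
qed

text \<open>The same mechanism for the Euler field, which multiplies a monomial by its degree; it
  evaluates the Euler term of \<open>weight_identity\<close>.\<close>

lemma pairing_euler_orth:
  assumes a: "-1 < a" and v: "v \<in> L2w a" and o: "\<And>M. M < N \<Longrightarrow> orth a M v" and p: "p \<in> polys N"
  shows "pairing a v (euler p) = of_nat N * pairing a v p"
  using p
proof (induction rule: polys_induct)
  case zero
  have "euler (\<lambda>x. 0) = (\<lambda>x. 0)" using euler_cmult[OF polys_zero[of 0], of 0] by simp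
  then show ?case by (simp add: pairing_def)
next
  case (add f g)
  then show ?case
    using polys_L2w[OF a euler_polys[OF add(1)]] polys_L2w[OF a euler_polys[OF add(2)]]
    by (simp add: euler_add pairing_add_right[OF _ _ v] polys_L2w[OF a add(1)] polys_L2w[OF a add(2)] algebra_simps)
next
  case (mon c i j)
  have m: "mon i j \<in> polys (i + j)" by (rule mon_in_polys) simp
  have "euler (\<lambda>x. c * mon i j x) = (\<lambda>x. c * (of_nat (i + j) * mon i j x))"
    by (simp add: euler_cmult[OF m] euler_mon)
  then have "pairing a v (euler (\<lambda>x. c * mon i j x)) = c * (of_nat (i + j) * pairing a v (mon i j))"
    by (simp only: pairing_cmult_right)
  also have "of_nat (i + j) * pairing a v (mon i j) = of_nat N * pairing a v (mon i j)"
    using mon o[of "i + j"] orthD[OF _ m, of a v] by (cases "i + j = N") auto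
  finally show ?case by (simp add: pairing_cmult_right)
qed

lemma weak_partial_polys: "p \<in> polys N \<Longrightarrow> weak_partial j p (partial j p)"
  unfolding weak_partial_def
  by (auto intro: polys_locally_integrable partial_polys integral_parts_test_polys)

lemma parts_polys:
  assumes "-1 < a" "p \<in> polys M" "q \<in> polys N"
  shows "pairing (a + 1) (partial j p) q =
    pairing a p (\<lambda>x. of_real (2 * (a + 1)) * (of_real (x $ j) * q x) - of_real (rho x) * partial j q x)"
  by (rule weak_parts[OF assms(1) polys_L2w[OF assms(1,2)] polys_L2w[OF assms(1) partial_polys[OF assms(2)]]
      weak_partial_polys[OF assms(2)] assms(3)])

lemma parts_ang:
  assumes "-1 < a" "p \<in> polys M" "q \<in> polys N"
  shows "pairing a (ang p) q = - pairing a p (ang q)"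
  unfolding ang_def[abs_def]
  by (rule weak_parts_angular[OF assms(1) polys_L2w[OF assms(1,2)] polys_L2w[OF assms(1) partial_polys[OF assms(2)]]
      polys_L2w[OF assms(1) partial_polys[OF assms(2)]] weak_partial_polys[OF assms(2)] weak_partial_polys[OF assms(2)] assms(3)])

text \<open>The gradient terms are integrated by parts against exponent \<open>a + 1\<close>, the
  angular one against \<open>a\<close>. The left side is symmetric in \<open>p\<close> and
  \<open>q\<close>, which makes \<open>diffop\<close> self-adjoint for the pairing.\<close>

lemma dirichlet_form:
  assumes a: "-1 < a" and p: "p \<in> polys M" and q: "q \<in> polys N"
  shows "pairing (a + 1) (partial 1 p) (partial 1 q) + pairing (a + 1) (partial 2 p) (partial 2 q)
    + pairing a (ang p) (ang q) = pairing a p (diffop a q)"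
proof -
  define f where "f j x = of_real (2 * (a + 1)) * (of_real (x $ j) * partial j q x)
      - of_real (rho x) * partial j (partial j q) x" for j x
  have f: "f j \<in> polys (N + 2)" for j unfolding f_def[abs_def]
    by (intro polys_diff polys_scale polys_mono[OF coord_partial_polys[OF q]] polys_rho partial_polys'[OF partial_polys'[OF q]]) simp
  have aa: "ang (ang q) \<in> polys N" by (intro ang_polys q)
  note L = polys_L2w[OF a]
  have "diffop a q = (\<lambda>x. (f 1 x + f 2 x) - ang (ang q) x)"
    by (simp add: diffop_def f_def euler_def fun_eq_iff algebra_simps)
  then have "pairing a p (diffop a q) = pairing a p (f 1) + pairing a p (f 2) - pairing a p (ang (ang q))"
    by (simp add: pairing_diff_right[OF L[OF polys_add[OF f f]] L[OF aa] L[OF p]] pairing_add_right[OF L[OF f] L[OF f] L[OF p]])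
  moreover have "pairing (a + 1) (partial j p) (partial j q) = pairing a p (f j)" for j
    unfolding f_def[abs_def] by (rule parts_polys[OF a p partial_polys[OF q]])
  moreover have "pairing a (ang p) (ang q) = - pairing a p (ang (ang q))"
    by (rule parts_ang[OF a p ang_polys[OF q]])
  ultimately show ?thesis by simp
qed

definition energy :: "real \<Rightarrow> (real ^ 2 \<Rightarrow> complex) \<Rightarrow> real" where
  "energy a p = (L2w_norm (a + 1) (partial 1 p))\<^sup>2 + (L2w_norm (a + 1) (partial 2 p))\<^sup>2 + (L2w_norm a (ang p))\<^sup>2"

lemma energy_nonneg: "0 \<le> energy a p"
  by (simp add: energy_def)

lemma energy_pairing:
  assumes a: "-1 < a" and p: "p \<in> polys N"
  shows "of_real (energy a p) = pairing a p (diffop a (\<lambda>x. cnj (p x)))"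
  unfolding dirichlet_form[OF a p polys_cnj[OF p], symmetric] partial_cnj_polys[OF p] ang_cnj[OF p] pairing_cnj_self
  by (simp add: energy_def)

lemma energy_orth:
  assumes a: "-1 < a" and p: "p \<in> polys N" "\<And>M. M < N \<Longrightarrow> orth a M p"
  shows "energy a p = eigval a N * (L2w_norm a p)\<^sup>2"
proof -
  have "of_real (energy a p) = of_real (eigval a N) * pairing a p (\<lambda>x. cnj (p x))"
    unfolding energy_pairing[OF a p(1)] by (rule pairing_diffop_orth[OF a polys_L2w[OF a p(1)] p(2) polys_cnj[OF p(1)]])
  also have "\<dots> = of_real (eigval a N * (L2w_norm a p)\<^sup>2)" by (simp add: pairing_cnj_self)
  finally show ?thesis by (simp only: of_real_eq_iff)
qed

text \<open>Both mixed terms vanish: \<open>diffop\<close> preserves \<open>polys M\<close>, to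
  which the remainder is orthogonal, and symmetry of the form brings the second mixed term to the
  same shape.\<close>

lemma energy_split:
  assumes a: "-1 < a" and p: "p \<in> polys (Suc M)"
  shows "energy a p = energy a (Proj a M p) + eigval a (Suc M) * (L2w_norm a (\<lambda>x. p x - Proj a M p x))\<^sup>2"
proof -
  define p' where "p' = Proj a M p"
  define e where "e x = p x - p' x" for x
  have p': "p' \<in> polys M" and oe: "orth a M e" unfolding p'_def e_def
    by (rule Proj_polys[OF a polys_L2w[OF a p]], rule Proj_orth[OF a polys_L2w[OF a p]])
  have e: "e \<in> polys (Suc M)" unfolding e_def by (intro polys_diff p polys_mono[OF p']) simp
  note c = polys_cnj[OF p'] polys_cnj[OF e]
  note L = polys_L2w[OF a]
  have peq: "p = (\<lambda>x. p' x + e x)" by (simp add: e_def)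
  have 1: "pairing a e (diffop a (\<lambda>x. cnj (p' x))) = 0"
    by (rule orthD[OF oe diffop_polys[OF c(1)]])
  have "pairing a p' (diffop a (\<lambda>x. cnj (e x))) = pairing a (\<lambda>x. cnj (e x)) (diffop a p')"
    unfolding dirichlet_form[OF a p' c(2), symmetric] dirichlet_form[OF a c(2) p', symmetric]
    by (simp add: pairing_commute)
  also have "\<dots> = 0" by (rule orthD[OF orth_cnj[OF oe] diffop_polys[OF p']])
  finally have 2: "pairing a p' (diffop a (\<lambda>x. cnj (e x))) = 0" .
  have "of_real (energy a p) = pairing a (\<lambda>x. p' x + e x) (\<lambda>x. diffop a (\<lambda>x. cnj (p' x)) x + diffop a (\<lambda>x. cnj (e x)) x)"
    unfolding energy_pairing[OF a p] by (simp add: peq diffop_add[OF c])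
  also have "\<dots> = pairing a p' (diffop a (\<lambda>x. cnj (p' x))) + pairing a e (diffop a (\<lambda>x. cnj (e x)))"
    using L[OF p'] L[OF e] L[OF diffop_polys[OF c(1)]] L[OF diffop_polys[OF c(2)]]
    by (simp add: pairing_add_left pairing_add_right L2w_add 1 2)
  also have "\<dots> = of_real (energy a p' + energy a e)"
    by (simp add: energy_pairing[OF a p'] energy_pairing[OF a e])
  finally have "energy a p = energy a p' + energy a e" by (simp only: of_real_eq_iff)
  also have "energy a e = eigval a (Suc M) * (L2w_norm a e)\<^sup>2"
    by (rule energy_orth[OF a e]) (use orth_mono[OF oe] in auto)
  finally show ?thesis unfolding p'_def e_def .
qed

lemma norm_split:
  assumes a: "-1 < a" and u: "u \<in> L2w a"
  shows "(L2w_norm a u)\<^sup>2 = (L2w_norm a (Proj a M u))\<^sup>2 + (L2w_norm a (\<lambda>x. u x - Proj a M u x))\<^sup>2"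
  using Proj_norm_split[OF a u polys_zero, of M] by simp

text \<open>Peel off the top degree by \<open>energy_split\<close>: every surviving degree exceeds
  \<open>N\<close>, and the eigenvalues grow with the degree. This spectral gap drives the
  \<open>L2\<close> error.\<close>

lemma energy_ge:
  assumes a: "-1 < a" and "p \<in> polys M" "orth a N p"
  shows "eigval a (Suc N) * (L2w_norm a p)\<^sup>2 \<le> energy a p"
  using assms(2,3)
proof (induction M arbitrary: p)
  case 0
  then have "p = (\<lambda>x. 0)" using orth_polys_eq_0[OF a 0(1)] orth_mono by blast
  then have "L2w_norm a p = 0" by (simp add: L2w_norm_def)
  then show ?case by (simp add: energy_nonneg)
next
  case (Suc M)
  note L = polys_L2w[OF a Suc.prems(1)]
  show ?case
  proof (cases "Suc M \<le> N")
    case True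
    then have "p = (\<lambda>x. 0)" using orth_polys_eq_0[OF a Suc.prems(1)] Suc.prems(2) orth_mono by blast
    then have "L2w_norm a p = 0" by (simp add: L2w_norm_def)
    then show ?thesis by (simp add: energy_nonneg)
  next
    case False
    have "orth a N (\<lambda>x. p x - (p x - Proj a M p x))"
      using False by (intro orth_diff a L Proj_diff_L2w[OF a L] Suc.prems(2) orth_mono[OF Proj_orth[OF a L]]) simp
    then have "eigval a (Suc N) * (L2w_norm a (Proj a M p))\<^sup>2 \<le> energy a (Proj a M p)"
      by (intro Suc.IH Proj_polys[OF a L]) simp
    moreover have "eigval a (Suc N) * (L2w_norm a (\<lambda>x. p x - Proj a M p x))\<^sup>2 \<le> eigval a (Suc M) * (L2w_norm a (\<lambda>x. p x - Proj a M p x))\<^sup>2"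
      using False by (intro mult_right_mono eigval_mono[OF a]) auto
    ultimately show ?thesis
      unfolding energy_split[OF a Suc.prems(1)] norm_split[OF a L, of M] distrib_left by linarith
  qed
qed

text \<open>The same peeling with the largest eigenvalue; it is the source of the bounds on
  derivatives of polynomials.\<close>

lemma energy_le:
  assumes a: "-1 < a" and "p \<in> polys M"
  shows "energy a p \<le> eigval a M * (L2w_norm a p)\<^sup>2"
  using assms(2)
proof (induction M arbitrary: p)
  case 0
  then show ?case using energy_orth[OF a 0] by simp
next
  case (Suc M)
  note L = polys_L2w[OF a Suc.prems(1)]
  have "energy a (Proj a M p) \<le> eigval a M * (L2w_norm a (Proj a M p))\<^sup>2"
    by (intro Suc.IH Proj_polys[OF a L])
  also have "\<dots> \<le> eigval a (Suc M) * (L2w_norm a (Proj a M p))\<^sup>2"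
    by (intro mult_right_mono eigval_mono[OF a]) auto
  finally show ?case
    unfolding energy_split[OF a Suc.prems(1)] norm_split[OF a L, of M] distrib_left by linarith
qed

section \<open>Projections and derivatives\<close>

lemma Proj_partial:
  assumes a: "-1 < a" and u: "u \<in> L2w a" and w: "w \<in> L2w a" and d: "weak_partial j u w"
  shows "Proj (a + 1) N w = partial j (Proj a (Suc N) u)"
proof (rule Proj_unique)
  define P where "P = Proj a (Suc N) u"
  have P: "P \<in> polys (Suc N)" unfolding P_def by (rule Proj_polys[OF a u])
  show a1: "-1 < a + 1" using a by simp
  show w1: "w \<in> L2w (a + 1)" by (rule L2w_mono[OF w]) simp
  show dP: "partial j (Proj a (Suc N) u) \<in> polys N" using partial_polys[OF P, of j] by (simp add: P_def)
  show "orth (a + 1) N (\<lambda>x. w x - partial j (Proj a (Suc N) u) x)"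
    unfolding orth_def
  proof
    fix q assume q: "q \<in> polys N"
    let ?Q = "\<lambda>x. of_real (2 * (a + 1)) * (of_real (x $ j) * q x) - of_real (rho x) * partial j q x"
    \<comment> \<open>The adjoint of \<open>partial j\<close>, taken from exponent
      \<open>a + 1\<close> back to \<open>a\<close>, raises the degree by at most one. This is why
      degree \<open>Suc N\<close> pairs with degree \<open>N\<close>.\<close>
    have Q: "?Q \<in> polys (Suc N)" by (intro polys_diff polys_scale polys_mult_coord rho_partial_polys q)
    have "pairing (a + 1) (\<lambda>x. w x - partial j P x) q = pairing (a + 1) w q - pairing (a + 1) (partial j P) q"
      unfolding P_def by (rule pairing_diff_left[OF w1 polys_L2w[OF a1 dP] polys_L2w[OF a1 q]])
    also have "\<dots> = pairing a u ?Q - pairing a P ?Q"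
      by (simp only: weak_parts[OF a u w d q] parts_polys[OF a P q])
    also have "\<dots> = pairing a (\<lambda>x. u x - P x) ?Q"
      by (rule pairing_diff_left[symmetric, OF u polys_L2w[OF a P] polys_L2w[OF a Q]])
    also have "\<dots> = 0" unfolding P_def by (rule orthD[OF Proj_orth[OF a u] Q])
    finally show "pairing (a + 1) (\<lambda>x. w x - partial j (Proj a (Suc N) u) x) q = 0" by (simp add: P_def)
  qed
qed

lemma Proj_ang:
  assumes a: "-1 < a" and u: "u \<in> L2w a" and w1: "w1 \<in> L2w a" and w2: "w2 \<in> L2w a"
    and d1: "weak_partial 1 u w1" and d2: "weak_partial 2 u w2"
  shows "Proj a N (\<lambda>x. of_real (x $ 1) * w2 x - of_real (x $ 2) * w1 x) = ang (Proj a N u)"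
proof (rule Proj_unique[OF a])
  define P where "P = Proj a N u"
  define v where "v x = of_real (x $ 1) * w2 x - of_real (x $ 2) * w1 x" for x
  have P: "P \<in> polys N" unfolding P_def by (rule Proj_polys[OF a u])
  have v: "v \<in> L2w a" unfolding v_def by (intro L2w_diff L2w_coord_mult w1 w2)
  then show "(\<lambda>x. of_real (x $ 1) * w2 x - of_real (x $ 2) * w1 x) \<in> L2w a" by (simp add: v_def[abs_def])
  show "ang (Proj a N u) \<in> polys N" using ang_polys[OF P] by (simp add: P_def)
  have "pairing a (\<lambda>x. v x - ang P x) q = 0" if q: "q \<in> polys N" for q
  proof -
    note L = polys_L2w[OF a]
    have "pairing a (\<lambda>x. v x - ang P x) q = pairing a v q - pairing a (ang P) q"
      by (rule pairing_diff_left[OF v L[OF ang_polys[OF P]] L[OF q]])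
    also have "\<dots> = - (pairing a u (ang q) - pairing a P (ang q))"
      unfolding v_def weak_parts_angular[OF a u w1 w2 d1 d2 q] parts_ang[OF a P q]
      by (simp add: ang_def[abs_def])
    also have "\<dots> = - pairing a (\<lambda>x. u x - P x) (ang q)"
      by (simp only: pairing_diff_left[OF u L[OF P] L[OF ang_polys[OF q]]])
    also have "\<dots> = 0" unfolding P_def by (simp add: orthD[OF Proj_orth[OF a u] ang_polys[OF q]])
    finally show ?thesis .
  qed
  then show "orth a N (\<lambda>x. of_real (x $ 1) * w2 x - of_real (x $ 2) * w1 x - ang (Proj a N u) x)"
    by (simp add: orth_def v_def P_def)
qed

section \<open>Comparison of the weights on polynomials\<close>

text \<open>Integrate \<open>\<Sum>j. x\<^sub>j * \<partial>\<^sub>j |q|\<^sup>2\<close> by parts against the weight with exponent \<open>a + 1\<close>.\<close>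

lemma weight_identity:
  assumes a: "-1 < a" and q: "q \<in> polys N"
  shows "(a + 1) * (L2w_norm a q)\<^sup>2 = (a + 2) * (L2w_norm (a + 1) q)\<^sup>2 + Re (pairing (a + 1) (euler q) (\<lambda>x. cnj (q x)))"
proof -
  define c where "c x = cnj (q x)" for x
  have c: "c \<in> polys N" unfolding c_def by (rule polys_cnj[OF q])
  have a1: "-1 < a + 1" using a by simp
  define T where "T = pairing (a + 1) (euler q) c"
  define F where "F j x = of_real (2 * (a + 1)) * (of_real (x $ j) * (of_real (x $ j) * c x))
      - of_real (rho x) * partial j (\<lambda>x. of_real (x $ j) * c x) x" for j x
  have F: "F j \<in> polys (N + 2)" for j unfolding F_def[abs_def]
    using polys_mult_coord[OF polys_mult_coord[OF c]] rho_partial_polys[OF polys_mult_coord[OF c]]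
    by (intro polys_diff polys_scale) auto
  define G where "G x = of_real (2 * (a + 2)) * c x + euler c x" for x
  have G: "G \<in> polys N" unfolding G_def[abs_def] by (intro polys_add polys_scale c euler_polys)
  have step: "pairing (a + 1) (\<lambda>x. of_real (x $ j) * partial j q x) c = pairing a q (F j)" for j
  proof -
    have "pairing (a + 1) (\<lambda>x. of_real (x $ j) * partial j q x) c = pairing (a + 1) (partial j q) (\<lambda>x. of_real (x $ j) * c x)"
      by (simp add: pairing_def mult_ac)
    also have "\<dots> = pairing a q (F j)"
      unfolding F_def[abs_def] by (rule parts_polys[OF a q polys_mult_coord[OF c]])
    finally show ?thesis .
  qed
  \<comment> \<open>The identity \<open>x1^2 + x2^2 = 1 - rho\<close> splits the leading term: the 1
    produces the norm with exponent \<open>a\<close>, while \<open>rho\<close> joins the terms with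
    exponent \<open>a + 1\<close>.\<close>
  have FG: "F 1 x + F 2 x = of_real (2 * (a + 1)) * c x - of_real (rho x) * G x" for x
  proof -
    have r: "complex_of_real (x $ 1) * of_real (x $ 1) + of_real (x $ 2) * of_real (x $ 2) = 1 - of_real (rho x)"
      by (simp add: rho_eq power2_eq_square)
    have "F 1 x + F 2 x = of_real (2 * (a + 1)) * ((complex_of_real (x $ 1) * of_real (x $ 1) + of_real (x $ 2) * of_real (x $ 2)) * c x)
       - of_real (rho x) * (euler c x + 2 * c x)"
      unfolding F_def partial_coord_mult[OF c] euler_def by (simp add: algebra_simps)
    then show ?thesis unfolding r by (simp add: G_def algebra_simps)
  qed
  have rG: "(\<lambda>x. of_real (rho x) * G x) \<in> polys (N + 2)" by (rule polys_rho[OF G])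
  note L = polys_L2w[OF a] and L1 = polys_L2w[OF a1]
  have "T = pairing (a + 1) (\<lambda>x. of_real (x $ 1) * partial 1 q x) c + pairing (a + 1) (\<lambda>x. of_real (x $ 2) * partial 2 q x) c"
    unfolding T_def euler_def[abs_def]
    by (rule pairing_add_left[OF L1[OF coord_partial_polys[OF q]] L1[OF coord_partial_polys[OF q]] L1[OF c]])
  also have "\<dots> = pairing a q (\<lambda>x. F 1 x + F 2 x)"
    unfolding step by (rule pairing_add_right[OF L[OF F] L[OF F] L[OF q], symmetric])
  also have "\<dots> = of_real (2 * (a + 1)) * pairing a q c - pairing (a + 1) q G"
    unfolding FG pairing_shift
    by (subst pairing_diff_right[OF L[OF polys_scale[OF c]] L[OF rG] L[OF q]]) (simp only: pairing_cmult_right)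
  also have "pairing (a + 1) q G = of_real (2 * (a + 2)) * pairing (a + 1) q c + pairing (a + 1) q (euler c)"
    unfolding G_def[abs_def]
    by (subst pairing_add_right[OF L1[OF polys_scale[OF c]] L1[OF euler_polys[OF c]] L1[OF q]]) (simp only: pairing_cmult_right)
  \<comment> \<open>The Euler field reappears on the conjugate factor, so only the real part of
    \<open>T\<close> is determined.\<close>
  also have "pairing (a + 1) q (euler c) = cnj T"
    unfolding T_def pairing_cnj_cnj[symmetric] c_def euler_cnj[OF q] by (simp add: pairing_commute)
  finally have "T + cnj T = of_real (2 * (a + 1)) * pairing a q c - of_real (2 * (a + 2)) * pairing (a + 1) q c"
    by (simp add: algebra_simps)
  then have "complex_of_real (2 * Re T) = of_real (2 * (a + 1) * (L2w_norm a q)\<^sup>2 - 2 * (a + 2) * (L2w_norm (a + 1) q)\<^sup>2)"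
    unfolding complex_add_cnj c_def pairing_cnj_self by simp
  then have "2 * Re T = 2 * (a + 1) * (L2w_norm a q)\<^sup>2 - 2 * (a + 2) * (L2w_norm (a + 1) q)\<^sup>2"
    by (simp only: of_real_eq_iff)
  then show ?thesis by (simp add: T_def c_def[abs_def] algebra_simps)
qed

text \<open>On a pure degree the Euler term is \<open>N\<close> times the squared norm, so
  \<open>weight_identity\<close> becomes an exact ratio of the two norms.\<close>

lemma orth_weight_norm:
  assumes a: "-1 < a" and q: "q \<in> polys N" "\<And>M. M < N \<Longrightarrow> orth (a + 1) M q"
  shows "(a + 1) * (L2w_norm a q)\<^sup>2 = (real N + a + 2) * (L2w_norm (a + 1) q)\<^sup>2"
proof -
  have a1: "-1 < a + 1" using a by simp
  have "pairing (a + 1) (euler q) (\<lambda>x. cnj (q x)) = pairing (a + 1) (\<lambda>x. cnj (q x)) (euler q)"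
    by (rule pairing_commute)
  also have "\<dots> = of_nat N * pairing (a + 1) (\<lambda>x. cnj (q x)) q"
    by (rule pairing_euler_orth[OF a1 L2w_cnj[OF polys_L2w[OF a1 q(1)]] orth_cnj[OF q(2)] q(1)])
  also have "pairing (a + 1) (\<lambda>x. cnj (q x)) q = of_real ((L2w_norm (a + 1) q)\<^sup>2)"
    by (simp only: pairing_commute[of _ _ q] pairing_cnj_self)
  finally show ?thesis
    unfolding weight_identity[OF a q(1)] by (simp add: algebra_simps)
qed

lemma orth_weight_norm_le:
  assumes a: "-1 < a" and q: "q \<in> polys N" "\<And>M. M < N \<Longrightarrow> orth (a + 1) M q"
  shows "L2w_norm a q \<le> sqrt ((real N + a + 2) / (a + 1)) * L2w_norm (a + 1) q"
proof (rule L2w_norm_leI)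
  show "(L2w_norm a q)\<^sup>2 \<le> (sqrt ((real N + a + 2) / (a + 1)) * L2w_norm (a + 1) q)\<^sup>2"
    using orth_weight_norm[OF assms] a by (simp add: power_mult_distrib field_simps)
qed (use a in simp)

text \<open>Multiplication by \<open>rho\<close> raises the degree by two, so the projection is orthogonal to
  all but its two top degrees.\<close>

lemma Proj_weight_bound:
  assumes a: "-1 < a" and w: "w \<in> L2w a" and o: "orth a n w"
  shows "L2w_norm a (Proj (a + 1) n w) \<le> 2 * sqrt ((real n + a + 2) / (a + 1)) * L2w_norm a w"
proof -
  have a1: "-1 < a + 1" using a by simp
  have w1: "w \<in> L2w (a + 1)" by (rule L2w_mono[OF w]) simp
  define q where "q = Proj (a + 1) n w"
  have q: "q \<in> polys n" unfolding q_def by (rule Proj_polys[OF a1 w1])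
  note qL = polys_L2w[OF a1 q]
  \<comment> \<open>Relative to exponent \<open>a + 1\<close>, \<open>s\<close> carries degree
    \<open>n - 1\<close> and \<open>t\<close> degree \<open>n\<close>; the factor 2 in the bound
    counts these two parts. For \<open>n = 0\<close> the truncated \<open>n - 1\<close> gives
    \<open>s = q\<close> and \<open>t = 0\<close>.\<close>
  define s where "s = Proj (a + 1) (n - 1) q"
  have s: "s \<in> polys (n - 1)" unfolding s_def by (rule Proj_polys[OF a1 qL])
  define t where "t x = q x - s x" for x
  have t: "t \<in> polys n" unfolding t_def by (intro polys_diff q polys_mono[OF s]) simp
  have to: "orth (a + 1) (n - 1) t" unfolding t_def s_def by (rule Proj_orth[OF a1 qL])
  have qo: "orth (a + 1) M q" if "M + 2 \<le> n" for M
    unfolding orth_def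
  proof
    fix p assume p: "p \<in> polys M"
    have pn: "p \<in> polys n" using polys_mono[OF p] that by simp
    have "pairing (a + 1) (\<lambda>x. w x - q x) p = 0" unfolding q_def by (rule orthD[OF Proj_orth[OF a1 w1] pn])
    then have "pairing (a + 1) q p = pairing (a + 1) w p"
      by (simp add: pairing_diff_left[OF w1 qL polys_L2w[OF a1 p]])
    also have "\<dots> = 0" unfolding pairing_shift
      by (rule orthD[OF o polys_mono[OF polys_rho[OF p] that]])
    finally show "pairing (a + 1) q p = 0" .
  qed
  have so: "orth (a + 1) M s" if "M < n - 1" for M
  proof -
    have "orth (a + 1) M (\<lambda>x. q x - t x)"
      using that by (intro orth_diff a1 qL polys_L2w[OF a1 t] qo orth_mono[OF to]) auto
    then show ?thesis by (simp add: t_def)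
  qed
  let ?S = "sqrt ((real n + a + 2) / (a + 1))"
  have qw: "L2w_norm (a + 1) q \<le> L2w_norm a w"
    using Proj_norm_le[OF a1 w1, of n] L2w_mono(2)[OF w, of "a + 1"] by (simp add: q_def)
  have S0: "0 \<le> ?S" using a by simp
  have "L2w_norm a s \<le> sqrt ((real (n - 1) + a + 2) / (a + 1)) * L2w_norm (a + 1) s"
    by (rule orth_weight_norm_le[OF a s so])
  also have "\<dots> \<le> ?S * L2w_norm a w"
    using a S0 Proj_norm_le[OF a1 qL, of "n - 1"] qw unfolding s_def[symmetric]
    by (intro mult_mono real_sqrt_le_mono divide_right_mono) auto
  finally have 1: "L2w_norm a s \<le> ?S * L2w_norm a w" .
  have "L2w_norm a t \<le> ?S * L2w_norm (a + 1) t"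
    by (rule orth_weight_norm_le[OF a t]) (use orth_mono[OF to] in auto)
  also have "\<dots> \<le> ?S * L2w_norm a w"
    using S0 Proj_diff_norm_le[OF a1 qL, of "n - 1"] qw unfolding s_def[symmetric] t_def
    by (intro mult_left_mono) auto
  finally have 2: "L2w_norm a t \<le> ?S * L2w_norm a w" .
  have "L2w_norm a q \<le> L2w_norm a t + L2w_norm a s"
    using L2w_norm_triangle[OF polys_L2w[OF a t] polys_L2w[OF a s]] by (simp add: t_def)
  then show ?thesis using 1 2 by (simp add: q_def)
qed

section \<open>The Markov inequality\<close>

lemma eigval_le: "-1 < a \<Longrightarrow> eigval a N \<le> (2 * a + 3) * (real N + 1)\<^sup>2"
proof -
  assume a: "-1 < a"
  have "(2 * a + 3) * (real N + 1)\<^sup>2 - eigval a N = (2 * a + 2) * (real N)\<^sup>2 + (2 * a + 4) * real N + (2 * a + 3)"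
    by (simp add: eigval_def power2_eq_square algebra_simps)
  moreover have "0 \<le> (2 * a + 2) * (real N)\<^sup>2" "0 \<le> (2 * a + 4) * real N" using a by simp_all
  ultimately show ?thesis using a by linarith
qed

text \<open>The gradient part of the energy already carries exponent \<open>a + 1\<close>, so a
  derivative costs only one power of the degree when the exponent rises with it.\<close>

lemma partial_norm_le:
  assumes a: "-1 < a" and p: "p \<in> polys N"
  shows "L2w_norm (a + 1) (partial j p) \<le> sqrt (2 * a + 3) * (real N + 1) * L2w_norm a p"
proof (rule L2w_norm_leI)
  have "(L2w_norm (a + 1) (partial j p))\<^sup>2 \<le> energy a p"
    using exhaust_2[of j] by (auto simp: energy_def)
  also have "\<dots> \<le> (2 * a + 3) * (real N + 1)\<^sup>2 * (L2w_norm a p)\<^sup>2"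
    using energy_le[OF a p] eigval_le[OF a, of N] by (meson mult_right_mono order_trans zero_le_power2)
  finally show "(L2w_norm (a + 1) (partial j p))\<^sup>2 \<le> (sqrt (2 * a + 3) * (real N + 1) * L2w_norm a p)\<^sup>2"
    using a by (simp add: power_mult_distrib)
qed (use a in simp)

text \<open>The constant of the quadratic inequality in \<open>inverse_weight_bound\<close>:
  \<open>a + 2\<close> from the norm term of \<open>weight_identity\<close>,
  \<open>2 * sqrt (2 * a + 5)\<close> from two coordinates with \<open>partial_norm_le\<close> at
  exponent \<open>a + 1\<close>.\<close>

definition weight_const :: "real \<Rightarrow> real" where
  "weight_const a = (a + 2 + 2 * sqrt (2 * a + 5)) / (a + 1)"

lemma weight_const_pos: "-1 < a \<Longrightarrow> 0 < weight_const a"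
  unfolding weight_const_def using add_pos_nonneg[of "a + 2" "2 * sqrt (2 * a + 5)"] by simp

text \<open>For general \<open>q\<close> the Euler term is estimated: Cauchy-Schwarz puts exponent
  \<open>a + 2\<close> on the derivative and \<open>a\<close> on \<open>q\<close>, and
  \<open>partial_norm_le\<close> bounds the derivative by \<open>q\<close> with exponent
  \<open>a + 1\<close>. One factor \<open>L2w_norm a q\<close> then cancels, leaving a full power of
  the degree instead of the half power for a pure degree.\<close>

lemma inverse_weight_bound:
  assumes a: "-1 < a" and q: "q \<in> polys N"
  shows "L2w_norm a q \<le> weight_const a * (real N + 1) * L2w_norm (a + 1) q"
proof (cases "L2w_norm a q = 0")
  case True
  then show ?thesis using weight_const_pos[OF a] by simp
next
  case False
  define X where "X = L2w_norm a q"
  define Y where "Y = L2w_norm (a + 1) q"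
  have X: "0 < X" using False L2w_norm_nonneg[of a q] unfolding X_def by linarith
  have Y: "0 \<le> Y" "Y \<le> X" using L2w_mono(2)[OF polys_L2w[OF a q], of "a + 1"] by (simp_all add: X_def Y_def)
  define R where "R = sqrt (2 * a + 5) * (real N + 1)"
  have a1: "-1 < a + 1" and a2: "-1 < a + 2" using a by simp_all
  have c: "(\<lambda>x. cnj (q x)) \<in> polys N" by (rule polys_cnj[OF q])
  have T: "norm (pairing (a + 1) (\<lambda>x. of_real (x $ j) * partial j q x) (\<lambda>x. cnj (q x))) \<le> R * Y * X" for j
  proof -
    have "pairing (a + 1) (\<lambda>x. of_real (x $ j) * partial j q x) (\<lambda>x. cnj (q x))
        = pairing (a + 1) (partial j q) (\<lambda>x. of_real (x $ j) * cnj (q x))"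
      by (simp add: pairing_def mult_ac)
    moreover have "norm \<dots> \<le> L2w_norm (a + 2) (partial j q) * L2w_norm a (\<lambda>x. of_real (x $ j) * cnj (q x))"
      by (rule pairing_mixed_bound[OF polys_L2w[OF a2 partial_polys[OF q]] polys_L2w[OF a polys_mult_coord[OF c]]]) simp
    moreover have "L2w_norm (a + 2) (partial j q) \<le> R * Y"
      using partial_norm_le[OF a1 q, of j] by (simp add: R_def Y_def add.assoc)
    moreover have "L2w_norm a (\<lambda>x. of_real (x $ j) * cnj (q x)) \<le> X"
      using L2w_coord_mult(2)[OF polys_L2w[OF a c], of j] by (simp add: X_def L2w_norm_cnj)
    ultimately show ?thesis
      by (smt (verit) L2w_norm_nonneg mult_mono)
  qed
  have "pairing (a + 1) (euler q) (\<lambda>x. cnj (q x)) = pairing (a + 1) (\<lambda>x. of_real (x $ 1) * partial 1 q x) (\<lambda>x. cnj (q x))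
     + pairing (a + 1) (\<lambda>x. of_real (x $ 2) * partial 2 q x) (\<lambda>x. cnj (q x))"
    unfolding euler_def[abs_def] using polys_L2w[OF a1] coord_partial_polys[OF q] c by (intro pairing_add_left) blast+
  then have "norm (pairing (a + 1) (euler q) (\<lambda>x. cnj (q x))) \<le> 2 * (R * Y * X)"
    using T[of 1] T[of 2] norm_triangle_ineq by (smt (verit))
  then have "Re (pairing (a + 1) (euler q) (\<lambda>x. cnj (q x))) \<le> 2 * (R * Y * X)"
    using complex_Re_le_cmod order_trans by blast
  then have "(a + 1) * X\<^sup>2 \<le> (a + 2) * Y\<^sup>2 + 2 * (R * Y * X)"
    using weight_identity[OF a q] by (simp add: X_def Y_def)
  also have "(a + 2) * Y\<^sup>2 \<le> (a + 2) * (real N + 1) * Y * X"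
  proof -
    have "(a + 2) * Y\<^sup>2 \<le> (a + 2) * (Y * X)"
      using a Y by (intro mult_left_mono) (auto simp: power2_eq_square mult_left_mono)
    also have "\<dots> \<le> (a + 2) * (Y * X) * (real N + 1)"
      using a X Y mult_left_mono[of 1 "real N + 1" "(a + 2) * (Y * X)"] by simp
    finally show ?thesis by (simp add: mult_ac)
  qed
  finally have "X * ((a + 1) * X) \<le> X * ((a + 2 + 2 * sqrt (2 * a + 5)) * (real N + 1) * Y)"
    by (simp add: R_def power2_eq_square algebra_simps)
  then have "(a + 1) * X \<le> (a + 2 + 2 * sqrt (2 * a + 5)) * (real N + 1) * Y"
    using X by (simp only: mult_le_cancel_left_pos)
  then show ?thesis using a by (simp add: X_def Y_def weight_const_def field_simps)
qed

definition markov_const :: "real \<Rightarrow> real" where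
  "markov_const a = weight_const a * sqrt (2 * a + 3)"

text \<open>One power of the degree is paid for differentiating into exponent \<open>a + 1\<close>
  and one for returning to \<open>a\<close>.\<close>

lemma markov_inequality:
  assumes a: "-1 < a" and p: "p \<in> polys N"
  shows "L2w_norm a (partial j p) \<le> markov_const a * (real N + 1)\<^sup>2 * L2w_norm a p"
proof -
  have "L2w_norm a (partial j p) \<le> weight_const a * (real N + 1) * L2w_norm (a + 1) (partial j p)"
    by (rule inverse_weight_bound[OF a partial_polys'[OF p]])
  also have "\<dots> \<le> weight_const a * (real N + 1) * (sqrt (2 * a + 3) * (real N + 1) * L2w_norm a p)"
    using weight_const_pos[OF a] by (intro mult_left_mono partial_norm_le[OF a p]) auto
  finally show ?thesis by (simp add: markov_const_def power2_eq_square mult_ac)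
qed

section \<open>Weak derivatives of sums and of products with coordinates\<close>

lemma smooth_differentiable: "smooth f \<Longrightarrow> f differentiable (at x)"
proof -
  assume "smooth f"
  then have "foldr partial [] f differentiable_on UNIV" by (auto simp only: smooth_def)
  then show ?thesis by (simp add: differentiable_on_def)
qed

lemma smooth_partial: "smooth f \<Longrightarrow> smooth (partial i f)"
proof -
  assume f: "smooth f"
  have "foldr partial ds (partial i f) = foldr partial (ds @ [i]) f" for ds by simp
  then show ?thesis using f unfolding smooth_def by metis
qed

lemma smooth_foldr: "smooth f \<Longrightarrow> smooth (foldr partial ds f)"
  by (induction ds) (simp_all add: smooth_partial)

lemma foldr_partial_add:
  assumes "smooth f" "smooth g"
  shows "foldr partial ds (\<lambda>x. f x + g x) = (\<lambda>x. foldr partial ds f x + foldr partial ds g x)"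
proof (induction ds)
  case (Cons i ds)
  show ?case
    by (simp add: Cons, intro ext partial_add smooth_differentiable smooth_foldr assms)
qed simp

lemma smooth_add: "smooth f \<Longrightarrow> smooth g \<Longrightarrow> smooth (\<lambda>x. f x + g x)"
  using smooth_differentiable[OF smooth_foldr]
  by (simp add: smooth_def[of "\<lambda>x. f x + g x"] foldr_partial_add differentiable_on_def)

lemma partial_coord_mult_smooth:
  "smooth f \<Longrightarrow> partial i (\<lambda>x. of_real (x $ j) * f x) x = of_real (x $ j) * partial i f x + (if i = j then f x else 0)"
  by (simp add: partial_mult polys_differentiable[OF polys_coord] smooth_differentiable partial_coord)

lemma smooth_zero: "smooth (\<lambda>x. 0)"
proof -
  have "foldr partial ds (\<lambda>x. 0) = (\<lambda>x. 0)" for ds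
    by (induction ds) (simp_all add: partial_const[abs_def])
  then show ?thesis by (simp add: smooth_def)
qed

text \<open>Every iterated derivative keeps the form \<open>x_j * g + h\<close> with smooth
  \<open>g\<close> and \<open>h\<close>; this invariant replaces a Leibniz formula for lists of
  derivatives.\<close>

lemma smooth_coord_mult:
  assumes "smooth f"
  shows "smooth (\<lambda>x. of_real (x $ j) * f x)"
proof -
  have "\<exists>g h. smooth g \<and> smooth h \<and> foldr partial ds (\<lambda>x. of_real (x $ j) * f x) = (\<lambda>x. of_real (x $ j) * g x + h x)" for ds
  proof (induction ds)
    case Nil
    show ?case by (rule exI[of _ f], rule exI[of _ "\<lambda>x. 0"]) (simp add: assms smooth_zero)
  next
    case (Cons i ds)
    then obtain g h where gh: "smooth g" "smooth h"
      "foldr partial ds (\<lambda>x. of_real (x $ j) * f x) = (\<lambda>x. of_real (x $ j) * g x + h x)" by blast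
    let ?h = "\<lambda>x. (if i = j then g x else 0) + partial i h x"
    have "partial i (\<lambda>x. of_real (x $ j) * g x + h x) x = of_real (x $ j) * partial i g x + ?h x" for x
      using gh by (subst partial_add) (simp_all add: partial_coord_mult_smooth smooth_differentiable
          differentiable_mult polys_differentiable[OF polys_coord])
    then have "foldr partial (i # ds) (\<lambda>x. of_real (x $ j) * f x) = (\<lambda>x. of_real (x $ j) * partial i g x + ?h x)"
      unfolding foldr.simps o_apply gh(3) by (rule ext)
    moreover have "smooth ?h"
      using gh by (cases "i = j") (auto intro!: smooth_add smooth_partial)
    ultimately show ?case using smooth_partial[OF gh(1), of i] by blast
  qed
  note cl = this
  have "foldr partial ds (\<lambda>x. of_real (x $ j) * f x) differentiable_on UNIV" for ds
  proof -
    obtain g h where gh: "smooth g" "smooth h" and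
      e: "foldr partial ds (\<lambda>x. of_real (x $ j) * f x) = (\<lambda>x. of_real (x $ j) * g x + h x)"
      using cl[of ds] by blast
    have "(\<lambda>x. of_real (x $ j) * g x + h x) differentiable (at x)" for x
      by (intro differentiable_add differentiable_mult polys_differentiable[OF polys_coord] smooth_differentiable gh)
    then show ?thesis unfolding e differentiable_on_def by (simp add: differentiable_at_withinI)
  qed
  then show ?thesis by (simp add: smooth_def)
qed

lemma test_function_coord_mult: "test_function \<phi> \<Longrightarrow> test_function (\<lambda>x. of_real (x $ j) * \<phi> x)"
proof -
  assume t: "test_function \<phi>"
  have "closure {x. of_real (x $ j) * \<phi> x \<noteq> 0} \<subseteq> closure {x. \<phi> x \<noteq> 0}" by (rule closure_mono) auto
  then show ?thesis using t smooth_coord_mult by (auto simp: test_function_def)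
qed

lemma weak_partial_add:
  assumes a: "-1 < a" and L: "u \<in> L2w a" "w \<in> L2w a" "u' \<in> L2w a" "w' \<in> L2w a"
    and d: "weak_partial j u w" "weak_partial j u' w'"
  shows "weak_partial j (\<lambda>x. u x + u' x) (\<lambda>x. w x + w' x)"
  unfolding weak_partial_def
proof (intro conjI allI impI)
  show "locally_integrable (\<lambda>x. u x + u' x)" "locally_integrable (\<lambda>x. w x + w' x)"
    by (intro L2w_locally_integrable[OF a] L2w_add L)+
  fix \<phi> assume t: "test_function \<phi>"
  note I = locally_integrable_test[OF L2w_locally_integrable[OF a]]
  have "(LINT x|disk_measure. u x * partial j \<phi> x + u' x * partial j \<phi> x) = - (LINT x|disk_measure. w x * \<phi> x + w' x * \<phi> x)"
    using d t by (simp add: I L test_function_partial weak_partial_def)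
  then show "(LINT x|disk_measure. (u x + u' x) * partial j \<phi> x) = - (LINT x|disk_measure. (w x + w' x) * \<phi> x)"
    by (simp add: distrib_right)
qed

lemma weak_partial_cmult:
  assumes a: "-1 < a" and L: "u \<in> L2w a" "w \<in> L2w a" and d: "weak_partial j u w"
  shows "weak_partial j (\<lambda>x. c * u x) (\<lambda>x. c * w x)"
  unfolding weak_partial_def
proof (intro conjI allI impI)
  show "locally_integrable (\<lambda>x. c * u x)" "locally_integrable (\<lambda>x. c * w x)"
    by (intro L2w_locally_integrable[OF a] L2w_cmult L)+
  fix \<phi> assume t: "test_function \<phi>"
  then show "(LINT x|disk_measure. (c * u x) * partial j \<phi> x) = - (LINT x|disk_measure. (c * w x) * \<phi> x)"
    using d by (simp add: weak_partial_def mult.assoc)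
qed

text \<open>Move the coordinate onto the test function; the product rule then produces the extra
  \<open>u\<close>. The angular derivative has coordinate coefficients, and its own Sobolev bound
  enters the induction for the \<open>L2\<close> error.\<close>

lemma weak_partial_coord_mult:
  assumes a: "-1 < a" and L: "u \<in> L2w a" "w \<in> L2w a" and d: "weak_partial j u w"
  shows "weak_partial j (\<lambda>x. of_real (x $ i) * u x) (\<lambda>x. of_real (x $ i) * w x + (if j = i then u x else 0))"
  unfolding weak_partial_def
proof (intro conjI allI impI)
  have z: "(\<lambda>x. if j = i then u x else 0) \<in> L2w a" using L(1) polys_L2w[OF a polys_zero] by (cases "j = i") auto
  then show "locally_integrable (\<lambda>x. of_real (x $ i) * u x)"
     "locally_integrable (\<lambda>x. of_real (x $ i) * w x + (if j = i then u x else 0))"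
    by (intro L2w_locally_integrable[OF a] L2w_add L2w_coord_mult L)+
  fix \<phi> assume t: "test_function \<phi>"
  have tx: "test_function (\<lambda>x. of_real (x $ i) * \<phi> x)" by (rule test_function_coord_mult[OF t])
  note I = locally_integrable_test[OF L2w_locally_integrable[OF a]]
  have s: "smooth \<phi>" using t by (simp add: test_function_def)
  have "(LINT x|disk_measure. of_real (x $ i) * u x * partial j \<phi> x)
      = (LINT x|disk_measure. u x * partial j (\<lambda>x. of_real (x $ i) * \<phi> x) x - (if j = i then u x else 0) * \<phi> x)"
    unfolding partial_coord_mult_smooth[OF s] by (cases "j = i") (simp_all add: algebra_simps)
  also have "\<dots> = (LINT x|disk_measure. u x * partial j (\<lambda>x. of_real (x $ i) * \<phi> x) x)
      - (LINT x|disk_measure. (if j = i then u x else 0) * \<phi> x)"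
    by (intro Bochner_Integration.integral_diff I L(1) z t test_function_partial tx)
  also have "(LINT x|disk_measure. u x * partial j (\<lambda>x. of_real (x $ i) * \<phi> x) x) = - (LINT x|disk_measure. w x * (of_real (x $ i) * \<phi> x))"
    using d tx by (simp add: weak_partial_def)
  also have "- (LINT x|disk_measure. w x * (of_real (x $ i) * \<phi> x)) - (LINT x|disk_measure. (if j = i then u x else 0) * \<phi> x)
      = - (LINT x|disk_measure. w x * (of_real (x $ i) * \<phi> x) + (if j = i then u x else 0) * \<phi> x)"
    by (subst Bochner_Integration.integral_add[OF I[OF L(2) tx] I[OF z t]]) simp
  finally show "(LINT x|disk_measure. of_real (x $ i) * u x * partial j \<phi> x)
      = - (LINT x|disk_measure. (of_real (x $ i) * w x + (if j = i then u x else 0)) * \<phi> x)"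
    by (simp add: algebra_simps)
qed

section \<open>Sobolev bounds through chains of first-order weak derivatives\<close>

text \<open>One bound \<open>K\<close> for the function and for suitable chains of up to
  \<open>l\<close> weak derivatives in every order of directions. The recursion on first derivatives
  keeps multi-indices out of the inductions, and no representative of a weak derivative is
  fixed.\<close>

primrec sobolev_bounded :: "nat \<Rightarrow> real \<Rightarrow> (real ^ 2 \<Rightarrow> complex) \<Rightarrow> real \<Rightarrow> bool" where
  "sobolev_bounded 0 a u K \<longleftrightarrow> u \<in> L2w a \<and> L2w_norm a u \<le> K"
| "sobolev_bounded (Suc l) a u K \<longleftrightarrow> u \<in> L2w a \<and> L2w_norm a u \<le> K \<and>
     (\<forall>j. \<exists>w. weak_partial j u w \<and> sobolev_bounded l a w K)"

lemma sobolev_bounded_L2w: "sobolev_bounded l a u K \<Longrightarrow> u \<in> L2w a"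
  by (cases l) auto

lemma sobolev_bounded_norm: "sobolev_bounded l a u K \<Longrightarrow> L2w_norm a u \<le> K"
  by (cases l) auto

lemma sobolev_bounded_nonneg: "sobolev_bounded l a u K \<Longrightarrow> 0 \<le> K"
  using sobolev_bounded_norm L2w_norm_nonneg order_trans by blast

lemma sobolev_bounded_mono: "sobolev_bounded l a u K \<Longrightarrow> K \<le> K' \<Longrightarrow> sobolev_bounded l a u K'"
proof (induction l arbitrary: u)
  case (Suc l)
  then show ?case by simp (meson order_trans)
qed auto

lemma sobolev_bounded_le: "sobolev_bounded l a u K \<Longrightarrow> k \<le> l \<Longrightarrow> sobolev_bounded k a u K"
proof (induction l arbitrary: u k)
  case (Suc l)
  show ?case
  proof (cases k)
    case 0
    then show ?thesis using Suc.prems by simp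
  next
    case (Suc k')
    then show ?thesis using Suc.prems Suc.IH[of _ k'] by simp meson
  qed
qed simp

lemma sobolev_bounded_weight: "sobolev_bounded l a u K \<Longrightarrow> sobolev_bounded l (a + 1) u K"
proof (induction l arbitrary: u)
  case 0
  then show ?case using L2w_mono[of u a "a + 1"] by auto
next
  case (Suc l)
  then have "u \<in> L2w (a + 1)" "L2w_norm (a + 1) u \<le> K" using L2w_mono[of u a "a + 1"] by auto
  then show ?case using Suc by simp meson
qed

lemma sobolev_bounded_add:
  assumes a: "-1 < a"
  shows "sobolev_bounded l a u K \<Longrightarrow> sobolev_bounded l a v K' \<Longrightarrow> sobolev_bounded l a (\<lambda>x. u x + v x) (K + K')"
proof (induction l arbitrary: u v)
  case 0
  then show ?case using L2w_add[of u a v] L2w_norm_triangle[of u a v] by auto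
next
  case (Suc l)
  have u: "u \<in> L2w a" "L2w_norm a u \<le> K" and v: "v \<in> L2w a" "L2w_norm a v \<le> K'" using Suc.prems by auto
  have "\<exists>w. weak_partial j (\<lambda>x. u x + v x) w \<and> sobolev_bounded l a w (K + K')" for j
  proof -
    obtain w where w: "weak_partial j u w" "sobolev_bounded l a w K" using Suc.prems(1) by auto
    obtain w' where w': "weak_partial j v w'" "sobolev_bounded l a w' K'" using Suc.prems(2) by auto
    have "weak_partial j (\<lambda>x. u x + v x) (\<lambda>x. w x + w' x)"
      by (rule weak_partial_add[OF a u(1) sobolev_bounded_L2w[OF w(2)] v(1) sobolev_bounded_L2w[OF w'(2)] w(1) w'(1)])
    then show ?thesis using Suc.IH[OF w(2) w'(2)] by blast
  qed
  then show ?case using L2w_add[OF u(1) v(1)] L2w_norm_triangle[OF u(1) v(1)] u(2) v(2) by auto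
qed

lemma sobolev_bounded_cmult:
  assumes a: "-1 < a"
  shows "sobolev_bounded l a u K \<Longrightarrow> sobolev_bounded l a (\<lambda>x. c * u x) (norm c * K)"
proof (induction l arbitrary: u)
  case 0
  then show ?case using L2w_cmult[of u a c] mult_left_mono[of "L2w_norm a u" K "norm c"] by auto
next
  case (Suc l)
  have u: "u \<in> L2w a" "L2w_norm a u \<le> K" using Suc.prems by auto
  have "\<exists>w. weak_partial j (\<lambda>x. c * u x) w \<and> sobolev_bounded l a w (norm c * K)" for j
  proof -
    obtain w where w: "weak_partial j u w" "sobolev_bounded l a w K" using Suc.prems by auto
    have "weak_partial j (\<lambda>x. c * u x) (\<lambda>x. c * w x)"
      by (rule weak_partial_cmult[OF a u(1) sobolev_bounded_L2w[OF w(2)] w(1)])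
    then show ?thesis using Suc.IH[OF w(2)] by blast
  qed
  moreover have "L2w_norm a (\<lambda>x. c * u x) \<le> norm c * K"
    using L2w_cmult(2)[OF u(1), of c] mult_left_mono[OF u(2), of "norm c"] by simp
  ultimately show ?case using L2w_cmult(1)[OF u(1)] by auto
qed

lemma sobolev_bounded_diff:
  assumes "-1 < a" "sobolev_bounded l a u K" "sobolev_bounded l a v K'"
  shows "sobolev_bounded l a (\<lambda>x. u x - v x) (K + K')"
  using sobolev_bounded_add[OF assms(1,2) sobolev_bounded_cmult[OF assms(1,3), of "-1"]] by simp

text \<open>Each differentiation that hits the coordinate adds one copy of the undifferentiated
  factor, so the constant grows by 1 per order.\<close>

lemma sobolev_bounded_coord_mult:
  assumes a: "-1 < a"
  shows "sobolev_bounded l a u K \<Longrightarrow> sobolev_bounded l a (\<lambda>x. of_real (x $ i) * u x) ((real l + 1) * K)"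
proof (induction l arbitrary: u)
  case 0
  then show ?case using L2w_coord_mult[of u a i] by auto
next
  case (Suc l)
  have K: "0 \<le> K" by (rule sobolev_bounded_nonneg[OF Suc.prems])
  have u: "u \<in> L2w a" "L2w_norm a u \<le> K" using Suc.prems by auto
  have "\<exists>w. weak_partial j (\<lambda>x. of_real (x $ i) * u x) w \<and> sobolev_bounded l a w ((real (Suc l) + 1) * K)" for j
  proof -
    obtain w where w: "weak_partial j u w" "sobolev_bounded l a w K" using Suc.prems by auto
    have wd: "weak_partial j (\<lambda>x. of_real (x $ i) * u x) (\<lambda>x. of_real (x $ i) * w x + (if j = i then u x else 0))"
      by (rule weak_partial_coord_mult[OF a u(1) sobolev_bounded_L2w[OF w(2)] w(1)])
    have ul: "sobolev_bounded l a u K" by (rule sobolev_bounded_le[OF Suc.prems]) simp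
    have "sobolev_bounded l a (\<lambda>x. if j = i then u x else 0) K"
      using ul sobolev_bounded_mono[OF sobolev_bounded_cmult[OF a ul, of 0], of K] K by (cases "j = i") auto
    from sobolev_bounded_add[OF a Suc.IH[OF w(2)] this]
    have "sobolev_bounded l a (\<lambda>x. of_real (x $ i) * w x + (if j = i then u x else 0)) ((real (Suc l) + 1) * K)"
      by (rule sobolev_bounded_mono) (simp add: algebra_simps)
    then show ?thesis using wd by blast
  qed
  moreover have "L2w_norm a (\<lambda>x. of_real (x $ i) * u x) \<le> (real (Suc l) + 1) * K"
  proof -
    have "K \<le> (real (Suc l) + 1) * K" using K by (simp add: algebra_simps)
    then show ?thesis using L2w_coord_mult(2)[OF u(1), of i] u(2) by linarith
  qed
  ultimately show ?case using L2w_coord_mult(1)[OF u(1)] by auto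
qed

text \<open>Iterates the Markov inequality. The \<open>max 1\<close> lets the constant for the
  highest order dominate all lower ones, as a single bound is required.\<close>

lemma sobolev_bounded_polys:
  assumes a: "-1 < a"
  shows "p \<in> polys n \<Longrightarrow> sobolev_bounded r a p ((max 1 (markov_const a) * (real n + 1)\<^sup>2) ^ r * L2w_norm a p)"
proof (induction r arbitrary: p)
  case 0
  then show ?case by (simp add: polys_L2w[OF a])
next
  case (Suc r)
  let ?m = "max 1 (markov_const a) * (real n + 1)\<^sup>2"
  have m1: "1 \<le> ?m" using mult_mono[of 1 "max 1 (markov_const a)" 1 "(real n + 1)\<^sup>2"] by (simp add: one_le_power)
  have "weak_partial j p (partial j p) \<and> sobolev_bounded r a (partial j p) (?m ^ Suc r * L2w_norm a p)" for j
  proof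
    show "weak_partial j p (partial j p)" by (rule weak_partial_polys[OF Suc.prems])
    have "L2w_norm a (partial j p) \<le> markov_const a * (real n + 1)\<^sup>2 * L2w_norm a p"
      by (rule markov_inequality[OF a Suc.prems])
    also have "\<dots> \<le> ?m * L2w_norm a p" by (intro mult_right_mono) auto
    finally have "?m ^ r * L2w_norm a (partial j p) \<le> ?m ^ Suc r * L2w_norm a p"
      using m1 mult_left_mono[of "L2w_norm a (partial j p)" "?m * L2w_norm a p" "?m ^ r"] by (simp add: mult_ac)
    then show "sobolev_bounded r a (partial j p) (?m ^ Suc r * L2w_norm a p)"
      by (rule sobolev_bounded_mono[OF Suc.IH[OF partial_polys'[OF Suc.prems]]])
  qed
  moreover have "L2w_norm a p \<le> ?m ^ Suc r * L2w_norm a p"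
    using mult_right_mono[OF one_le_power[OF m1, of "Suc r"] L2w_norm_nonneg[of a p]] by simp
  ultimately show ?case using polys_L2w[OF a Suc.prems] by auto
qed

section \<open>Density of polynomials\<close>

lemma L2w_norm_tendsto_0:
  assumes v: "\<And>n::nat. v n \<in> borel_measurable disk_measure"
    and w: "integrable disk_measure (\<lambda>x. (W x)\<^sup>2 * rho x powr a)"
    and bnd: "\<And>n x. x \<in> unit_disk \<Longrightarrow> norm (v n x) \<le> W x"
    and lim: "AE x in disk_measure. (\<lambda>n. v n x) \<longlonglongrightarrow> 0"
  shows "(\<lambda>n. L2w_norm a (v n)) \<longlonglongrightarrow> 0"
proof -
  have "(\<lambda>n. LINT x|disk_measure. (norm (v n x))\<^sup>2 * rho x powr a) \<longlonglongrightarrow> (LINT x|disk_measure. 0)"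
  proof (rule integral_dominated_convergence[OF _ _ w])
    show "(\<lambda>x. (norm (v n x))\<^sup>2 * rho x powr a) \<in> borel_measurable disk_measure" for n
      by (rule weighted_square_measurable[OF v])
    show "AE x in disk_measure. (\<lambda>n. (norm (v n x))\<^sup>2 * rho x powr a) \<longlonglongrightarrow> 0"
      using lim by eventually_elim (auto intro!: tendsto_eq_intros)
    show "AE x in disk_measure. norm ((norm (v n x))\<^sup>2 * rho x powr a) \<le> (W x)\<^sup>2 * rho x powr a" for n
      using bnd by (intro AE_disk_measureI) (auto simp: abs_mult intro!: mult_right_mono power_mono)
  qed simp
  from tendsto_real_sqrt[OF this] show ?thesis by (simp add: L2w_norm_def)
qed

text \<open>Truncating the values of \<open>u\<close> gives a bounded function close to
  \<open>u\<close>, and \<open>polys_approx_AE\<close> approximates that by uniformly bounded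
  polynomials.\<close>

lemma polys_dense:
  assumes a: "-1 < a" and u: "u \<in> L2w a" and e: "0 < e"
  shows "\<exists>N. \<exists>p\<in>polys N. L2w_norm a (\<lambda>x. u x - p x) < e"
proof -
  define v where "v M x = (if norm (u x) \<le> real M then u x else 0)" for M :: nat and x
  have um [measurable]: "u \<in> borel_measurable disk_measure" by (rule L2w_measurable[OF u])
  have vm: "v M \<in> borel_measurable disk_measure" for M unfolding v_def by measurable
  have vL: "v M \<in> L2w a" for M
    using L2w_bound(1)[OF vm u, of 1 M] by (simp add: v_def)
  have "(\<lambda>M. L2w_norm a (\<lambda>x. u x - v M x)) \<longlonglongrightarrow> 0"
  proof (rule L2w_norm_tendsto_0[OF _ L2w_integrable[OF u]])
    show "(\<lambda>x. u x - v M x) \<in> borel_measurable disk_measure" for M using vm um by simp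
    show "norm (u x - v M x) \<le> norm (u x)" for M x by (simp add: v_def)
    show "AE x in disk_measure. (\<lambda>M. u x - v M x) \<longlonglongrightarrow> 0"
    proof (intro AE_disk_measureI tendsto_eventually)
      fix x
      obtain M0 :: nat where "norm (u x) \<le> real M0" using real_arch_simple by blast
      then show "\<forall>\<^sub>F M in sequentially. u x - v M x = 0"
        by (intro eventually_sequentiallyI[of M0]) (auto simp: v_def)
    qed
  qed
  then have "\<forall>\<^sub>F M in sequentially. L2w_norm a (\<lambda>x. u x - v M x) < e / 2"
    using e by (intro order_tendstoD(2)) auto
  then obtain M where M: "L2w_norm a (\<lambda>x. u x - v M x) < e / 2" by (auto simp: eventually_sequentially)
  have vb: "norm (v M x) \<le> real M" for x by (simp add: v_def)
  obtain p where p: "\<And>n::nat. \<exists>N. p n \<in> polys N" "\<And>n x. x \<in> unit_disk \<Longrightarrow> norm (p n x) \<le> real M + 1"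
    "AE x in disk_measure. (\<lambda>n. p n x) \<longlonglongrightarrow> v M x"
    by (rule polys_approx_AE[OF vm, of "real M"]) (use vb in auto)
  have pm: "p n \<in> borel_measurable disk_measure" for n using p(1) polys_measurable by blast
  have "(\<lambda>n. L2w_norm a (\<lambda>x. v M x - p n x)) \<longlonglongrightarrow> 0"
  proof (rule L2w_norm_tendsto_0[where W = "\<lambda>_. 2 * real M + 1"])
    show "(\<lambda>x. v M x - p n x) \<in> borel_measurable disk_measure" for n using vm pm by simp
    show "integrable disk_measure (\<lambda>x. (2 * real M + 1)\<^sup>2 * rho x powr a)" using rho_powr_integrable[OF a] by simp
    show "norm (v M x - p n x) \<le> 2 * real M + 1" if "x \<in> unit_disk" for n x
      using norm_triangle_ineq4[of "v M x" "p n x"] vb[of x] p(2)[OF that, of n] by simp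
    show "AE x in disk_measure. (\<lambda>n. v M x - p n x) \<longlonglongrightarrow> 0"
      using p(3) by eventually_elim (auto intro!: tendsto_eq_intros)
  qed
  then have "\<forall>\<^sub>F n in sequentially. L2w_norm a (\<lambda>x. v M x - p n x) < e / 2"
    using e by (intro order_tendstoD(2)) auto
  then obtain n where n: "L2w_norm a (\<lambda>x. v M x - p n x) < e / 2" by (auto simp: eventually_sequentially)
  obtain N where N: "p n \<in> polys N" using p(1) by blast
  have "L2w_norm a (\<lambda>x. (u x - v M x) + (v M x - p n x)) \<le> L2w_norm a (\<lambda>x. u x - v M x) + L2w_norm a (\<lambda>x. v M x - p n x)"
    by (intro L2w_norm_triangle L2w_diff u vL polys_L2w[OF a N])
  then have "L2w_norm a (\<lambda>x. u x - p n x) < e" using M n by simp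
  then show ?thesis using N by blast
qed

lemma Proj_tendsto:
  assumes a: "-1 < a" and u: "u \<in> L2w a"
  shows "(\<lambda>N. L2w_norm a (\<lambda>x. u x - Proj a N u x)) \<longlonglongrightarrow> 0"
proof (rule LIMSEQ_I)
  fix e :: real assume "0 < e"
  then obtain N p where p: "p \<in> polys N" "L2w_norm a (\<lambda>x. u x - p x) < e" using polys_dense[OF a u] by blast
  have "L2w_norm a (\<lambda>x. u x - Proj a n u x) < e" if "N \<le> n" for n
    using Proj_best[OF a u polys_mono[OF p(1) that]] p(2) by simp
  then show "\<exists>no. \<forall>n\<ge>no. norm (L2w_norm a (\<lambda>x. u x - Proj a n u x) - 0) < e" by auto
qed

section \<open>The projection error\<close>

text \<open>The exponent is generalised because the gradient part uses the induction hypothesis at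
  \<open>a + 1\<close> and the angular part at \<open>a\<close>. Each step gains the square root of
  the lowest surviving eigenvalue, of order \<open>N\<close>.\<close>

lemma L2_projection_error:
  "-1 < a \<Longrightarrow> \<exists>C\<ge>1. \<forall>N u K. sobolev_bounded l a u K \<longrightarrow>
     L2w_norm a (\<lambda>x. u x - Proj a N u x) \<le> C / (real N + 1) ^ l * K"
proof (induction l arbitrary: a)
  case 0
  show ?case
  proof (rule exI[of _ 1], intro conjI allI impI)
    fix N u K assume u: "sobolev_bounded 0 a u K"
    then show "L2w_norm a (\<lambda>x. u x - Proj a N u x) \<le> 1 / (real N + 1) ^ 0 * K"
      using Proj_diff_norm_le[OF 0, of u N] by simp
  qed simp
next
  case (Suc l)
  note a = Suc.prems
  have a1: "-1 < a + 1" using a by simp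
  obtain C1 where C1: "1 \<le> C1" "\<And>N u K. sobolev_bounded l a u K \<Longrightarrow>
     L2w_norm a (\<lambda>x. u x - Proj a N u x) \<le> C1 / (real N + 1) ^ l * K"
    using Suc.IH[OF a] by blast
  obtain C2 where C2: "1 \<le> C2" "\<And>N u K. sobolev_bounded l (a + 1) u K \<Longrightarrow>
     L2w_norm (a + 1) (\<lambda>x. u x - Proj (a + 1) N u x) \<le> C2 / (real N + 1) ^ l * K"
    using Suc.IH[OF a1] by blast
  \<comment> \<open>Two gradient components contribute \<open>C2\<close> each; the angular one
    contributes \<open>C1\<close> times the factor \<open>2 * (l + 1)\<close> in the Sobolev bound
    of \<open>v\<close>. The later \<open>2 ^ l\<close> pays for comparing \<open>N\<close> with
    \<open>N + 1\<close>.\<close>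
  define D where "D = 2 * C2 + 2 * (real l + 1) * C1"
  have D: "1 \<le> D" using C1(1) C2(1) by (simp add: D_def add_increasing2)
  show ?case
  proof (rule exI[of _ "D * 2 ^ l"], intro conjI allI impI)
    show "1 \<le> D * 2 ^ l" using mult_mono[of 1 D 1 "2 ^ l :: real"] D by simp
    fix N u K assume s: "sobolev_bounded (Suc l) a u K"
    then obtain w where w: "\<And>j. weak_partial j u (w j)" "\<And>j. sobolev_bounded l a (w j) K" by simp metis
    have u: "u \<in> L2w a" "L2w_norm a u \<le> K" using s by auto
    have K: "0 \<le> K" by (rule sobolev_bounded_nonneg[OF s])
    have wL: "w j \<in> L2w a" for j by (rule sobolev_bounded_L2w[OF w(2)])
    have wL1: "w j \<in> L2w (a + 1)" for j by (rule L2w_mono(1)[OF wL]) simp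
    show "L2w_norm a (\<lambda>x. u x - Proj a N u x) \<le> D * 2 ^ l / (real N + 1) ^ Suc l * K"
    proof (cases N)
      \<comment> \<open>Degree 0 is separate: \<open>Proj_partial\<close> needs a degree of the form
        \<open>Suc n\<close>, and here the trivial bound by \<open>K\<close> suffices.\<close>
      case 0
      have "K \<le> D * 2 ^ l * K"
        using mult_right_mono[OF \<open>1 \<le> D * 2 ^ l\<close> K] by simp
      then show ?thesis using Proj_diff_norm_le[OF a u(1), of N] u(2) 0 by simp
    next
      case (Suc n)
      define v where "v x = of_real (x $ 1) * w 2 x - of_real (x $ 2) * w 1 x" for x
      have v: "sobolev_bounded l a v ((real l + 1) * K + (real l + 1) * K)"
        unfolding v_def by (intro sobolev_bounded_diff sobolev_bounded_coord_mult a w(2))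
      have vL: "v \<in> L2w a" by (rule sobolev_bounded_L2w[OF v])
      define Q where "Q = D * K / real N ^ l"
      have N: "real N = real n + 1" using Suc by simp
      \<comment> \<open>The energy estimate is for polynomials, so the difference of two projections
        is bounded uniformly in \<open>M\<close>; letting \<open>M\<close> tend to infinity gives
        the error itself by density.\<close>
      have main: "L2w_norm a (\<lambda>x. Proj a M u x - Proj a N u x) \<le> Q / (real N + 1)" if M: "N \<le> M" for M
      proof -
        obtain m where m: "M = Suc m" "n \<le> m" using M Suc by (cases M) auto
        define p where "p = (\<lambda>x. Proj a M u x - Proj a N u x)"
        have PM: "Proj a k u \<in> polys k" for k by (rule Proj_polys[OF a u(1)])
        have p: "p \<in> polys M" unfolding p_def by (intro polys_diff PM polys_mono[OF PM M])
        have "orth a N (\<lambda>x. (u x - Proj a N u x) - (u x - Proj a M u x))"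
          by (intro orth_diff a Proj_diff_L2w u(1) Proj_orth orth_mono[OF Proj_orth[OF a u(1)] M])
        then have o: "orth a N p" by (simp add: p_def)
        have pd: "L2w_norm (a + 1) (partial j p) \<le> C2 / real N ^ l * K" for j
        proof (rule L2w_norm_leI)
          have "partial j p = (\<lambda>x. Proj (a + 1) m (w j) x - Proj (a + 1) n (w j) x)"
            unfolding Proj_partial[OF a u(1) wL w(1)] p_def m(1) Suc
            by (intro ext partial_diff polys_differentiable[OF PM])
          then have "(L2w_norm (a + 1) (partial j p))\<^sup>2 \<le> (L2w_norm (a + 1) (\<lambda>x. w j x - Proj (a + 1) n (w j) x))\<^sup>2"
            using Proj_norm_split[OF a1 wL1[of j] polys_mono[OF Proj_polys[OF a1 wL1[of j]] m(2)]] by simp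
          also have "\<dots> \<le> (C2 / real N ^ l * K)\<^sup>2"
            using C2(2)[OF sobolev_bounded_weight[OF w(2)[of j]], of n] by (intro power_mono) (simp_all add: N)
          finally show "(L2w_norm (a + 1) (partial j p))\<^sup>2 \<le> (C2 / real N ^ l * K)\<^sup>2" .
        qed (use C2(1) K in simp)
        have pa: "L2w_norm a (ang p) \<le> 2 * (real l + 1) * C1 / real N ^ l * K"
        proof (rule L2w_norm_leI)
          have "ang p = (\<lambda>x. ang (Proj a M u) x - ang (Proj a N u) x)"
            unfolding ang_def[abs_def] p_def partial_diff[OF polys_differentiable[OF PM] polys_differentiable[OF PM]]
            by (simp add: fun_eq_iff algebra_simps)
          also have "\<dots> = (\<lambda>x. Proj a M v x - Proj a N v x)"
            unfolding v_def Proj_ang[OF a u(1) wL wL w(1) w(1)] ..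
          finally have "(L2w_norm a (ang p))\<^sup>2 \<le> (L2w_norm a (\<lambda>x. v x - Proj a N v x))\<^sup>2"
            using Proj_norm_split[OF a vL polys_mono[OF Proj_polys[OF a vL] M]] by simp
          also have "\<dots> \<le> (2 * (real l + 1) * C1 / real N ^ l * K)\<^sup>2"
          proof (rule power_mono)
            have "L2w_norm a (\<lambda>x. v x - Proj a N v x) \<le> C1 / (real N + 1) ^ l * ((real l + 1) * K + (real l + 1) * K)"
              by (rule C1(2)[OF v])
            also have "\<dots> \<le> C1 / real N ^ l * ((real l + 1) * K + (real l + 1) * K)"
              using C1(1) K Suc by (intro mult_right_mono divide_left_mono power_mono) auto
            finally show "L2w_norm a (\<lambda>x. v x - Proj a N v x) \<le> 2 * (real l + 1) * C1 / real N ^ l * K"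
              by (simp add: algebra_simps add_divide_distrib)
          qed simp
          finally show "(L2w_norm a (ang p))\<^sup>2 \<le> (2 * (real l + 1) * C1 / real N ^ l * K)\<^sup>2" .
        qed (use C1(1) K in simp)
        have Q: "Q = C2 / real N ^ l * K + C2 / real N ^ l * K + 2 * (real l + 1) * C1 / real N ^ l * K"
          by (simp add: Q_def D_def add_divide_distrib algebra_simps)
        have sq: "x\<^sup>2 + y\<^sup>2 + z\<^sup>2 \<le> (x + y + z)\<^sup>2" if "0 \<le> x" "0 \<le> y" "0 \<le> z" for x y z :: real
          using that by (simp add: power2_eq_square algebra_simps)
        have "energy a p \<le> (C2 / real N ^ l * K)\<^sup>2 + (C2 / real N ^ l * K)\<^sup>2 + (2 * (real l + 1) * C1 / real N ^ l * K)\<^sup>2"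
          unfolding energy_def by (intro add_mono power_mono pd pa L2w_norm_nonneg)
        also have "\<dots> \<le> Q\<^sup>2" unfolding Q using C1(1) C2(1) K by (intro sq) auto
        finally have "eigval a (Suc N) * (L2w_norm a p)\<^sup>2 \<le> Q\<^sup>2" using energy_ge[OF a p o] by linarith
        moreover have "(real N + 1)\<^sup>2 * (L2w_norm a p)\<^sup>2 \<le> eigval a (Suc N) * (L2w_norm a p)\<^sup>2"
          using a by (intro mult_right_mono) (auto simp: eigval_def power2_eq_square intro!: mult_mono)
        ultimately have "((real N + 1) * L2w_norm a p)\<^sup>2 \<le> Q\<^sup>2" by (simp add: power_mult_distrib)
        moreover have "0 \<le> Q" using D K by (simp add: Q_def)
        ultimately have "(real N + 1) * L2w_norm a p \<le> Q" by (rule power2_le_imp_le)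
        then show ?thesis unfolding p_def[symmetric] by (simp add: field_simps)
      qed
      have "L2w_norm a (\<lambda>x. u x - Proj a N u x) \<le> Q / (real N + 1)"
      proof (rule LIMSEQ_le_const)
        show "(\<lambda>M. L2w_norm a (\<lambda>x. u x - Proj a M u x) + Q / (real N + 1)) \<longlonglongrightarrow> Q / (real N + 1)"
          using tendsto_add[OF Proj_tendsto[OF a u(1)] tendsto_const] by simp
        show "\<exists>M0. \<forall>M\<ge>M0. L2w_norm a (\<lambda>x. u x - Proj a N u x) \<le> L2w_norm a (\<lambda>x. u x - Proj a M u x) + Q / (real N + 1)"
        proof (intro exI[of _ N] allI impI)
          fix M assume M: "N \<le> M"
          have "L2w_norm a (\<lambda>x. (u x - Proj a M u x) + (Proj a M u x - Proj a N u x))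
              \<le> L2w_norm a (\<lambda>x. u x - Proj a M u x) + L2w_norm a (\<lambda>x. Proj a M u x - Proj a N u x)"
            by (intro L2w_norm_triangle Proj_diff_L2w[OF a u(1)] L2w_diff Proj_L2w[OF a u(1)])
          then show "L2w_norm a (\<lambda>x. u x - Proj a N u x) \<le> L2w_norm a (\<lambda>x. u x - Proj a M u x) + Q / (real N + 1)"
            using main[OF M] by simp
        qed
      qed
      also have "\<dots> \<le> D * 2 ^ l / (real N + 1) ^ Suc l * K"
      proof -
        have N0: "0 < real N" using Suc by simp
        have "(real N + 1) ^ l \<le> (2 * real N) ^ l" using Suc by (intro power_mono) auto
        then have "1 * (real N + 1) ^ l \<le> 2 ^ l * real N ^ l" by (simp only: power_mult_distrib mult_1)
        then have "1 / real N ^ l \<le> 2 ^ l / (real N + 1) ^ l"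
          using N0 by (subst frac_le_eq) (auto simp: field_simps intro!: divide_nonpos_pos)
        then have "D * K / (real N + 1) * (1 / real N ^ l) \<le> D * K / (real N + 1) * (2 ^ l / (real N + 1) ^ l)"
          using D K by (intro mult_left_mono) auto
        then show ?thesis by (simp add: Q_def mult_ac)
      qed
      finally show ?thesis .
    qed
  qed
qed

text \<open>Order 0 is a case of its own: the general formula would give \<open>- 1/2 - l\<close>
  there, half a power better than \<open>L2_projection_error\<close>.\<close>

definition rate :: "nat \<Rightarrow> nat \<Rightarrow> real" where
  "rate r l = (if r = 0 then - real l else - (1/2) + 2 * real r - real l)"

text \<open>The exponent takes either sign, hence its absolute value in the constant; for a base of
  at least 1, \<open>N + 1 <= 2 * N\<close>.\<close>

lemma powr_shift_le:
  assumes "1 \<le> (N::real)"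
  shows "N powr e \<le> 2 powr \<bar>e\<bar> * (N + 1) powr e"
proof (cases "0 \<le> e")
  case True
  have "N powr e \<le> (N + 1) powr e" using True assms by (intro powr_mono2) auto
  also have "\<dots> \<le> 2 powr \<bar>e\<bar> * (N + 1) powr e"
    using ge_one_powr_ge_zero[of 2 "\<bar>e\<bar>"] by (simp add: mult_le_cancel_right1)
  finally show ?thesis .
next
  case False
  have "(2 * N) powr e \<le> (N + 1) powr e" using False assms by (intro powr_mono2') auto
  then have "2 powr e * N powr e \<le> (N + 1) powr e" using assms by (simp add: powr_mult)
  then have "2 powr (- e) * (2 powr e * N powr e) \<le> 2 powr (- e) * (N + 1) powr e" by (intro mult_left_mono) auto
  then show ?thesis using False by (simp add: mult.assoc[symmetric] flip: powr_add)
qed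

lemma powr_shift_le':
  assumes "1 \<le> (N::real)"
  shows "(N + 1) powr e \<le> 2 powr \<bar>e\<bar> * N powr e"
proof -
  have "(N + 1) powr e * N powr (- e) \<le> 2 powr \<bar>e\<bar>"
  proof -
    have "N powr (- e) \<le> 2 powr \<bar>e\<bar> * (N + 1) powr (- e)" using powr_shift_le[OF assms, of "- e"] by simp
    then have "(N + 1) powr e * N powr (- e) \<le> (N + 1) powr e * (2 powr \<bar>e\<bar> * (N + 1) powr (- e))"
      by (intro mult_left_mono) auto
    also have "\<dots> = 2 powr \<bar>e\<bar>" using assms by (simp add: powr_minus)
    finally show ?thesis .
  qed
  then have "(N + 1) powr e * N powr (- e) * N powr e \<le> 2 powr \<bar>e\<bar> * N powr e" by (intro mult_right_mono) auto
  then show ?thesis using assms by (simp add: mult.assoc flip: powr_add)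
qed

text \<open>Powers of \<open>N + 1\<close> rather than \<open>N\<close> include degree 0, which the
  induction reaches when it passes from \<open>N = Suc n\<close> to \<open>n\<close>.\<close>

lemma projection_error:
  assumes a: "-1 < a"
  shows "r \<le> l \<Longrightarrow> \<exists>C\<ge>1. \<forall>N u K. sobolev_bounded l a u K \<longrightarrow>
     sobolev_bounded r a (\<lambda>x. u x - Proj a N u x) (C * (real N + 1) powr rate r l * K)"
proof (induction r arbitrary: l)
  case 0
  obtain C where C: "1 \<le> C" "\<And>N u K. sobolev_bounded l a u K \<Longrightarrow>
     L2w_norm a (\<lambda>x. u x - Proj a N u x) \<le> C / (real N + 1) ^ l * K"
    using L2_projection_error[OF a] by blast
  have "(real N + 1) powr rate 0 l = 1 / (real N + 1) ^ l" for N
    by (simp add: rate_def powr_minus powr_realpow inverse_eq_divide)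
  then show ?case using C Proj_diff_L2w[OF a sobolev_bounded_L2w]
    by (intro exI[of _ C]) auto
next
  case (Suc r)
  then obtain k where k: "l = Suc k" "r \<le> k" by (cases l) auto
  \<comment> \<open>One constant for both uses: order \<open>Suc k\<close> for the error of
    \<open>u\<close> itself, order \<open>k\<close> for the errors of its derivatives.\<close>
  obtain C0 where C0: "1 \<le> C0" "\<And>N u K l. l = Suc k \<or> l = k \<Longrightarrow> sobolev_bounded l a u K \<Longrightarrow>
     L2w_norm a (\<lambda>x. u x - Proj a N u x) \<le> C0 * (real N + 1) powr (- real l) * K"
  proof -
    obtain B where B: "1 \<le> B" "\<And>N u K. sobolev_bounded k a u K \<Longrightarrow>
       L2w_norm a (\<lambda>x. u x - Proj a N u x) \<le> B / (real N + 1) ^ k * K"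
      using L2_projection_error[OF a] by blast
    obtain B' where B': "1 \<le> B'" "\<And>N u K. sobolev_bounded (Suc k) a u K \<Longrightarrow>
       L2w_norm a (\<lambda>x. u x - Proj a N u x) \<le> B' / (real N + 1) ^ Suc k * K"
      using L2_projection_error[OF a] by blast
    have p: "(real N + 1) powr (- real l) = 1 / (real N + 1) ^ l" for N l
      by (simp add: powr_minus powr_realpow inverse_eq_divide del: of_nat_Suc)
    show thesis
    proof (rule that[of "max B B'"])
      fix N u K l assume l: "l = Suc k \<or> l = k" and s: "sobolev_bounded l a u K"
      have "L2w_norm a (\<lambda>x. u x - Proj a N u x) \<le> (if l = k then B else B') / (real N + 1) ^ l * K"
        using l s B(2) B'(2) by (auto simp del: sobolev_bounded.simps)
      also have "\<dots> \<le> max B B' / (real N + 1) ^ l * K"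
        using sobolev_bounded_nonneg[OF s] by (intro mult_right_mono divide_right_mono) auto
      finally show "L2w_norm a (\<lambda>x. u x - Proj a N u x) \<le> max B B' * (real N + 1) powr (- real l) * K"
        unfolding p by simp
    qed (use B(1) in simp)
  qed
  obtain C1 where C1: "1 \<le> C1" "\<And>N u K. sobolev_bounded k a u K \<Longrightarrow>
     sobolev_bounded r a (\<lambda>x. u x - Proj a N u x) (C1 * (real N + 1) powr rate r k * K)"
    using Suc.IH[OF k(2)] by blast
  define e where "e = rate (Suc r) l"
  \<comment> \<open>The balance of \<open>2 * r\<close> from the Markov inequality,
    \<open>1/2\<close> from the change of weight and \<open>- k\<close> from the \<open>L2\<close>
    error of a derivative; it agrees with \<open>rate\<close> because
    \<open>l = Suc k\<close>.\<close>
  have e: "e = 1/2 + 2 * real r - real k" by (simp add: e_def rate_def k(1))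
  define S where "S = 2 * sqrt ((a + 2) / (a + 1))"
  define m where "m = max 1 (markov_const a)"
  define C where "C = max C0 (2 powr \<bar>e\<bar> * (C1 + m ^ r * S * C0))"
  have S: "0 \<le> S" using a by (simp add: S_def)
  have m: "1 \<le> m" by (simp add: m_def)
  have C: "1 \<le> C" "C0 \<le> C" using C0(1) by (auto simp: C_def)
  show ?case
  proof (rule exI[of _ C], intro conjI allI impI)
    fix N u K assume s: "sobolev_bounded l a u K"
    then have u: "u \<in> L2w a" "L2w_norm a u \<le> K" using k(1) by auto
    have K: "0 \<le> K" by (rule sobolev_bounded_nonneg[OF s])
    obtain w where w: "\<And>j. weak_partial j u (w j)" "\<And>j. sobolev_bounded k a (w j) K" using s k(1) by simp metis
    have wL: "w j \<in> L2w a" for j by (rule sobolev_bounded_L2w[OF w(2)])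
    have P: "Proj a N u \<in> polys N" by (rule Proj_polys[OF a u(1)])
    have N1: "1 \<le> real N + 1" by simp
    have 0: "L2w_norm a (\<lambda>x. u x - Proj a N u x) \<le> C * (real N + 1) powr e * K"
    proof -
      have "L2w_norm a (\<lambda>x. u x - Proj a N u x) \<le> C0 * (real N + 1) powr (- real l) * K"
        using C0(2)[OF _ s] k(1) by blast
      also have "\<dots> \<le> C * (real N + 1) powr e * K"
        using C C0(1) K by (intro mult_right_mono mult_mono powr_mono) (auto simp: e k(1))
      finally show ?thesis .
    qed
    have wd: "weak_partial j (\<lambda>x. u x - Proj a N u x) (\<lambda>x. w j x - partial j (Proj a N u) x)" for j
    proof -
      note PL = polys_L2w[OF a P] polys_L2w[OF a partial_polys[OF P]]
      from weak_partial_add[OF a u(1) wL L2w_cmult(1)[OF PL(1)] L2w_cmult(1)[OF PL(2)] w(1) weak_partial_cmult[OF a PL weak_partial_polys[OF P]], of j "-1"]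
      show ?thesis by simp
    qed
    have "sobolev_bounded r a (\<lambda>x. w j x - partial j (Proj a N u) x) (C * (real N + 1) powr e * K)" for j
    proof (cases N)
      case 0
      then have "partial j (Proj a N u) x = 0" for x using partial_polys_0 P by blast
      moreover have "sobolev_bounded r a (w j) (C * K)"
        using sobolev_bounded_mono[OF sobolev_bounded_le[OF w(2) k(2)]] mult_right_mono[OF C(1) K] by simp
      ultimately show ?thesis using 0 by simp
    next
      case (Suc n)
      define z where "z x = w j x - Proj a n (w j) x" for x
      have z: "z \<in> L2w a" "orth a n z" unfolding z_def
        by (rule Proj_diff_L2w[OF a wL], rule Proj_orth[OF a wL])
      have a1: "-1 < a + 1" using a by simp
      have up: "f \<in> L2w (a + 1)" if "f \<in> L2w a" for f using L2w_mono(1)[OF that, of "a + 1"] by simp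
      define q where "q = Proj (a + 1) n z"
      have q: "q \<in> polys n" unfolding q_def by (rule Proj_polys[OF a1 up[OF z(1)]])
      \<comment> \<open>Projections for exponent \<open>a + 1\<close> fix polynomials of degree
        \<open>n\<close>, so subtracting \<open>Proj a n (w j)\<close> from \<open>w j\<close>
        subtracts the same polynomial from the projection.\<close>
      have "Proj (a + 1) n (w j) = (\<lambda>x. Proj a n (w j) x + q x)"
      proof (rule Proj_unique[OF a1 up[OF wL]])
        show "(\<lambda>x. Proj a n (w j) x + q x) \<in> polys n" by (intro polys_add Proj_polys[OF a wL] q)
        have "orth (a + 1) n (\<lambda>x. z x - q x)" unfolding q_def by (rule Proj_orth[OF a1 up[OF z(1)]])
        then show "orth (a + 1) n (\<lambda>x. w j x - (Proj a n (w j) x + q x))" by (simp add: z_def diff_diff_eq)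
      qed
      then have eq: "(\<lambda>x. w j x - partial j (Proj a N u) x) = (\<lambda>x. z x - q x)"
        unfolding Suc Proj_partial[OF a u(1) wL w(1), symmetric] by (simp add: z_def diff_diff_eq)
      have N: "real n + 1 = real N" "1 \<le> real N" using Suc by simp_all
      have "sobolev_bounded r a z (C1 * real N powr rate r k * K)"
        using C1(2)[OF w(2)[of j], of n] unfolding z_def N(1) .
      \<comment> \<open>The inductive exponent \<open>rate r k\<close> lies strictly below
        \<open>e\<close>; the exponent of the result is decided by \<open>q\<close>.\<close>
      then have zs: "sobolev_bounded r a z (C1 * real N powr e * K)"
        by (rule sobolev_bounded_mono)
          (use C1(1) K N(2) in \<open>intro mult_right_mono mult_left_mono powr_mono; simp add: e rate_def\<close>)
      have "L2w_norm a q \<le> 2 * sqrt ((real n + a + 2) / (a + 1)) * L2w_norm a z"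
        unfolding q_def by (rule Proj_weight_bound[OF a z])
      also have "\<dots> \<le> (S * real N powr (1/2)) * (C0 * real N powr (- real k) * K)"
      proof (rule mult_mono)
        have "real n + a + 2 \<le> (a + 2) * real N"
          using a mult_nonneg_nonneg[of "a + 1" "real n"] by (simp add: N(1)[symmetric] algebra_simps)
        then have "(real n + a + 2) / (a + 1) \<le> (a + 2) / (a + 1) * real N"
          using a by (simp add: divide_right_mono)
        then have "sqrt ((real n + a + 2) / (a + 1)) \<le> sqrt ((a + 2) / (a + 1)) * sqrt (real N)"
          by (simp flip: real_sqrt_mult)
        then show "2 * sqrt ((real n + a + 2) / (a + 1)) \<le> S * real N powr (1/2)"
          by (simp add: S_def powr_half_sqrt)
        show "L2w_norm a z \<le> C0 * real N powr (- real k) * K"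
          using C0(2)[OF _ w(2)[of j], of n] unfolding z_def N(1) by blast
      qed (use S in auto)
      finally have "L2w_norm a q \<le> S * C0 * (real N powr (1/2) * real N powr (- real k)) * K" by (simp add: mult_ac)
      then have "(m * (real n + 1)\<^sup>2) ^ r * L2w_norm a q \<le> (m * (real n + 1)\<^sup>2) ^ r * (S * C0 * (real N powr (1/2) * real N powr (- real k)) * K)"
        using m by (intro mult_left_mono) auto
      also have "\<dots> = m ^ r * S * C0 * (real N powr (2 * real r) * (real N powr (1/2) * real N powr (- real k))) * K"
      proof -
        have "((real N)\<^sup>2) ^ r = real N powr (2 * real r)"
          using N(2) powr_realpow[of "real N" "2 * r"] by (simp add: power_mult)
        then show ?thesis unfolding N(1) by (simp add: power_mult_distrib mult_ac)
      qed
      also have "real N powr (2 * real r) * (real N powr (1/2) * real N powr (- real k)) = real N powr e"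
        unfolding powr_add[symmetric] by (rule arg_cong[where f = "(powr) (real N)"]) (simp add: e)
      finally have "sobolev_bounded r a q (m ^ r * S * C0 * real N powr e * K)"
        by (rule sobolev_bounded_mono[OF sobolev_bounded_polys[OF a q, of r, folded m_def]])
      from sobolev_bounded_diff[OF a zs this] show ?thesis unfolding eq
      proof (rule sobolev_bounded_mono)
        have "C1 * real N powr e * K + m ^ r * S * C0 * real N powr e * K = (C1 + m ^ r * S * C0) * real N powr e * K"
          by (simp add: algebra_simps)
        also have "\<dots> \<le> (C1 + m ^ r * S * C0) * (2 powr \<bar>e\<bar> * (real N + 1) powr e) * K"
          using C1(1) m S C0(1) K by (intro mult_right_mono mult_left_mono powr_shift_le N(2)) auto
        also have "\<dots> = (2 powr \<bar>e\<bar> * (C1 + m ^ r * S * C0)) * (real N + 1) powr e * K" by (simp add: mult_ac)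
        also have "\<dots> \<le> C * (real N + 1) powr e * K"
          using K by (intro mult_right_mono) (auto simp: C_def)
        finally show "C1 * real N powr e * K + m ^ r * S * C0 * real N powr e * K \<le> C * (real N + 1) powr e * K" .
      qed
    qed
    then show "sobolev_bounded (Suc r) a (\<lambda>x. u x - Proj a N u x) (C * (real N + 1) powr rate (Suc r) l * K)"
      using 0 wd Proj_diff_L2w[OF a u(1)] unfolding e_def by auto
  qed (rule C(1))
qed

text \<open>Both sides have the same integral against every polynomial.\<close>

lemma partial_commute_test:
  assumes t: "test_function \<phi>"
  shows "partial i (partial j \<phi>) = partial j (partial i \<phi>)"
proof
  fix x
  have tp: "test_function (partial i (partial j \<phi>))" for i j by (intro test_function_partial t)
  define f where "f x = partial i (partial j \<phi>) x - partial j (partial i \<phi>) x" for x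
  have c: "continuous_on UNIV f" unfolding f_def by (intro continuous_intros test_function_continuous tp)
  show "partial i (partial j \<phi>) x = partial j (partial i \<phi>) x"
  proof (cases "x \<in> unit_disk")
    case False
    then have "partial i (partial j \<phi>) x = 0" for i j
      using partial_eq_0_outside[of x "partial j \<phi>" i] test_function_support[OF test_function_partial[OF t, of j]] by blast
    then show ?thesis by simp
  next
    case True
    have "AE x in disk_measure. f x = 0"
    proof (rule AE_eq_0_if_orthogonal_polys)
      show "integrable disk_measure f" unfolding f_def
        by (intro Bochner_Integration.integrable_diff test_function_integrable tp)
      fix p N assume p: "p \<in> polys N"
      note I = locally_integrable_test[OF polys_locally_integrable]
      \<comment> \<open>Two integrations by parts move both derivatives onto \<open>p\<close>, in
        reversed order, where they commute by \<open>partial_commute_polys\<close>.\<close>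
      have k: "(LINT x|disk_measure. p x * partial i (partial j \<phi>) x) = (LINT x|disk_measure. partial j (partial i p) x * \<phi> x)" for i j
        by (simp add: integral_parts_test_polys[OF test_function_partial[OF t] p]
            integral_parts_test_polys[OF t partial_polys[OF p]])
      have "(LINT x|disk_measure. f x * p x) = (LINT x|disk_measure. p x * partial i (partial j \<phi>) x - p x * partial j (partial i \<phi>) x)"
        by (simp add: f_def algebra_simps)
      also have "\<dots> = (LINT x|disk_measure. p x * partial i (partial j \<phi>) x) - (LINT x|disk_measure. p x * partial j (partial i \<phi>) x)"
        by (intro Bochner_Integration.integral_diff I[OF p] tp)
      also have "\<dots> = 0" unfolding k partial_commute_polys[OF p, of i j] by simp
      finally show "(LINT x|disk_measure. f x * p x) = 0" .
    qed
    from continuous_AE_0_imp_0[OF c this True] show ?thesis by (simp add: f_def)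
  qed
qed

lemma test_function_funpow: "test_function \<phi> \<Longrightarrow> test_function ((partial i ^^ n) \<phi>)"
  by (induction n) (simp_all add: test_function_partial)

lemma test_function_partials: "test_function \<phi> \<Longrightarrow> test_function (partials \<beta> \<phi>)"
  by (simp add: partials_def test_function_funpow)

lemma partials_partial_2: "partials (i, j) (partial 2 \<phi>) = partials (i, Suc j) \<phi>"
  by (simp add: partials_def funpow_Suc_right del: funpow.simps)

text \<open>\<open>partials\<close> applies the derivatives in direction 2 innermost, so an extra
  derivative of the argument in direction 1 has to be commuted through them.\<close>

lemma partials_partial_1:
  assumes t: "test_function \<phi>"
  shows "partials (i, j) (partial 1 \<phi>) = partials (Suc i, j) \<phi>"
proof -
  have "(partial 2 ^^ j) (partial 1 \<phi>) = partial 1 ((partial 2 ^^ j) \<phi>)"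
    by (induction j) (simp_all add: partial_commute_test[OF test_function_funpow[OF t], of 2 1])
  then show ?thesis by (simp add: partials_def funpow_Suc_right del: funpow.simps)
qed

section \<open>Comparison with the given Sobolev norms\<close>

text \<open>A weak derivative chosen by \<open>SOME\<close> is at first only known to be locally
  integrable; exhausting the disk by closed balls makes it measurable, as membership in
  \<open>L2w\<close> requires.\<close>

lemma locally_integrable_measurable:
  assumes "locally_integrable u"
  shows "u \<in> borel_measurable disk_measure"
proof -
  define K where "K n = cball (0::real^2) (1 - inverse (real (Suc n)))" for n
  have K: "compact (K n)" "K n \<subseteq> unit_disk" for n
    by (auto simp: K_def unit_disk_def) (smt (verit) inverse_positive_iff_positive of_nat_0_less_iff zero_less_Suc of_nat_Suc)
  have "(\<lambda>x. indicator unit_disk x *\<^sub>R u x) \<in> borel_measurable lebesgue"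
  proof (rule borel_measurable_LIMSEQ_metric)
    show "(\<lambda>x. indicator (K n) x *\<^sub>R u x) \<in> borel_measurable lebesgue" for n
    proof -
      have "integrable lebesgue (\<lambda>x. indicator (K n) x *\<^sub>R u x)"
        using assms K[of n] by (simp add: locally_integrable_def set_integrable_def)
      then show ?thesis by (rule borel_measurable_integrable)
    qed
    fix x
    show "(\<lambda>n. indicator (K n) x *\<^sub>R u x) \<longlonglongrightarrow> indicator unit_disk x *\<^sub>R u x"
    proof (cases "x \<in> unit_disk")
      case True
      then have "0 < 1 - norm x" by (simp add: unit_disk_def)
      then have "\<forall>\<^sub>F n in sequentially. inverse (real (Suc n)) < 1 - norm x"
        by (rule order_tendstoD(2)[OF LIMSEQ_inverse_real_of_nat])
      then have "\<forall>\<^sub>F n in sequentially. indicator (K n) x *\<^sub>R u x = indicator unit_disk x *\<^sub>R u x"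
        by eventually_elim (use True in \<open>auto simp: K_def\<close>)
      then show ?thesis by (rule tendsto_eventually)
    next
      case False
      then have "x \<notin> K n" for n using K(2) by blast
      then show ?thesis using False by simp
    qed
  qed
  then show ?thesis by (simp add: borel_measurable_restrict_space_iff)
qed

lemma weak_deriv_unique:
  assumes v: "has_weak_deriv \<beta> u v" and w: "has_weak_deriv \<beta> u w"
  shows "AE x in disk_measure. v x = w x"
proof -
  have li: "locally_integrable v" "locally_integrable w" using v w by (auto simp: has_weak_deriv_def)
  have "AE x in disk_measure. v x - w x = 0"
  proof (rule AE_eq_0_if_orthogonal_test_functions)
    show "locally_integrable (\<lambda>x. v x - w x)"
      unfolding locally_integrable_def
    proof (intro allI impI)
      fix K assume "compact K \<and> K \<subseteq> unit_disk"
      then have "v absolutely_integrable_on K" "w absolutely_integrable_on K"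
        using li unfolding locally_integrable_def by blast+
      then show "(\<lambda>x. v x - w x) absolutely_integrable_on K" by (rule set_integral_diff(1))
    qed
    fix \<phi> assume t: "test_function \<phi>"
    have "(LINT x|disk_measure. u x * partials \<beta> \<phi> x) = (- 1) ^ (fst \<beta> + snd \<beta>) * (LINT x|disk_measure. v x * \<phi> x)"
      using v t unfolding has_weak_deriv_def by blast
    moreover have "(LINT x|disk_measure. u x * partials \<beta> \<phi> x) = (- 1) ^ (fst \<beta> + snd \<beta>) * (LINT x|disk_measure. w x * \<phi> x)"
      using w t unfolding has_weak_deriv_def by blast
    ultimately have "(- 1) ^ (fst \<beta> + snd \<beta>) * (LINT x|disk_measure. v x * \<phi> x) = (- 1) ^ (fst \<beta> + snd \<beta>) * (LINT x|disk_measure. w x * \<phi> x)"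
      by (rule trans[OF sym])
    then have "(LINT x|disk_measure. v x * \<phi> x) = (LINT x|disk_measure. w x * \<phi> x)" by simp
    then show "(LINT x|disk_measure. (v x - w x) * \<phi> x) = 0"
      using locally_integrable_test[OF li(1) t] locally_integrable_test[OF li(2) t] by (simp add: left_diff_distrib)
  qed
  then show ?thesis by simp
qed

text \<open>The choice made by \<open>weak_deriv\<close> need not be the witness \<open>v\<close>,
  but it agrees with \<open>v\<close> almost everywhere and so inherits membership and norm.\<close>

lemma weak_deriv_representative:
  assumes h: "has_weak_deriv \<beta> u v" and v: "v \<in> L2w a"
  shows "has_weak_deriv \<beta> u (weak_deriv \<beta> u)" "weak_deriv \<beta> u \<in> L2w a"
    "L2w_norm a (weak_deriv \<beta> u) = L2w_norm a v"
proof -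
  show s: "has_weak_deriv \<beta> u (weak_deriv \<beta> u)" unfolding weak_deriv_def
    by (rule someI[of "has_weak_deriv \<beta> u", OF h])
  then have "weak_deriv \<beta> u \<in> borel_measurable disk_measure"
    by (intro locally_integrable_measurable) (simp add: has_weak_deriv_def)
  from L2w_AE_cong[OF v this weak_deriv_unique[OF h s]]
  show "weak_deriv \<beta> u \<in> L2w a" "L2w_norm a (weak_deriv \<beta> u) = L2w_norm a v" .
qed

text \<open>The outermost derivative in \<open>partials\<close> is in direction 1 as long as
  \<open>i > 0\<close>. Peeling it off matches the first link of the chain, and no derivatives are
  interchanged.\<close>

lemma sobolev_bounded_weak_deriv:
  assumes a: "-1 < a"
  shows "sobolev_bounded r a u K \<Longrightarrow> i + j \<le> r \<Longrightarrow> \<exists>v\<in>L2w a. has_weak_deriv (i, j) u v \<and> L2w_norm a v \<le> K"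
proof (induction r arbitrary: u i j)
  case 0
  then have "u \<in> L2w a" "L2w_norm a u \<le> K" by auto
  then show ?case using 0
    by (intro bexI[of _ u]) (auto simp: has_weak_deriv_def partials_def L2w_locally_integrable[OF a])
next
  case (Suc r)
  have u: "u \<in> L2w a" "L2w_norm a u \<le> K" using Suc.prems by auto
  have step: "\<exists>v\<in>L2w a. has_weak_deriv (i, j) u v \<and> L2w_norm a v \<le> K"
    if w: "weak_partial k u w" "sobolev_bounded r a w K" and ij: "i' + j' \<le> r" "i + j = Suc (i' + j')"
      and p: "\<And>\<phi>. partials (i, j) \<phi> = partial k (partials (i', j') \<phi>)" for k w i' j'
  proof -
    obtain v where v: "v \<in> L2w a" "has_weak_deriv (i', j') w v" "L2w_norm a v \<le> K"
      using Suc.IH[OF w(2) ij(1)] by blast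
    have "has_weak_deriv (i, j) u v"
      unfolding has_weak_deriv_def
    proof (intro conjI allI impI)
      fix \<phi> assume t: "test_function \<phi>"
      have "(LINT x|disk_measure. u x * partials (i, j) \<phi> x) = - (LINT x|disk_measure. w x * partials (i', j') \<phi> x)"
        using w(1) test_function_partials[OF t] by (simp add: p weak_partial_def)
      also have "\<dots> = (- 1) ^ (i + j) * (LINT x|disk_measure. v x * \<phi> x)"
        using v(2) t by (simp add: has_weak_deriv_def ij(2))
      finally show "(LINT x|disk_measure. u x * partials (i, j) \<phi> x) = (- 1) ^ (fst (i, j) + snd (i, j)) * (LINT x|disk_measure. v x * \<phi> x)"
        by simp
    qed (use L2w_locally_integrable[OF a] u v in auto)
    then show ?thesis using v by blast
  qed
  have "\<forall>k. \<exists>w. weak_partial k u w \<and> sobolev_bounded r a w K" using Suc.prems(1) by simp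
  then obtain w where w: "weak_partial k u (w k)" "sobolev_bounded r a (w k) K" for k by metis
  show ?case
  proof (cases i)
    case (Suc i')
    show ?thesis
      by (rule step[OF w, of i' j 1]) (use Suc Suc.prems(2) in \<open>simp_all add: partials_def\<close>)
  next
    case 0
    show ?thesis
    proof (cases j)
      case 0
      then show ?thesis using u \<open>i = 0\<close>
        by (intro bexI[of _ u]) (auto simp: has_weak_deriv_def partials_def L2w_locally_integrable[OF a])
    next
      case (Suc j')
      show ?thesis
        by (rule step[OF w, of 0 j' 2]) (use Suc \<open>i = 0\<close> Suc.prems(2) in \<open>simp_all add: partials_def\<close>)
    qed
  qed
qed

lemma Hw_norm_le:
  assumes a: "-1 < a" and s: "sobolev_bounded r a u K"
  shows "Hw_norm r a u \<le> sqrt (\<Sum>k\<le>r. real (card (multi_indices k))) * K"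
proof -
  have K: "0 \<le> K" by (rule sobolev_bounded_nonneg[OF s])
  have le: "(L2w_norm a (weak_deriv \<beta> u))\<^sup>2 \<le> K\<^sup>2" if "k \<le> r" "\<beta> \<in> multi_indices k" for k \<beta>
  proof -
    have "fst \<beta> + snd \<beta> \<le> r" using that by (auto simp: multi_indices_def)
    then obtain v where v: "v \<in> L2w a" "has_weak_deriv \<beta> u v" "L2w_norm a v \<le> K"
      using sobolev_bounded_weak_deriv[OF a s, of "fst \<beta>" "snd \<beta>"] by auto
    then show ?thesis using weak_deriv_representative(3)[OF v(2,1)] by (intro power_mono) auto
  qed
  have "(\<Sum>k\<le>r. \<Sum>\<beta>\<in>multi_indices k. (L2w_norm a (weak_deriv \<beta> u))\<^sup>2) \<le> (\<Sum>k\<le>r. \<Sum>\<beta>\<in>multi_indices k. K\<^sup>2)"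
    by (intro sum_mono le) auto
  also have "\<dots> = (\<Sum>k\<le>r. real (card (multi_indices k))) * K\<^sup>2"
    by (simp add: sum_distrib_right)
  finally have "Hw_norm r a u \<le> sqrt ((\<Sum>k\<le>r. real (card (multi_indices k))) * K\<^sup>2)"
    unfolding Hw_norm_def by (rule real_sqrt_le_mono)
  then show ?thesis using K by (simp add: real_sqrt_mult)
qed

text \<open>The chains run through all orders of directions, so each \<open>D i j\<close> must have
  weak derivatives in both. Raising one index of \<open>D i j\<close> is where mixed derivatives are
  interchanged.\<close>

lemma Hw_sobolev_bounded:
  assumes a: "-1 < a" and u: "u \<in> Hw l a"
  shows "sobolev_bounded l a u (Hw_norm l a u)"
proof -
  define K where "K = Hw_norm l a u"
  define D where "D i j = weak_deriv (i, j) u" for i j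
  have uL: "u \<in> L2w a" using u by (simp add: Hw_def)
  have D: "has_weak_deriv (i, j) u (D i j)" "D i j \<in> L2w a" "L2w_norm a (D i j) \<le> K" if ij: "i + j \<le> l" for i j
  proof -
    have m: "(i, j) \<in> multi_indices (i + j)" by (simp add: multi_indices_def)
    then obtain v where "v \<in> L2w a" "has_weak_deriv (i, j) u v" using u ij unfolding Hw_def by blast
    then show "has_weak_deriv (i, j) u (D i j)" "D i j \<in> L2w a"
      unfolding D_def using weak_deriv_representative by blast+
    have "(L2w_norm a (D i j))\<^sup>2 \<le> (\<Sum>\<beta>\<in>multi_indices (i + j). (L2w_norm a (weak_deriv \<beta> u))\<^sup>2)"
      unfolding D_def using member_le_sum[OF m, of "\<lambda>\<beta>. (L2w_norm a (weak_deriv \<beta> u))\<^sup>2"] by simp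
    also have "\<dots> \<le> (\<Sum>k\<le>l. \<Sum>\<beta>\<in>multi_indices k. (L2w_norm a (weak_deriv \<beta> u))\<^sup>2)"
      using ij by (intro member_le_sum[of _ _ "\<lambda>k. \<Sum>\<beta>\<in>multi_indices k. (L2w_norm a (weak_deriv \<beta> u))\<^sup>2"]) (auto intro: sum_nonneg)
    finally show "L2w_norm a (D i j) \<le> K"
      unfolding K_def Hw_norm_def by (rule real_le_rsqrt)
  qed
  have wd: "weak_partial 1 (D i j) (D (Suc i) j)" "weak_partial 2 (D i j) (D i (Suc j))" if ij: "Suc (i + j) \<le> l" for i j
  proof -
    have h0: "has_weak_deriv (i, j) u (D i j)" using D(1) ij by simp
    have key: "weak_partial k (D i j) v"
      if h: "has_weak_deriv (i', j') u v" and s: "i' + j' = Suc (i + j)"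
        and p: "\<And>\<phi>. test_function \<phi> \<Longrightarrow> partials (i, j) (partial k \<phi>) = partials (i', j') \<phi>" for k v i' j'
      unfolding weak_partial_def
    proof (intro conjI allI impI)
      show "locally_integrable (D i j)" "locally_integrable v" using h0 h by (auto simp: has_weak_deriv_def)
      fix \<phi> assume t: "test_function \<phi>"
      have "(LINT x|disk_measure. u x * partials (i, j) (partial k \<phi>) x) = (- 1) ^ (i + j) * (LINT x|disk_measure. D i j x * partial k \<phi> x)"
        using h0 test_function_partial[OF t] by (auto simp: has_weak_deriv_def)
      moreover have "(LINT x|disk_measure. u x * partials (i', j') \<phi> x) = (- 1) ^ (i' + j') * (LINT x|disk_measure. v x * \<phi> x)"
        using h t by (auto simp: has_weak_deriv_def)
      ultimately have "(- 1) ^ (i + j) * (LINT x|disk_measure. D i j x * partial k \<phi> x) = (- 1) ^ (i + j) * - (LINT x|disk_measure. v x * \<phi> x)"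
        using p[OF t] s by simp
      then show "(LINT x|disk_measure. D i j x * partial k \<phi> x) = - (LINT x|disk_measure. v x * \<phi> x)"
        by (subst (asm) mult_cancel_left) simp
    qed
    show "weak_partial 1 (D i j) (D (Suc i) j)"
      by (rule key[OF D(1)]) (use ij partials_partial_1 in auto)
    show "weak_partial 2 (D i j) (D i (Suc j))"
      by (rule key[OF D(1)]) (use ij partials_partial_2 in auto)
  qed
  have sD: "sobolev_bounded n a (D i j) K" if "i + j + n \<le> l" for n i j
    using that
  proof (induction n arbitrary: i j)
    case 0
    then show ?case using D by simp
  next
    case (Suc n)
    have "\<exists>w. weak_partial k (D i j) w \<and> sobolev_bounded n a w K" for k
      using exhaust_2[of k] wd[of i j] Suc.IH[of "Suc i" j] Suc.IH[of i "Suc j"] Suc.prems by auto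
    then show ?case using D[of i j] Suc.prems by simp
  qed
  \<comment> \<open>\<open>u\<close> agrees with \<open>D 0 0\<close> only almost everywhere, so its
    norm and its first derivatives are supplied separately.\<close>
  have "has_weak_deriv (0, 0) u u"
    by (simp add: has_weak_deriv_def partials_def L2w_locally_integrable[OF a uL])
  then have nu: "L2w_norm a u \<le> K"
    using weak_deriv_representative(3)[OF _ uL, of "(0, 0)" u] D(3)[of 0 0] by (simp add: D_def)
  show ?thesis
  proof (cases l)
    case 0
    then show ?thesis using uL nu by (simp add: K_def)
  next
    case (Suc n)
    have "weak_partial 1 u (D 1 0)" "weak_partial 2 u (D 0 1)"
      using D(1)[of 1 0] D(1)[of 0 1] Suc by (auto simp: weak_partial_def has_weak_deriv_def partials_def)
    then have "\<exists>w. weak_partial k u w \<and> sobolev_bounded n a w K" for k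
      using exhaust_2[of k] sD[of 1 0 n] sD[of 0 1 n] Suc by auto
    then have "sobolev_bounded (Suc n) a u K" using uL nu by simp
    then show ?thesis using Suc by (simp only: K_def)
  qed
qed

theorem theorem3p9:
  fixes \<alpha> :: real and r l :: nat
  assumes "\<alpha> > -1" and "1 \<le> r" and "r \<le> l"
  shows "\<exists>C>0. \<forall>N\<ge>1. \<forall>u\<in>Hw l \<alpha>.
    Hw_norm r \<alpha> (\<lambda>x. u x - Proj \<alpha> N u x)
      \<le> C * real N powr (- (1/2) + 2 * real r - real l) * Hw_norm l \<alpha> u"
proof -
  define e where "e = - (1/2) + 2 * real r - real l"
  have e: "rate r l = e" using assms(2) by (simp add: rate_def e_def)
  obtain C where C: "1 \<le> C" "\<And>N u K. sobolev_bounded l \<alpha> u K \<Longrightarrow>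
     sobolev_bounded r \<alpha> (\<lambda>x. u x - Proj \<alpha> N u x) (C * (real N + 1) powr e * K)"
    using projection_error[OF assms(1,3)] unfolding e by blast
  define S where "S = sqrt (\<Sum>k\<le>r. real (card (multi_indices k)))"
  have S: "0 \<le> S" by (simp add: S_def sum_nonneg)
  show ?thesis
  \<comment> \<open>\<open>S\<close> comes from counting multi-indices and the power of 2 from
    replacing \<open>N + 1\<close> by \<open>N\<close>; the added 1 makes positivity of the constant
    immediate.\<close>
  proof (intro exI[of _ "(S + 1) * C * 2 powr \<bar>e\<bar>"] conjI allI impI ballI)
    show "0 < (S + 1) * C * 2 powr \<bar>e\<bar>" using S C(1) by simp
    fix N :: nat and u assume N: "1 \<le> N" and u: "u \<in> Hw l \<alpha>"
    define K where "K = Hw_norm l \<alpha> u"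
    have s: "sobolev_bounded l \<alpha> u K" unfolding K_def by (rule Hw_sobolev_bounded[OF assms(1) u])
    have K: "0 \<le> K" by (rule sobolev_bounded_nonneg[OF s])
    have "Hw_norm r \<alpha> (\<lambda>x. u x - Proj \<alpha> N u x) \<le> S * (C * (real N + 1) powr e * K)"
      unfolding S_def by (rule Hw_norm_le[OF assms(1) C(2)[OF s]])
    also have "\<dots> \<le> (S + 1) * (C * (2 powr \<bar>e\<bar> * real N powr e) * K)"
      using S C(1) K N by (intro mult_mono mult_right_mono mult_left_mono powr_shift_le') auto
    finally show "Hw_norm r \<alpha> (\<lambda>x. u x - Proj \<alpha> N u x)
      \<le> (S + 1) * C * 2 powr \<bar>e\<bar> * real N powr (- (1/2) + 2 * real r - real l) * Hw_norm l \<alpha> u"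
      by (simp add: e_def K_def mult_ac)
  qed
qed

end
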